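(* Let $k\geq 3$ and let $\chi$ be a primitive even Dirichlet character modulo $k$, with complex conjugate character $\overline{\chi}$. For $0<\Re(s)<1$ and $n\geq1$ let $$\xi_n(s,\chi)=n^{-s}\left(\frac{\pi}{k}\right)^{\frac{s}{2}}\Gamma\!\left(\frac{s}{2}\right)L_n(s,\chi).$$ The following are equivalent: (i) for all $s$ with $0<\Re(s)<1$ and $\Im(s)\geq 8$ we have $\displaystyle\lim_{n\to\infty}\frac{|\xi_n(s,\chi)|}{|\xi_n(1-s,\overline{\chi})|}=1$; (ii) every zero of $L(s,\chi)$ in the region $0<\Re(s)<1$, $\Im(s)\geq 8$ has real part $\frac12$.
   Context: A Dirichlet character $\chi$ modulo $k$ is even if $\chi(-1)=1$. For $n\geq 1$, $L_n(s,\chi):=\sum_{j=1}^{kn-1}\chi(j)\,\sin\!\left(\frac{\pi j}{kn}\right)^{-s}$ (the normalized $L$-function of the cyclic graph $\mathbb{Z}/kn\mathbb{Z}$). $L(s,\chi)=\sum_{j\geq1}\chi(j)j^{-s}$ is the Dirichlet $L$-function (series for $\Re(s)>0$, analytic continuation elsewhere). $\Gamma$ is the Euler Gamma function. *)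

theory Defs
  imports "HOL-Complex_Analysis.Complex_Analysis" "HOL-Number_Theory.Number_Theory"
begin

(* Characters are extended by zero to all integers, so that the values at -1 and at
   representatives j = 1, ..., kn - 1 make sense. *)
definition dirichlet_character :: "nat \<Rightarrow> (int \<Rightarrow> complex) \<Rightarrow> bool" where
  "dirichlet_character k chi \<longleftrightarrow>
     k > 0 \<and>
     (\<forall>a. chi (a + int k) = chi a) \<and>
     (\<forall>a b. chi (a * b) = chi a * chi b) \<and>
     (\<forall>a. chi a \<noteq> 0 \<longleftrightarrow> coprime a (int k))"

definition even_character :: "(int \<Rightarrow> complex) \<Rightarrow> bool" where
  "even_character chi \<longleftrightarrow> chi (-1) = 1"

(* Induced moduli and primitivity as in Apostol, Introduction to Analytic Number Theory,
   Section 8.7. *)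
definition induced_modulus :: "nat \<Rightarrow> (int \<Rightarrow> complex) \<Rightarrow> nat \<Rightarrow> bool" where
  "induced_modulus k chi d \<longleftrightarrow>
     d dvd k \<and> (\<forall>a. coprime a (int k) \<and> [a = 1] (mod int d) \<longrightarrow> chi a = 1)"

definition primitive_character :: "nat \<Rightarrow> (int \<Rightarrow> complex) \<Rightarrow> bool" where
  "primitive_character k chi \<longleftrightarrow>
     dirichlet_character k chi \<and> (\<forall>d<k. \<not> induced_modulus k chi d)"

(* For Re s > 0 this is the ordered, in general only conditionally convergent, series;
   for Re s \<le> 0 it is the value of the entire continuation.  Only meaningful for
   non-principal characters (the series then converges for Re s > 0); primitive
   characters of modulus k > 1 are non-principal. *)
definition dirichlet_L :: "(int \<Rightarrow> complex) \<Rightarrow> complex \<Rightarrow> complex" where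
  "dirichlet_L chi s =
     (if Re s > 0 then \<Sum>j. chi (int (Suc j)) * of_nat (Suc j) powr (-s)
      else (THE f. f holomorphic_on UNIV \<and>
              (\<forall>z. Re z > 0 \<longrightarrow>
                 (\<lambda>j. chi (int (Suc j)) * of_nat (Suc j) powr (-z)) sums f z)) s)"

(* The sines are positive for 0 < j < k * n, so powr is the ordinary power of a
   positive real. *)
definition cyclic_L :: "nat \<Rightarrow> (int \<Rightarrow> complex) \<Rightarrow> nat \<Rightarrow> complex \<Rightarrow> complex" where
  "cyclic_L k chi n s =
     (\<Sum>j = 1..k * n - 1.
        chi (int j) * complex_of_real (sin (pi * real j / real (k * n))) powr (-s))"

definition cyclic_xi :: "nat \<Rightarrow> (int \<Rightarrow> complex) \<Rightarrow> nat \<Rightarrow> complex \<Rightarrow> complex" where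
  "cyclic_xi k chi n s =
     of_nat n powr (-s) * complex_of_real (pi / real k) powr (s / 2) * Gamma (s / 2) *
       cyclic_L k chi n s"

end

theory Submission
  imports Defs "HOL-Real_Asymp.Real_Asymp"
begin

text \<open>
  Expand \<open>(sin x)\<^sup>-\<^sup>s\<close> into its Fourier series, whose coefficients are, up to a factor \<open>K(s)\<close>,
  \<open>\<Gamma>(m + s/2) / \<Gamma>(m + 1 - s/2)\<close>. Summing against a primitive even character of Gauss sum \<open>\<tau>\<close> gives
  the exact dual formula
  \<open>L\<^sub>n(s, \<chi>) = 2 n \<tau> K(s) \<Sum>\<^sub>l \<chi>'(l) \<Gamma>(n l + s/2) / \<Gamma>(n l + 1 - s/2)\<close> with \<open>\<chi>'\<close> the conjugate of \<open>\<chi>\<close>,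
  and the Gamma quotient is \<open>m\<^sup>s\<^sup>-\<^sup>1 (1 - s(s - 1)(s - 2) / (24 m\<^sup>2) + o(m\<^sup>-\<^sup>2))\<close>. Hence \<open>\<xi>\<^sub>n(s, \<chi>)\<close> has a limit
  proportional to \<open>L(1 - s, \<chi>')\<close> and an explicit \<open>n\<^sup>-\<^sup>2\<close> term proportional to \<open>L(3 - s, \<chi>')\<close>. Summation by
  parts shows that the limit is also the completed \<open>L(s, \<chi>)\<close>, which is the functional equation; so
  the ratio tends to 1 wherever \<open>L(s, \<chi>) \<noteq> 0\<close>. At a zero the ratio of the \<open>n\<^sup>-\<^sup>2\<close> terms decides. It is 1 only on
  the critical line because, apart from the elementary factor \<open>\<bar>s(2 - s)\<bar> / \<bar>1 - s\<^sup>2\<bar>\<close>, it compares the values at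
  \<open>1 - Re s\<close> and \<open>Re s\<close> of \<open>\<sigma> \<mapsto> (k/\<pi>)\<^sup>\<sigma>\<^sup>/\<^sup>2 \<bar>\<Gamma>(1 + (\<sigma> + i t)/2) L(2 + \<sigma> + i t, \<chi>)\<bar>\<close>, which strictly increases for
  \<open>t \<ge> 8\<close>: its logarithmic derivative is at least \<open>ln 2 + ln (3/\<pi>) / 2 + \<zeta>'(2)/\<zeta>(2) > 0\<close>.
\<close>

section \<open>Growth of the completed \<open>L\<close>-function\<close>

text \<open>The obstacle is the strip itself: there the Fourier coefficients decay only like
  \<open>m\<close> to the power \<open>Re s - 1\<close>, so the expansion does not converge
  absolutely. Multiplication by \<open>4 * (sin x)^2\<close> acts on the coefficients as a second
  difference and turns the series for \<open>s\<close> into the one for \<open>s - 2\<close>. Two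
  such steps lead to \<open>Re s < -3\<close>, where convergence is uniform and a first-order
  differential equation together with one integral identifies the sum.

  The order \<open>n^-2\<close> has a structural reason: the shifts \<open>s / 2\<close> and
  \<open>1 - s / 2\<close> in the Gamma quotient add up to 1, which removes its \<open>1 / m\<close>
  term. It also moves the decisive \<open>L\<close>-value to \<open>3 - s\<close>, of real part
  above 2, where the Dirichlet series controls modulus and logarithmic derivative.

  The height 8 comes from the digamma function. At height \<open>t\<close> its argument has
  imaginary part \<open>t / 2\<close>, and its contribution to the logarithmic derivative is at
  least \<open>ln ((t / 2)^2) / 4\<close>, which equals \<open>ln 2\<close> at \<open>t = 8\<close>.
  This exceeds the possible losses, bounded by 0.622 from the \<open>L\<close>-value and 0.024 from
  \<open>k / pi\<close>, by a narrow margin.\<close>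

lemma ln_quotient_ge:
  fixes r :: real
  assumes "0 \<le> r" "r < 1"
  shows "2 * r \<le> ln ((1 + r) / (1 - r))"
proof -
  have *: "\<exists>y. ((\<lambda>r. ln (1 + r) - ln (1 - r) - 2 * r) has_real_derivative y) (at x) \<and> y \<ge> 0"
    if "0 \<le> x" "x \<le> r" for x
  proof -
    have "((\<lambda>r. ln (1 + r) - ln (1 - r) - 2 * r) has_real_derivative
            (1 / (1 + x) + 1 / (1 - x) - 2)) (at x)"
      using that assms by (auto intro!: derivative_eq_intros)
    moreover have "1 / (1 + x) + 1 / (1 - x) - 2 = 2 * x\<^sup>2 / ((1 + x) * (1 - x))"
    proof -
      have "x * x < 1 * 1" using that assms by (intro mult_strict_mono') auto
      thus ?thesis using that assms by (simp add: divide_simps power2_eq_square) (simp add: algebra_simps)?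
    qed
    moreover have "2 * x\<^sup>2 / ((1 + x) * (1 - x)) \<ge> 0" using that assms by simp
    ultimately show ?thesis by metis
  qed
  have "ln (1 + 0) - ln (1 - 0) - 2 * 0 \<le> ln (1 + r) - ln (1 - r) - 2 * r"
    by (rule DERIV_nonneg_imp_nondecreasing[OF assms(1)]) (use * in auto)
  thus ?thesis using assms by (simp add: ln_div)
qed

text \<open>With \<open>v = Re z + n\<close> and \<open>r = Re (1 / (z + n))\<close>, the quotient
  \<open>(1 + r) / (1 - r)\<close> is the value of \<open>x^2 - x + y^2\<close> at
  \<open>x = v + 1\<close> over its value at \<open>x = v\<close>. So
  \<open>2 * r <= ln ((1 + r) / (1 - r))\<close> makes the partial sums in the limit formula of
  Digamma telescope.\<close>

lemma Re_Digamma_ge: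
  fixes z :: complex
  assumes "Re z > 0" "Im z \<noteq> 0" and pos: "(Re z)\<^sup>2 - Re z + (Im z)\<^sup>2 > 0"
  shows "ln ((Re z)\<^sup>2 - Re z + (Im z)\<^sup>2) / 2 \<le> Re (Digamma z)"
proof -
  define x y where "x = Re z" and "y = Im z"
  define Psi where "Psi = (\<lambda>v. ln (v\<^sup>2 - v + y\<^sup>2) / 2)"
  have step: "Re (inverse (z + of_nat n)) \<le> Psi (x + real (Suc n)) - Psi (x + real n)" for n
  proof -
    define v where "v = x + real n"
    define r where "r = v / (v\<^sup>2 + y\<^sup>2)"
    have v: "v > 0" using assms by (simp add: v_def x_def)
    have y: "y\<^sup>2 > 0" using assms by (simp add: y_def)
    have D: "v\<^sup>2 + y\<^sup>2 > 0" using y by (simp add: add_nonneg_pos)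
    have "v\<^sup>2 - v + y\<^sup>2 = x\<^sup>2 - x + y\<^sup>2 + (real n * (real n - 1) + 2 * real n * x)"
      by (simp add: v_def power2_eq_square algebra_simps)
    moreover have "real n * (real n - 1) + 2 * real n * x \<ge> 0"
      using assms(1) by (cases n) (auto simp: x_def)
    ultimately have E: "v\<^sup>2 - v + y\<^sup>2 > 0" using pos by (simp add: x_def y_def)
    have r: "0 \<le> r" "r < 1" using v D E by (auto simp: r_def divide_simps)
    have "Re (inverse (z + of_nat n)) = r"
      by (simp add: r_def v_def x_def y_def add.commute)
    also have "\<dots> \<le> ln ((1 + r) / (1 - r)) / 2" using ln_quotient_ge[OF r] by simp
    also have "(1 + r) / (1 - r) = ((v + 1)\<^sup>2 - (v + 1) + y\<^sup>2) / (v\<^sup>2 - v + y\<^sup>2)"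
      using D E by (simp add: r_def divide_simps power2_eq_square) (simp add: algebra_simps)
    also have "ln \<dots> / 2 = Psi (v + 1) - Psi v"
    proof -
      have "(v + 1)\<^sup>2 - (v + 1) + y\<^sup>2 > 0" using D v by (simp add: power2_eq_square algebra_simps add_pos_pos)
      thus ?thesis using E by (simp add: Psi_def ln_div diff_divide_distrib)
    qed
    finally show ?thesis by (simp add: v_def algebra_simps)
  qed
  have "Re (\<Sum>n<m. inverse (z + of_nat n)) \<le> Psi (x + real m) - Psi x" for m
  proof -
    have "(\<Sum>n<m. Re (inverse (z + of_nat n))) \<le> (\<Sum>n<m. Psi (x + real (Suc n)) - Psi (x + real n))"
      by (intro sum_mono step)
    also have "\<dots> = Psi (x + real m) - Psi x"
      using sum_lessThan_telescope[of "\<lambda>n. Psi (x + real n)" m] by simp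
    finally show ?thesis by (simp only: Re_sum)
  qed
  hence le: "ln (real m) - Psi (x + real m) + Psi x \<le> Re (of_real (ln (real m)) - (\<Sum>n<m. inverse (z + of_nat n)))" for m
    by (simp add: algebra_simps)
  have "(\<lambda>m. Re (of_real (ln (real m)) - (\<Sum>n<m. inverse (z + of_nat n)))) \<longlonglongrightarrow> Re (Digamma z)"
    using assms by (intro tendsto_Re Digamma_LIMSEQ) auto
  moreover have "(\<lambda>m. ln (real m) - Psi (x + real m) + Psi x) \<longlonglongrightarrow> 0 + Psi x"
    unfolding Psi_def by (intro tendsto_add tendsto_const) real_asymp
  ultimately have "0 + Psi x \<le> Re (Digamma z)"
    using le by (blast intro: LIMSEQ_le)
  thus ?thesis by (simp add: Psi_def x_def y_def)
qed

text \<open>Writing \<open>ln |f|\<close> as half of \<open>ln (Re^2 + Im^2)\<close> avoids the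
  choice of a branch of the complex logarithm.\<close>

lemma has_real_derivative_ln_cmod:
  assumes "(f has_field_derivative D) (at (of_real x + w))" and nz: "f (of_real x + w) \<noteq> 0"
  shows "((\<lambda>x. ln (cmod (f (of_real x + w)))) has_real_derivative Re (D / f (of_real x + w))) (at x)"
proof -
  define g where "g = (\<lambda>x::real. f (of_real x + w))"
  have "((\<lambda>x. of_real x + w) has_vector_derivative 1) (at x)"
    by (auto intro!: derivative_eq_intros)
  from field_vector_diff_chain_at[OF this assms(1)]
  have g: "(g has_vector_derivative D) (at x)" by (simp add: g_def o_def)
  have gR: "((\<lambda>x. Re (g x)) has_real_derivative Re D) (at x)"
    and gI: "((\<lambda>x. Im (g x)) has_real_derivative Im D) (at x)"
    using g by (auto simp: has_real_derivative_iff_has_vector_derivative intro: bounded_linear.has_vector_derivative[OF bounded_linear_Re] bounded_linear.has_vector_derivative[OF bounded_linear_Im])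
  have nz': "(Re (g x))\<^sup>2 + (Im (g x))\<^sup>2 > 0" using nz by (simp add: g_def sum_power2_gt_zero_iff complex_eq_iff)
  have "((\<lambda>x. (Re (g x))\<^sup>2 + (Im (g x))\<^sup>2) has_real_derivative 2 * (Re (g x) * Re D + Im (g x) * Im D)) (at x)"
    by (rule derivative_eq_intros gR gI refl)+ simp
  from DERIV_cmult[OF DERIV_chain2[OF DERIV_ln[OF nz'] this], of "1 / 2"]
  have "((\<lambda>x. 1 / 2 * ln ((Re (g x))\<^sup>2 + (Im (g x))\<^sup>2)) has_real_derivative
          (Re (g x) * Re D + Im (g x) * Im D) / ((Re (g x))\<^sup>2 + (Im (g x))\<^sup>2)) (at x)"
    by (rule DERIV_cong) (simp only: divide_inverse, simp only: mult.assoc mult.commute mult.left_commute, simp)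
  moreover have "1 / 2 * ln ((Re z)\<^sup>2 + (Im z)\<^sup>2) = ln (cmod z)" for z
    by (cases "z = 0") (auto simp: cmod_def ln_sqrt sum_power2_gt_zero_iff complex_eq_iff)
  moreover have "(Re (g x) * Re D + Im (g x) * Im D) / ((Re (g x))\<^sup>2 + (Im (g x))\<^sup>2) = Re (D / g x)"
    by (simp only: Re_divide mult.commute)
  ultimately show ?thesis by (simp only: g_def)
qed

section \<open>Logarithmic derivatives through the von Mangoldt function, with numerical
  bounds\<close>

text \<open>This is \<open>- L' = (- L' / L) * L\<close>. The divisor sum of \<open>mangoldt\<close>
  is \<open>ln n\<close>; multiplied by \<open>g n = g d * g (n div d)\<close> it becomes a sum over
  pairs \<open>(d, e)\<close> with \<open>d * e = n\<close>, and absolute summability of the double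
  family lets it factor.\<close>

lemma suminf_mangoldt_convolution:
  fixes g :: "nat \<Rightarrow> complex"
  assumes mult: "\<And>m n. g (m * n) = g m * g n" and g0: "g 0 = 0"
    and sg: "summable (\<lambda>n. norm (g n))" and sl: "summable (\<lambda>n. ln (real n) * norm (g n))"
  shows "summable (\<lambda>n. norm (mangoldt n * g n))"
    and "(\<Sum>n. of_real (ln (real n)) * g n) = (\<Sum>n. mangoldt n * g n) * (\<Sum>n. g n)"
proof -
  have mnn: "(mangoldt d :: real) \<ge> 0" for d
    using aprimedivisor_pos_nat[of d] primepow_gt_Suc_0[of d] by (auto simp: mangoldt_def Suc_le_eq)
  have mle: "(mangoldt n :: real) \<le> ln (real n)" for n
  proof (cases "n = 0")
    case False
    have "(mangoldt n :: real) \<le> (\<Sum>d | d dvd n. mangoldt d)"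
      by (rule member_le_sum) (use False mnn in auto)
    thus ?thesis using mangoldt_sum[OF False, where 'a = real] by simp
  qed auto
  have nm: "norm (mangoldt n :: complex) = mangoldt n" for n
  proof -
    have "norm (mangoldt n :: complex) = norm (of_real (mangoldt n :: real) :: complex)"
      by (simp only: of_real_mangoldt)
    also have "\<dots> = mangoldt n" using mnn[of n] by (simp only: norm_of_real abs_of_nonneg)
    finally show ?thesis .
  qed
  show S: "summable (\<lambda>n. norm (mangoldt n * g n))"
    by (rule summable_comparison_test'[OF sl, of 0]) (auto simp: norm_mult nm abs_mult mnn intro!: mult_right_mono mle)
  define f where "f = (\<lambda>(d, e). mangoldt d * g d * g e)"
  have a1: "Infinite_Sum.abs_summable_on (\<lambda>n. mangoldt n * g n) UNIV"
    using S by (simp add: summable_nonneg_imp_summable_on)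
  have a2: "Infinite_Sum.abs_summable_on g UNIV" using sg by (simp add: summable_nonneg_imp_summable_on)
  have "Infinite_Sum.abs_summable_on f (UNIV \<times> UNIV)"
    unfolding Infinite_Sum.abs_summable_on_Sigma_iff
  proof (intro conjI ballI)
    fix d show "Infinite_Sum.abs_summable_on (\<lambda>e. f (d, e)) UNIV"
      using summable_on_cmult_right[OF a2, of "norm (mangoldt d * g d)"] by (simp add: f_def norm_mult)
    have "(\<lambda>d. (\<Sum>\<^sub>\<infinity>e. norm (f (d, e)))) = (\<lambda>d. norm (mangoldt d * g d) * (\<Sum>\<^sub>\<infinity>e. norm (g e)))"
      by (simp add: f_def norm_mult infsum_cmult_right')
    moreover have "(\<lambda>d. norm (mangoldt d * g d) * (\<Sum>\<^sub>\<infinity>e. norm (g e))) summable_on UNIV"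
      by (rule summable_on_cmult_left[OF a1])
    ultimately have "(\<lambda>d. (\<Sum>\<^sub>\<infinity>e. norm (f (d, e)))) summable_on UNIV" by simp
    thus "Infinite_Sum.abs_summable_on (\<lambda>d. (\<Sum>\<^sub>\<infinity>e. norm (f (d, e)))) UNIV"
      by (rule summable_on_iff_abs_summable_on_real[THEN iffD1])
  qed
  hence fs: "f summable_on (UNIV \<times> UNIV)" by (rule Infinite_Sum.abs_summable_summable)
  have sl': "summable (\<lambda>n. norm (of_real (ln (real n)) * g n))"
    by (rule summable_comparison_test'[OF sl, of 1]) (simp add: norm_mult abs_mult)
  \<comment> \<open>Only positive \<open>n\<close> admit this inversion, since every
    \<open>d\<close> divides 0. The index 0 is removed before and restored afterwards by
    \<open>g 0 = 0\<close>.\<close>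
  have reindex: "bij_betw (\<lambda>(n, d). (d, n div d)) (SIGMA n:{1..}. {d. d dvd n}) ({1..} \<times> {1..} :: (nat \<times> nat) set)"
    by (rule bij_betwI[where g = "\<lambda>(d, e). (d * e, d)"])
       (auto simp: Suc_le_eq intro!: Nat.gr0I elim!: dvdE)
  have "(\<Sum>n. of_real (ln (real n)) * g n) = (\<Sum>\<^sub>\<infinity>n. of_real (ln (real n)) * g n)"
    by (rule sym, intro infsumI norm_summable_imp_has_sum sl' summable_sums summable_norm_cancel[OF sl'])
  also have "\<dots> = (\<Sum>\<^sub>\<infinity>n\<in>{1..}. of_real (ln (real n)) * g n)"
    by (rule infsum_cong_neutral) (auto simp: not_le g0)
  also have "\<dots> = (\<Sum>\<^sub>\<infinity>n\<in>{1..}. \<Sum>\<^sub>\<infinity>d\<in>{d. d dvd n}. f (d, n div d))"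
  proof (rule infsum_cong)
    fix n :: nat assume n: "n \<in> {1..}"
    have "(\<Sum>\<^sub>\<infinity>d\<in>{d. d dvd n}. f (d, n div d)) = (\<Sum>d | d dvd n. f (d, n div d))"
      using n by (intro infsum_finite) auto
    also have "\<dots> = (\<Sum>d | d dvd n. mangoldt d * g n)"
    proof (rule sum.cong)
      fix d assume "d \<in> {d. d dvd n}"
      hence "g n = g d * g (n div d)" by (simp flip: mult)
      thus "f (d, n div d) = mangoldt d * g n" by (simp add: f_def)
    qed simp
    also have "\<dots> = of_real (ln (real n)) * g n"
      using n mangoldt_sum[of n, where 'a = complex] by (simp flip: sum_distrib_right)
    finally show "of_real (ln (real n)) * g n = (\<Sum>\<^sub>\<infinity>d\<in>{d. d dvd n}. f (d, n div d))" by simp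
  qed
  also have "\<dots> = infsum (\<lambda>p. f ((\<lambda>(n, d). (d, n div d)) p)) (SIGMA n:{1..}. {d. d dvd n})"
  proof -
    have "f summable_on ({1..} \<times> {1..})" by (rule summable_on_subset_banach[OF fs]) auto
    hence "(\<lambda>p. f ((\<lambda>(n, d). (d, n div d)) p)) summable_on (SIGMA n:{1..}. {d. d dvd n})"
      using summable_on_reindex_bij_betw[OF reindex, of f] by simp
    from infsum_Sigma_banach[OF this] show ?thesis by (simp only: prod.case)
  qed
  also have "\<dots> = infsum f ({1..} \<times> {1..})"
    by (rule infsum_reindex_bij_betw[OF reindex])
  also have "\<dots> = infsum f (UNIV \<times> UNIV)"
    by (rule infsum_cong_neutral) (use g0 in \<open>auto simp: f_def Suc_le_eq intro!: Nat.gr0I\<close>)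
  also have "\<dots> = (\<Sum>\<^sub>\<infinity>d. \<Sum>\<^sub>\<infinity>e. f (d, e))"
    by (rule infsum_Sigma_banach[OF fs, symmetric])
  also have "\<dots> = (\<Sum>\<^sub>\<infinity>d. mangoldt d * g d) * infsum g UNIV"
    by (simp only: f_def prod.case infsum_cmult_right' infsum_cmult_left')
  also have "(\<Sum>\<^sub>\<infinity>n. mangoldt n * g n) = (\<Sum>n. mangoldt n * g n)"
    by (intro infsumI norm_summable_imp_has_sum S summable_sums summable_norm_cancel[OF S])
  also have "infsum g UNIV = (\<Sum>n. g n)"
    by (intro infsumI norm_summable_imp_has_sum sg summable_sums summable_norm_cancel[OF sg])
  finally show "(\<Sum>n. of_real (ln (real n)) * g n) = (\<Sum>n. mangoldt n * g n) * (\<Sum>n. g n)" .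
qed


text \<open>\<open>F\<close> is an antiderivative of \<open>- ln x / x^2\<close>, so the terms from
  3 on are at most the integral from 2 to infinity, which is \<open>F 2\<close>. The bound is
  \<open>F 2 + ln 2 / 4\<close> at \<open>ln 2 <= 25/36\<close>, rounded up.\<close>

lemma sum_ln_over_square_le:
  shows "summable (\<lambda>n. ln (real n) / real n ^ 2)" and "(\<Sum>n. ln (real n) / real n ^ 2) \<le> 10209 / 10000"
proof -
  define F where "F = (\<lambda>x::real. (ln x + 1) / x)"
  have step: "ln (real n + 3) / (real n + 3) ^ 2 \<le> F (real n + 2) - F (real n + 3)" for n
  proof -
    have "\<exists>z. real n + 2 < z \<and> z < real n + 3 \<and> F (real n + 3) - F (real n + 2) = (real n + 3 - (real n + 2)) * (- ln z / z ^ 2)"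
      by (rule MVT2) (auto simp: F_def power2_eq_square field_simps intro!: derivative_eq_intros)
    then obtain z where z: "real n + 2 < z" "z < real n + 3" and eq: "F (real n + 2) - F (real n + 3) = ln z / z ^ 2"
      by (auto simp: algebra_simps)
    have "ln (real n + 3) / (real n + 3) ^ 2 \<le> ln z / z ^ 2"
    proof (rule DERIV_nonpos_imp_nonincreasing[of z _ "\<lambda>z. ln z / z ^ 2"])
      fix x assume x: "z \<le> x" "x \<le> real n + 3"
      have "((\<lambda>z. ln z / z ^ 2) has_real_derivative ((1 - 2 * ln x) / x ^ 3)) (at x)"
        using x z by (auto intro!: derivative_eq_intros simp: field_simps power2_eq_square power3_eq_cube)
      \<comment> \<open>\<open>ln z / z^2\<close> decreases as soon as \<open>ln z >= 1/2\<close>,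
        which holds from \<open>z = 2\<close> on.\<close>
      moreover have "ln x \<ge> 2 / 3" using ln2_ge_two_thirds ln_mono[of 2 x] x z by linarith
      hence "(1 - 2 * ln x) / x ^ 3 \<le> 0" using x z by (intro divide_nonpos_pos) auto
      ultimately show "\<exists>y. ((\<lambda>z. ln z / z ^ 2) has_real_derivative y) (at x) \<and> y \<le> 0" by blast
    qed (use z in auto)
    thus ?thesis using eq by simp
  qed
  have F: "(\<lambda>n. F (real n + 2)) \<longlonglongrightarrow> 0" unfolding F_def by real_asymp
  hence sums: "(\<lambda>n. F (real n + 2) - F (real (Suc n) + 2)) sums (F (real 0 + 2) - 0)" by (rule telescope_sums')
  have step': "ln (real (n + 3)) / real (n + 3) ^ 2 \<le> F (real n + 2) - F (real (Suc n) + 2)" for n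
    using step[of n] by (simp add: add_ac)
  have s3: "summable (\<lambda>n. ln (real (n + 3)) / real (n + 3) ^ 2)"
    by (rule summable_comparison_test'[OF sums_summable[OF sums], of 0]) (use step' in auto)
  thus s: "summable (\<lambda>n. ln (real n) / real n ^ 2)" by (subst (asm) summable_iff_shift)
  have "(\<Sum>n. ln (real n) / real n ^ 2) = (\<Sum>n. ln (real (n + 3)) / real (n + 3) ^ 2) + (\<Sum>n<3. ln (real n) / real n ^ 2)"
    by (rule suminf_split_initial_segment[OF s])
  also have "(\<Sum>n<3. ln (real n) / real n ^ 2) = ln 2 / 4" by (simp add: eval_nat_numeral)
  also have "(\<Sum>n. ln (real (n + 3)) / real (n + 3) ^ 2) \<le> F 2"
    using suminf_le[OF step' s3 sums_summable[OF sums]] sums_unique[OF sums] by simp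
  also have "F 2 + ln 2 / 4 \<le> 10209 / 10000" 
  proof -
    have "x \<le> 25 / 36 \<Longrightarrow> (x + 1) / 2 + x / 4 \<le> 10209 / 10000" for x :: real by (simp add: field_simps)
    from this[OF ln2_le_25_over_36] show ?thesis by (simp only: F_def)
  qed
  finally show "(\<Sum>n. ln (real n) / real n ^ 2) \<le> 10209 / 10000" by simp
qed

lemma zeta_2_nat: "(\<lambda>n. 1 / real n ^ 2) sums (pi\<^sup>2 / 6)"
proof -
  have "(\<lambda>n. 1 / real (Suc n) ^ 2) sums (pi\<^sup>2 / 6 - 1 / real 0 ^ 2)"
    using inverse_squares_sums by (simp add: add_ac)
  thus ?thesis by (subst (asm) sums_Suc_iff) simp
qed

text \<open>The sum is \<open>- \<zeta>'(2) / \<zeta>(2)\<close>, by the convolution identity for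
  \<open>g n = 1 / n^2\<close>. With \<open>\<zeta>(2) = pi^2 / 6 >= 1.6444\<close> the constant
  comes from \<open>1.0209 / 1.6444 < 0.622\<close>.\<close>

lemma sum_mangoldt_over_square_le:
  shows "summable (\<lambda>n. mangoldt n / real n ^ 2)" and "(\<Sum>n. mangoldt n / real n ^ 2) \<le> (622 / 1000 :: real)"
proof -
  define g where "g = (\<lambda>n::nat. complex_of_real (1 / real n ^ 2))"
  have ng: "norm (g n) = 1 / real n ^ 2" for n by (simp add: g_def norm_divide norm_power)
  have A: "summable (\<lambda>n. norm (g n))" using zeta_2_nat by (simp add: ng sums_iff)
  have B: "summable (\<lambda>n. ln (real n) * norm (g n))" using sum_ln_over_square_le(1) by (simp add: ng)
  have m: "g (m * n) = g m * g n" for m n by (simp add: g_def power_mult_distrib)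
  note C = suminf_mangoldt_convolution[OF m _ A B]
  have g0: "g 0 = 0" by (simp add: g_def)
  have eq: "mangoldt n * g n = complex_of_real (mangoldt n / real n ^ 2)" for n
    by (simp add: g_def)
  have "summable (\<lambda>n. complex_of_real (mangoldt n / real n ^ 2))"
    using summable_norm_cancel[OF C(1)[OF g0]] by (simp only: eq)
  thus S: "summable (\<lambda>n. mangoldt n / real n ^ 2 :: real)" by (subst (asm) summable_of_real_iff)
  have "(\<Sum>n. of_real (ln (real n)) * g n) = of_real (\<Sum>n. ln (real n) / real n ^ 2)"
    using suminf_of_real[OF sum_ln_over_square_le(1), where 'a = complex] by (simp add: g_def)
  moreover have "(\<Sum>n. mangoldt n * g n) = of_real (\<Sum>n. mangoldt n / real n ^ 2)"
    unfolding eq by (rule suminf_of_real[OF S, symmetric])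
  moreover have "(\<Sum>n. g n) = of_real (pi\<^sup>2 / 6)"
    using suminf_of_real[OF sums_summable[OF zeta_2_nat], where 'a = complex] sums_unique[OF zeta_2_nat] by (simp add: g_def)
  ultimately have "complex_of_real (\<Sum>n. ln (real n) / real n ^ 2) = of_real ((\<Sum>n. mangoldt n / real n ^ 2) * (pi\<^sup>2 / 6))"
    using C(2)[OF g0] by (simp only: of_real_mult)
  hence "(\<Sum>n. ln (real n) / real n ^ 2) = (\<Sum>n. mangoldt n / real n ^ 2) * (pi\<^sup>2 / 6)"
    by (simp only: of_real_eq_iff)
  moreover have "pi\<^sup>2 / 6 \<ge> 16444 / 10000"
  proof -
    have "pi\<^sup>2 \<ge> (31412 / 10000)\<^sup>2" using pi_approx by (intro power_mono) auto
    thus ?thesis by (simp add: power2_eq_square)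
  qed
  moreover have "(\<Sum>n. mangoldt n / real n ^ 2) \<ge> (0 :: real)"
    using aprimedivisor_pos_nat primepow_gt_Suc_0 
    by (intro suminf_nonneg S) (auto simp: mangoldt_def Suc_le_eq)
  ultimately have "(\<Sum>n. mangoldt n / real n ^ 2) * 16444 / 10000 \<le> (10209 / 10000 :: real)"
    using sum_ln_over_square_le(2) mult_left_mono[of "16444 / 10000" "pi\<^sup>2 / 6" "\<Sum>n. mangoldt n / real n ^ 2 :: real"]
    by linarith
  thus "(\<Sum>n. mangoldt n / real n ^ 2) \<le> (622 / 1000 :: real)" by simp
qed

lemma norm_of_nat_powr: "norm (of_nat n powr w :: complex) = real n powr Re w"
  by (cases "n = 0") (auto simp: norm_powr_real_powr)

section \<open>Dirichlet series of a bounded completely multiplicative function on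
  \<open>Re w >= 2\<close>\<close>

context
  fixes chi :: "int \<Rightarrow> complex"
  assumes mult: "\<And>a b. chi (a * b) = chi a * chi b"
    and chi1: "chi 1 = 1"
    and norm_le: "\<And>a. norm (chi a) \<le> 1"
begin

lemma dirichlet_L_term_norm_le:
  assumes "Re w \<ge> 2"
  shows "norm (chi (int n) * of_nat n powr (-w)) \<le> 1 / real n ^ 2"
proof (cases "n = 0")
  case False
  have "norm (chi (int n) * of_nat n powr (-w)) \<le> 1 * real n powr (-Re w)"
    unfolding norm_mult norm_of_nat_powr by (intro mult_mono norm_le) auto
  also have "\<dots> \<le> real n powr (-2)" using False assms by (simp add: powr_mono)
  also have "\<dots> = 1 / real n ^ 2" using False by (simp add: powr_minus_divide)
  finally show ?thesis .
qed auto

lemma dirichlet_L_abs_summable: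
  assumes "Re w \<ge> 2"
  shows "summable (\<lambda>n. norm (chi (int n) * of_nat n powr (-w)))"
  by (rule summable_comparison_test'[OF sums_summable[OF zeta_2_nat], of 0])
     (use dirichlet_L_term_norm_le[OF assms] in auto)

lemma dirichlet_L_eq_suminf:
  assumes "Re w \<ge> 2"
  shows "dirichlet_L chi w = (\<Sum>n. chi (int n) * of_nat n powr (-w))"
  using assms suminf_split_head[OF summable_norm_cancel[OF dirichlet_L_abs_summable[OF assms]]]
  by (simp add: dirichlet_L_def)

text \<open>The leading term 1 outweighs all others together, whose sum has modulus at most
  \<open>pi^2 / 6 - 1 < 1\<close>.\<close>

lemma dirichlet_L_nonzero:
  assumes "Re w \<ge> 2"
  shows "dirichlet_L chi w \<noteq> 0"
proof
  assume L0: "dirichlet_L chi w = 0"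
  define f where "f = (\<lambda>n. chi (int n) * of_nat n powr (-w))"
  have s: "summable f" using summable_norm_cancel[OF dirichlet_L_abs_summable[OF assms]] by (simp add: f_def)
  have "suminf f = (\<Sum>n. f (n + 2)) + (\<Sum>n<2. f n)" by (rule suminf_split_initial_segment[OF s])
  \<comment> \<open>The term with index 0 vanishes because \<open>0 powr z = 0\<close>.\<close>
  also have "(\<Sum>n<2. f n) = 1" by (simp add: f_def eval_nat_numeral chi1)
  also have "suminf f = 0" using L0 dirichlet_L_eq_suminf[OF assms] by (simp add: f_def)
  finally have "(\<Sum>n. f (n + 2)) = -1" by (simp add: eq_neg_iff_add_eq_0)
  moreover have "norm (\<Sum>n. f (n + 2)) \<le> (\<Sum>n. 1 / real (n + 2) ^ 2)"
  proof (rule norm_suminf_le)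
    show "norm (f (n + 2)) \<le> 1 / real (n + 2) ^ 2" for n
      unfolding f_def by (rule dirichlet_L_term_norm_le[OF assms])
    show "summable (\<lambda>n. 1 / real (n + 2) ^ 2)"
      using sums_summable[OF zeta_2_nat] by (subst summable_iff_shift)
  qed
  moreover have "(\<Sum>n. 1 / real (n + 2) ^ 2) = pi\<^sup>2 / 6 - 1"
  proof -
    have "pi\<^sup>2 / 6 = (\<Sum>n. 1 / real (n + 2) ^ 2) + (\<Sum>n<2. 1 / real n ^ 2)"
      using suminf_split_initial_segment[OF sums_summable[OF zeta_2_nat], of 2] sums_unique[OF zeta_2_nat] by simp
    also have "(\<Sum>n<2. 1 / real n ^ 2) = 1" by (simp add: eval_nat_numeral)
    finally show ?thesis by linarith
  qed
  moreover have "pi\<^sup>2 \<le> (32 / 10)\<^sup>2" using pi_approx by (intro power_mono) auto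
  ultimately show False by (simp add: power2_eq_square)
qed

text \<open>The differentiated series has the majorant \<open>ln n / n^2\<close> on the whole
  half-plane \<open>Re w >= 2\<close>; the strict hypothesis places \<open>w\<close> in its
  interior.\<close>

lemma dirichlet_L_has_field_derivative:
  assumes "Re w > 2"
  shows "(dirichlet_L chi has_field_derivative - (\<Sum>n. of_real (ln (real n)) * (chi (int n) * of_nat n powr (-w)))) (at w)"
proof -
  define f where "f = (\<lambda>n w. chi (int n) * of_nat n powr (-w))"
  define f' where "f' = (\<lambda>n w. - (of_real (ln (real n)) * (chi (int n) * of_nat n powr (-w))))"
  define S where "S = {w :: complex. Re w \<ge> 2}"
  have "((\<lambda>w. \<Sum>n. f n w) has_field_derivative (\<Sum>n. f' n w)) (at w)"
  proof (rule has_field_derivative_series'(2))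
    show "convex S" by (simp add: S_def convex_halfspace_Re_ge)
    show "uniformly_convergent_on S (\<lambda>n x. \<Sum>i<n. f' i x)"
    proof (rule Weierstrass_m_test')
      fix n and x :: complex assume "x \<in> S"
      hence "norm (f' n x) \<le> \<bar>ln (real n)\<bar> * (1 / real n ^ 2)"
        unfolding f'_def norm_minus_cancel norm_mult[of "of_real _"] norm_of_real
        by (intro mult_left_mono dirichlet_L_term_norm_le) (auto simp: S_def)
      thus "norm (f' n x) \<le> ln (real n) / real n ^ 2" by (cases "n = 0") auto
    qed (rule sum_ln_over_square_le)
    show "2 \<in> S" by (simp add: S_def)
    show "summable (\<lambda>n. f n 2)"
      unfolding f_def by (rule summable_norm_cancel[OF dirichlet_L_abs_summable]) auto
    show "(f n has_field_derivative f' n x) (at x within S)" for n x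
    proof (cases "n = 0")
      case False
      have "((\<lambda>x. of_nat n powr (-x)) has_field_derivative (Ln (of_nat n) * of_nat n powr (-x)) * (-1)) (at x within S)"
        using False
        by (intro DERIV_chain2[OF has_field_derivative_powr_right]) (auto intro!: derivative_eq_intros)
      from DERIV_cmult[OF this, of "chi (int n)"] show ?thesis
        using False by (simp add: f_def f'_def Ln_of_nat mult_ac)
    qed (simp add: f_def f'_def)
    have "{w. Re w > 2} \<subseteq> interior S"
      by (rule interior_maximal) (auto simp: S_def open_halfspace_Re_gt)
    thus "w \<in> interior S" using assms by auto
  qed
  moreover have "eventually (\<lambda>w. (\<Sum>n. f n w) = dirichlet_L chi w) (nhds w)"
  proof -
    have "eventually (\<lambda>w. w \<in> {w. Re w > 2}) (nhds w)"
      using assms by (intro eventually_nhds_in_open open_halfspace_Re_gt) auto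
    thus ?thesis by eventually_elim (simp add: f_def dirichlet_L_eq_suminf)
  qed
  moreover have "(\<Sum>n. f' n w) = - (\<Sum>n. of_real (ln (real n)) * (chi (int n) * of_nat n powr (-w)))"
    unfolding f'_def
  proof (rule suminf_minus, rule summable_comparison_test'[OF sum_ln_over_square_le(1), of 1])
    fix n :: nat assume "1 \<le> n"
    have "norm (of_real (ln (real n)) * (chi (int n) * of_nat n powr (-w))) \<le> \<bar>ln (real n)\<bar> * (1 / real n ^ 2)"
      unfolding norm_mult[of "of_real _"] norm_of_real using assms
      by (intro mult_left_mono dirichlet_L_term_norm_le) auto
    thus "norm (of_real (ln (real n)) * (chi (int n) * of_nat n powr (-w))) \<le> ln (real n) / real n ^ 2"
      using \<open>1 \<le> n\<close> by simp
  qed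
  ultimately show ?thesis by (simp add: DERIV_cong_ev)
qed

text \<open>The quotient is minus the sum of \<open>mangoldt n * g n\<close>, and
  \<open>|g n| <= 1 / n^2\<close> reduces its modulus to the sum already estimated.\<close>

lemma Re_logderiv_dirichlet_L_ge:
  assumes "Re w \<ge> 2"
  shows "Re (- (\<Sum>n. of_real (ln (real n)) * (chi (int n) * of_nat n powr (-w))) / dirichlet_L chi w) \<ge> - 622 / 1000"
proof -
  define g where "g = (\<lambda>n. chi (int n) * of_nat n powr (-w))"
  have m: "g (a * b) = g a * g b" for a b
    by (simp add: g_def mult powr_times_real)
  have g0: "g 0 = 0" by (simp add: g_def)
  have sg: "summable (\<lambda>n. norm (g n))" using dirichlet_L_abs_summable[OF assms] by (simp add: g_def)
  have gle: "norm (g n) \<le> 1 / real n ^ 2" for n using dirichlet_L_term_norm_le[OF assms] by (simp add: g_def)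
  have sl: "summable (\<lambda>n. ln (real n) * norm (g n))"
  proof (rule summable_comparison_test'[OF sum_ln_over_square_le(1), of 1])
    fix n :: nat assume "1 \<le> n"
    thus "norm (ln (real n) * norm (g n)) \<le> ln (real n) / real n ^ 2"
      using mult_left_mono[OF gle, of "ln (real n)" n] by (simp add: abs_mult)
  qed
  note C = suminf_mangoldt_convolution[OF m g0 sg sl]
  have "norm (\<Sum>n. mangoldt n * g n) \<le> (\<Sum>n. mangoldt n / real n ^ 2)"
  proof (rule norm_suminf_le[OF _ sum_mangoldt_over_square_le(1)])
    fix n
    have "(mangoldt n :: real) \<ge> 0"
      using aprimedivisor_pos_nat[of n] primepow_gt_Suc_0[of n] by (auto simp: mangoldt_def Suc_le_eq)
    hence "norm (mangoldt n :: complex) = mangoldt n" using norm_of_real[of "mangoldt n", where 'a = complex] by simp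
    thus "norm (mangoldt n * g n) \<le> mangoldt n / real n ^ 2"
      using mult_left_mono[OF gle \<open>(mangoldt n :: real) \<ge> 0\<close>, of n] by (simp add: norm_mult)
  qed
  hence "norm (\<Sum>n. mangoldt n * g n) \<le> 622 / 1000" using sum_mangoldt_over_square_le(2) by linarith
  moreover have "- (\<Sum>n. of_real (ln (real n)) * (chi (int n) * of_nat n powr (-w))) / dirichlet_L chi w
     = - (\<Sum>n. mangoldt n * g n)"
    using C(2) dirichlet_L_nonzero[OF assms] dirichlet_L_eq_suminf[OF assms] by (simp add: g_def)
  ultimately show ?thesis using complex_Re_le_cmod[of "\<Sum>n. mangoldt n * g n"] by simp
qed

text \<open>\<open>h\<close> is the logarithm of the product. Its derivative has three terms,
  bounded below by \<open>- 24/1000\<close> (conductor), \<open>2/3\<close> (Gamma factor) and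
  \<open>- 622/1000\<close> (\<open>L\<close>-value), with sum just above
  \<open>20/1000\<close>.\<close>

lemma completed_L_strict_mono:
  assumes k: "k \<ge> 3" and t: "t \<ge> 8" and ab: "0 < a" "a < b"
  defines "w \<equiv> \<lambda>x. complex_of_real x + (2 + \<i> * of_real t)"
  shows "(k / pi) powr (a / 2) * cmod (Gamma (w a / 2)) * cmod (dirichlet_L chi (w a))
       < (k / pi) powr (b / 2) * cmod (Gamma (w b / 2)) * cmod (dirichlet_L chi (w b))"
proof -
  define h where "h = (\<lambda>x. ln (k / pi) * (x / 2) + ln (cmod (Gamma (w x / 2))) + ln (cmod (dirichlet_L chi (w x))))"
  have G: "w x / 2 \<notin> \<int>\<^sub>\<le>\<^sub>0" for x
  proof
    assume "w x / 2 \<in> \<int>\<^sub>\<le>\<^sub>0"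
    hence "Im (w x / 2) = 0" by (auto elim!: nonpos_Ints_cases)
    thus False using t by (simp add: w_def)
  qed
  have "h a < h b"
  proof (rule DERIV_pos_imp_increasing[of a b h])
    fix x assume x: "a \<le> x" "x \<le> b"
    have "((\<lambda>z. Gamma (z / 2)) has_field_derivative Gamma (w x / 2) * Digamma (w x / 2) / 2) (at (w x))"
      using G[of x] by (auto intro!: derivative_eq_intros)
    from has_real_derivative_ln_cmod[OF this[unfolded w_def]] G[of x]
    have 1: "((\<lambda>x. ln (cmod (Gamma (w x / 2)))) has_real_derivative Re (Digamma (w x / 2) / 2)) (at x)"
      by (simp add: w_def Gamma_eq_zero_iff)
    have Rew: "Re (w x) > 2" using x ab by (simp add: w_def)
    define D where "D = Re (- (\<Sum>n. of_real (ln (real n)) * (chi (int n) * of_nat n powr (- w x))) / dirichlet_L chi (w x))"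
    have 2: "((\<lambda>x. ln (cmod (dirichlet_L chi (w x)))) has_real_derivative D) (at x)"
      using has_real_derivative_ln_cmod[OF dirichlet_L_has_field_derivative[OF Rew, unfolded w_def]]
         dirichlet_L_nonzero[of "w x"] Rew by (simp add: w_def D_def)
    have "D \<ge> - 622 / 1000" unfolding D_def using Rew by (intro Re_logderiv_dirichlet_L_ge) auto
    have "(h has_real_derivative ln (k / pi) * (1 / 2) + Re (Digamma (w x / 2) / 2) + D) (at x)"
      unfolding h_def by (intro DERIV_add 1 2 DERIV_cmult) (auto intro!: derivative_eq_intros)
    moreover have "ln (k / pi) \<ge> - 48 / 1000"
    proof -
      \<comment> \<open>For \<open>k = 3\<close> this logarithm is negative;
        \<open>ln u <= u - 1\<close> at \<open>u = pi / k\<close> bounds the loss by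
        \<open>pi / 3 - 1 < 0.048\<close>.\<close>
      have "- ln (k / pi) = ln (pi / k)" using k by (simp add: ln_div)
      also have "\<dots> \<le> pi / k - 1" using k by (intro ln_le_minus_one) auto
      also have "\<dots> \<le> pi / 3 - 1" using k by (intro diff_right_mono divide_left_mono) auto
      also have "\<dots> \<le> 48 / 1000" using pi_approx(2) by simp
      finally show ?thesis by simp
    qed
    moreover have "Re (Digamma (w x / 2)) \<ge> 4 / 3"
    proof -
      define X Y where "X = Re (w x / 2)" and "Y = Im (w x / 2)"
      have "X \<ge> 1" "Y \<ge> 4" using x ab t by (auto simp: X_def Y_def w_def)
      have "X\<^sup>2 - X + Y\<^sup>2 \<ge> 0 + 4\<^sup>2"
      proof -
        have "X * (X - 1) \<ge> 0" using \<open>X \<ge> 1\<close> by simp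
        moreover have "Y\<^sup>2 \<ge> 4\<^sup>2" using \<open>Y \<ge> 4\<close> by (intro power_mono) auto
        ultimately show ?thesis by (simp add: power2_eq_square algebra_simps)
      qed
      \<comment> \<open>Here \<open>t >= 8\<close> enters: \<open>Y >= 4\<close> gives
        \<open>Y^2 >= 16\<close>, whose logarithm is \<open>4 * ln 2\<close>, and
        \<open>ln 2 >= 2/3\<close>.\<close>
      hence "ln ((2::real) ^ 4) \<le> ln (X\<^sup>2 - X + Y\<^sup>2)" by simp
      moreover have "ln (X\<^sup>2 - X + Y\<^sup>2) / 2 \<le> Re (Digamma (w x / 2))"
        unfolding X_def Y_def using \<open>X \<ge> 1\<close> \<open>Y \<ge> 4\<close> \<open>X\<^sup>2 - X + Y\<^sup>2 \<ge> 0 + 4\<^sup>2\<close>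
        by (intro Re_Digamma_ge) (auto simp: X_def Y_def)
      moreover have "ln ((2::real) ^ 4) = 4 * ln 2" by (subst ln_realpow) auto
      ultimately show ?thesis using ln2_ge_two_thirds by linarith
    qed
    ultimately show "\<exists>y. (h has_real_derivative y) (at x) \<and> y > 0"
      using \<open>D \<ge> - 622 / 1000\<close> by (intro exI[of _ "ln (k / pi) * (1 / 2) + Re (Digamma (w x / 2) / 2) + D"]) auto
  qed fact
  hence "exp (h a) < exp (h b)" by simp
  moreover have "exp (h x) = (k / pi) powr (x / 2) * cmod (Gamma (w x / 2)) * cmod (dirichlet_L chi (w x))" if "x > 0" for x
    using that k G[of x] dirichlet_L_nonzero[of "w x"]
    by (simp add: h_def exp_add powr_def Gamma_eq_zero_iff w_def mult.commute)
  ultimately show ?thesis using ab by simp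
qed

end

section \<open>Asymptotics of the Fourier coefficients of \<open>(sin x)\<^sup>-\<^sup>s\<close>\<close>

definition sine_coeff :: "complex \<Rightarrow> nat \<Rightarrow> complex" where
  "sine_coeff s m = Gamma (of_nat m + s / 2) / Gamma (of_nat m + (1 - s / 2))"

lemma nonreal_not_nonpos_Int: "Im z \<noteq> 0 \<Longrightarrow> z \<notin> \<int>\<^sub>\<le>\<^sub>0"
  by (auto elim!: nonpos_Ints_cases)

lemma sine_coeff_Suc:
  assumes "Im s \<noteq> 0"
  shows "(of_nat m + (1 - s / 2)) * sine_coeff s (Suc m) = (of_nat m + s / 2) * sine_coeff s m"
proof -
  have G: "Gamma (of_nat (Suc m) + z) = (of_nat m + z) * Gamma (of_nat m + z)" if "Im z \<noteq> 0" for z :: complex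
    using that Gamma_plus1[of "of_nat m + z"] by (simp add: nonreal_not_nonpos_Int add_ac)
  have nz: "of_nat m + (1 - s / 2) \<noteq> 0" using assms by (auto simp: complex_eq_iff)
  have gen: "b * (c * G / (b * G')) = c * (G / G')" if "b \<noteq> 0" for b c G G' :: complex
    using that by simp
  have im: "Im (s / 2) \<noteq> 0" "Im (1 - s / 2) \<noteq> 0" using assms by auto
  show ?thesis unfolding sine_coeff_def G[OF im(1)] G[OF im(2)] by (rule gen[OF nz])
qed

text \<open>Both Gamma values are written through the approximants \<open>Gamma_series'\<close> of
  the limit formula; in their quotient the factorials cancel and the powers of \<open>n\<close>
  combine.\<close>

lemma Gamma_quotient_asymp:
  fixes z z' :: complex
  assumes "z \<notin> \<int>\<^sub>\<le>\<^sub>0" "z' \<notin> \<int>\<^sub>\<le>\<^sub>0"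
  shows "(\<lambda>n. Gamma (of_nat n + z) / Gamma (of_nat n + z') * of_nat n powr (z' - z)) \<longlonglongrightarrow> 1"
proof -
  have G: "Gamma z \<noteq> 0" "Gamma z' \<noteq> 0" using assms by (auto simp: Gamma_eq_zero_iff)
  have "(\<lambda>n. (Gamma z * Gamma_series' z' n) / (Gamma z' * Gamma_series' z n))
          \<longlonglongrightarrow> (Gamma z * Gamma z') / (Gamma z' * Gamma z)"
    using G by (intro tendsto_intros Gamma_series'_LIMSEQ) auto
  moreover have "(Gamma z * Gamma z') / (Gamma z' * Gamma z) = 1" using G by simp
  moreover have "eventually (\<lambda>n. (Gamma z * Gamma_series' z' n) / (Gamma z' * Gamma_series' z n)
     = Gamma (of_nat n + z) / Gamma (of_nat n + z') * of_nat n powr (z' - z)) sequentially"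
    using eventually_gt_at_top[of 0]
  proof eventually_elim
    case (elim n)
    have p: "Gamma (of_nat n + w) = pochhammer w n * Gamma w" if "w \<notin> \<int>\<^sub>\<le>\<^sub>0" for w :: complex
      using pochhammer_Gamma[of w n] that by (simp add: Gamma_eq_zero_iff add.commute)
    have e: "exp (w * of_real (ln (real n))) = of_nat n powr w" for w :: complex
      using elim by (simp add: powr_def Ln_of_nat)
    show ?case using elim
      by (simp add: Gamma_series'_def p[OF assms(1)] p[OF assms(2)] e powr_diff mult_ac)
  qed
  ultimately show ?thesis by (simp add: filterlim_cong)
qed

lemma sine_coeff_asymp:
  assumes "Im s \<noteq> 0"
  shows "(\<lambda>n. sine_coeff s n * of_nat n powr (1 - s)) \<longlonglongrightarrow> 1"
  using Gamma_quotient_asymp[of "s / 2" "1 - s / 2"] assms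
  by (simp add: sine_coeff_def nonreal_not_nonpos_Int)

lemma norm_sine_coeff_le:
  assumes "Im s \<noteq> 0"
  obtains B where "B \<ge> 0" "\<And>n. n > 0 \<Longrightarrow> norm (sine_coeff s n) \<le> B * real n powr (Re s - 1)"
proof -
  obtain B where B: "\<And>n. norm (sine_coeff s n * of_nat n powr (1 - s)) \<le> B"
    using convergent_imp_Bseq[OF convergentI[OF sine_coeff_asymp[OF assms]]] by (auto elim!: BseqE)
  show ?thesis
  proof (rule that)
    show "B \<ge> 0" using order_trans[OF norm_ge_zero B[of 0]] .
    fix n :: nat assume n: "n > 0"
    have "norm (sine_coeff s n) * real n powr (1 - Re s) \<le> B"
      using B[of n] by (simp add: norm_mult norm_powr_real_powr)
    hence "norm (sine_coeff s n) * real n powr (1 - Re s) * real n powr (Re s - 1) \<le> B * real n powr (Re s - 1)"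
      by (intro mult_right_mono) auto
    thus "norm (sine_coeff s n) \<le> B * real n powr (Re s - 1)"
      using n by (simp add: mult.assoc flip: powr_add)
  qed
qed

section \<open>Second-order asymptotics of the Gamma quotient\<close>

text \<open>The error has derivative \<open>- w^3 / (1 + w)\<close>, of modulus at most
  \<open>2 * |z|^3\<close> on the ball of radius \<open>|z| <= 1/2\<close>.\<close>

lemma norm_Ln_one_plus_third_order:
  fixes z :: complex
  assumes z: "norm z \<le> 1 / 2"
  shows "norm (Ln (1 + z) - (z - z\<^sup>2 / 2 + z ^ 3 / 3)) \<le> 2 * norm z ^ 4"
proof -
  define f where "f = (\<lambda>z::complex. Ln (1 + z) - (z - z\<^sup>2 / 2 + z ^ 3 / 3))"
  have "norm (f z - f 0) \<le> (2 * norm z ^ 3) * norm (z - 0)"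
  proof (rule field_differentiable_bound)
    fix w :: complex assume "w \<in> cball 0 (norm z)"
    hence w: "norm w \<le> norm z" by simp
    have Re: "Re (1 + w) \<ge> 1 / 2" using abs_Re_le_cmod[of w] w z by simp
    hence nn: "1 + w \<notin> \<real>\<^sub>\<le>\<^sub>0" by (auto simp: complex_nonpos_Reals_iff)
    have nz: "1 + w \<noteq> 0" using nn by auto
    have "((\<lambda>z. Ln (1 + z)) has_field_derivative inverse (1 + w) * 1) (at w)"
      using nn by (intro DERIV_chain2[OF has_field_derivative_Ln]) (auto intro!: derivative_eq_intros)
    moreover have "((\<lambda>z. z - z\<^sup>2 / 2 + z ^ 3 / 3) has_field_derivative 1 - w + w\<^sup>2) (at w)"
      by (auto intro!: derivative_eq_intros simp: power2_eq_square)
    ultimately have "(f has_field_derivative (inverse (1 + w) * 1 - (1 - w + w\<^sup>2))) (at w)"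
      unfolding f_def by (rule DERIV_diff)
    hence "(f has_field_derivative (1 / (1 + w) - (1 - w + w\<^sup>2))) (at w within cball 0 (norm z))"
      by (simp add: inverse_eq_divide has_field_derivative_at_within)
    also have "1 / (1 + w) - (1 - w + w\<^sup>2) = - (w ^ 3) / (1 + w)"
      using nz by (simp add: field_simps power2_eq_square power3_eq_cube)
    finally show "(f has_field_derivative - (w ^ 3) / (1 + w)) (at w within cball 0 (norm z))" .
    have "norm (w ^ 3) / norm (1 + w) \<le> norm z ^ 3 / (1 / 2)"
      using Re complex_Re_le_cmod[of "1 + w"] w
      by (intro frac_le) (auto simp: norm_power intro!: power_mono)
    thus "norm (- (w ^ 3) / (1 + w)) \<le> 2 * norm z ^ 3" by (simp add: norm_divide)
  qed auto
  thus ?thesis by (simp add: f_def power_Suc2[symmetric] eval_nat_numeral)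
qed

text \<open>Consecutive values of \<open>sine_coeff s m * m powr (1 - s)\<close> have as ratio the
  exponential of \<open>Ln (1 + a * x) - Ln (1 + (1 - a) * x) + (1 - s) * Ln (1 + x)\<close> with
  \<open>x = 1 / m\<close>. This has no terms of order \<open>x\<close> and \<open>x^2\<close>; its
  cubic term is \<open>- 2 * e * x^3\<close>, which up to \<open>O(x^4)\<close> is the increment of
  \<open>e / m^2\<close> from \<open>m\<close> to \<open>m + 1\<close>. Summing the remainders
  \<open>H\<close> gives the value as \<open>exp (e / m^2 - R m)\<close> with
  \<open>R m = o(m^-2)\<close>.\<close>

lemma sine_coeff_second_order:
  assumes s: "Im s \<noteq> 0"
  shows "(\<lambda>m. of_nat m ^ 2 * (sine_coeff s m * of_nat m powr (1 - s) - 1)) \<longlonglongrightarrow> - s * (s - 1) * (s - 2) / 24"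
proof -
  define a e where "a = s / 2" and "e = - s * (s - 1) * (s - 2) / 24"
  \<comment> \<open>The logarithm of the ratio minus the increment of \<open>e / m^2\<close>, since
    \<open>x^2 / (1 + x)^2 = 1 / (m + 1)^2\<close>; hence \<open>O(x^4)\<close>.\<close>
  define H where "H = (\<lambda>x. Ln (1 + a * x) - Ln (1 + (1 - a) * x) + (1 - s) * Ln (1 + x) + e * x\<^sup>2 - e * x\<^sup>2 / (1 + x)\<^sup>2)"
  \<comment> \<open>\<open>M\<close> bounds the factors \<open>a\<close>, \<open>1 - a\<close> and 1
    of \<open>x\<close> in the three logarithms, so \<open>x <= 1 / (2 * M)\<close> keeps the
    arguments in the ball of radius 1/2.\<close>
  define M where "M = max 1 (max (norm a) (norm (1 - a)))"
  define C where "C = 2 * M ^ 4 + 2 * M ^ 4 + norm (1 - s) * (2 * M ^ 4) + 5 * norm e"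
  have M: "M \<ge> 1" "norm a \<le> M" "norm (1 - a) \<le> M" by (auto simp: M_def)
  have H: "norm (H (of_real x)) \<le> C * x ^ 4" if x: "0 < x" "x \<le> 1 / (2 * M)" for x :: real
  proof -
    define T where "T = (\<lambda>z::complex. Ln (1 + z) - (z - z\<^sup>2 / 2 + z ^ 3 / 3))"
    have T: "norm (T (b * of_real x)) \<le> 2 * M ^ 4 * x ^ 4" if b: "norm b \<le> M" for b
    proof -
      have le: "norm (b * of_real x) \<le> M * x" using b x by (simp add: norm_mult mult_right_mono)
      also have "\<dots> \<le> 1 / 2" using x M by (simp add: field_simps)
      finally have "norm (T (b * of_real x)) \<le> 2 * norm (b * of_real x) ^ 4"
        unfolding T_def by (rule norm_Ln_one_plus_third_order)
      also have "\<dots> \<le> 2 * (M * x) ^ 4" using le by (intro mult_left_mono power_mono) auto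
      finally show ?thesis by (simp add: power_mult_distrib)
    qed
    define y where "y = complex_of_real x"
    have y1: "1 + y \<noteq> 0" using x by (auto simp: y_def complex_eq_iff)
    have "H y = T (a * y) - T ((1 - a) * y) + (1 - s) * T (1 * y) + e * y ^ 4 * (- 3 - 2 * y) / (1 + y)\<^sup>2"
    proof -
      have gen: "L1 - L2 + (1 - s) * L3 + E1 - E2 = (L1 - A1) - (L2 - A2) + (1 - s) * (L3 - A3) + E3"
        if "E1 - E2 - E3 = E4" "A1 - A2 + (1 - s) * A3 + E4 = 0" for L1 L2 L3 A1 A2 A3 E1 E2 E3 E4 :: complex
        proof -
        have "E1 = E2 + E3 + E4" "E4 = A2 - A1 - (1 - s) * A3" using that by (simp_all add: algebra_simps)
        thus ?thesis by (simp add: right_diff_distrib[of "1 - s"])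
      qed
      have E: "e * y\<^sup>2 - e * y\<^sup>2 / (1 + y)\<^sup>2 - e * y ^ 4 * (- 3 - 2 * y) / (1 + y)\<^sup>2 = 2 * e * y ^ 3"
        using y1 by (simp add: divide_simps) (simp add: algebra_simps power2_eq_square power3_eq_cube power4_eq_xxxx)
      \<comment> \<open>Orders 1 and 2 cancel because \<open>s = 2 * a\<close>; order 3 determines
        \<open>e\<close>.\<close>
      have A: "a * y - (a * y)\<^sup>2 / 2 + (a * y) ^ 3 / 3 - ((1 - a) * y - ((1 - a) * y)\<^sup>2 / 2 + ((1 - a) * y) ^ 3 / 3)
          + (1 - s) * (1 * y - (1 * y)\<^sup>2 / 2 + (1 * y) ^ 3 / 3) + 2 * e * y ^ 3 = 0"
        unfolding a_def e_def by (simp add: field_simps power2_eq_square power3_eq_cube)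
      show ?thesis using gen[OF E A, of "Ln (1 + a * y)" "Ln (1 + (1 - a) * y)" "Ln (1 + y)"]
        by (simp only: H_def T_def mult_1_left)
    qed
    also have "norm \<dots> \<le> 2 * M ^ 4 * x ^ 4 + 2 * M ^ 4 * x ^ 4 + norm (1 - s) * (2 * M ^ 4 * x ^ 4) + 5 * norm e * x ^ 4"
    proof (intro norm_triangle_le norm_triangle_le_diff add_mono)
      show "norm (T (a * y)) \<le> 2 * M ^ 4 * x ^ 4" unfolding y_def by (intro T M)
      show "norm (T ((1 - a) * y)) \<le> 2 * M ^ 4 * x ^ 4" unfolding y_def by (intro T M)
      show "norm ((1 - s) * T (1 * y)) \<le> norm (1 - s) * (2 * M ^ 4 * x ^ 4)"
        unfolding y_def norm_mult[of "1 - s"] using M by (intro mult_left_mono T) auto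
      have "1 / (2 * M) \<le> 1" using M by simp
      hence x1: "x \<le> 1" using x by linarith
      have "norm (e * y ^ 4 * (- 3 - 2 * y) / (1 + y)\<^sup>2) = norm e * x ^ 4 * (norm (- 3 - 2 * y) / norm ((1 + y)\<^sup>2))"
        using x by (simp add: norm_mult norm_divide norm_power y_def)
      also have "\<dots> \<le> norm e * x ^ 4 * (5 / 1)"
      proof (intro mult_left_mono frac_le)
        have "- 3 - 2 * y = of_real (- 3 - 2 * x)" by (simp add: y_def)
        hence "norm (- 3 - 2 * y) = \<bar>- 3 - 2 * x\<bar>" by (metis norm_of_real)
        thus "norm (- 3 - 2 * y) \<le> 5" using x x1 by simp
        have "(1 + y)\<^sup>2 = of_real ((1 + x)\<^sup>2)" by (simp add: y_def)
        hence "norm ((1 + y)\<^sup>2) = (1 + x)\<^sup>2" by (metis norm_of_real abs_power2)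
        thus "1 \<le> norm ((1 + y)\<^sup>2)" using x by simp
      qed (use x in auto)
      finally show "norm (e * y ^ 4 * (- 3 - 2 * y) / (1 + y)\<^sup>2) \<le> 5 * norm e * x ^ 4" by simp
    qed
    finally show ?thesis by (simp add: C_def y_def algebra_simps)
  qed
  have C: "C \<ge> 0" using M by (simp add: C_def)
  define m0 where "m0 = nat \<lceil>2 * M\<rceil>"
  have m0: "real m > 0" "1 / real m \<le> 1 / (2 * M)" if "m \<ge> m0" for m
  proof -
    have "real m \<ge> 2 * M" using that by (simp add: m0_def)
    thus "real m > 0" "1 / real m \<le> 1 / (2 * M)" using M by (auto intro!: divide_left_mono)
  qed
  have Hm: "norm (H (1 / of_nat m)) \<le> C * (1 / real m ^ 4)" if "m \<ge> m0" for m
    using H[of "1 / real m"] m0[OF that] by (simp add: power_one_over)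
  have s2: "summable (\<lambda>m. 1 / real m ^ 2)"
    using inverse_power_summable[of 2, where 'a = real] by (simp add: inverse_eq_divide)
  have sH: "summable (\<lambda>m. H (1 / of_nat m))"
  proof (rule summable_comparison_test'[OF summable_mult[OF s2, of C], of m0])
    fix m assume m: "m \<ge> m0"
    have "1 / real m ^ 4 \<le> 1 / real m ^ 2"
      using m0[OF m] by (intro divide_left_mono power_increasing) (auto simp: Suc_le_eq)
    thus "norm (H (1 / of_nat m)) \<le> C * (1 / real m ^ 2)"
      using Hm[OF m] mult_left_mono[OF _ C] by fastforce
  qed
  define R where "R = (\<lambda>m. \<Sum>j. H (1 / of_nat (j + m)))"
  have R_Suc: "R m = H (1 / of_nat m) + R (Suc m)" for m
    unfolding R_def using suminf_split_head[of "\<lambda>j. H (1 / of_nat (j + m))"] sH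
    by (simp add: summable_iff_shift[of "\<lambda>j. H (1 / of_nat j)" m] del: of_nat_add)
  have tail: "(\<lambda>m. \<Sum>j. 1 / real (j + m) ^ 2) \<longlonglongrightarrow> 0"
  proof -
    have "(\<lambda>m. (\<Sum>j. 1 / real j ^ 2) - (\<Sum>j<m. 1 / real j ^ 2)) \<longlonglongrightarrow> (\<Sum>j. 1 / real j ^ 2) - (\<Sum>j. 1 / real j ^ 2)"
      by (intro tendsto_intros summable_LIMSEQ s2)
    thus ?thesis using suminf_minus_initial_segment[OF s2] by simp
  qed
  have R0: "(\<lambda>m. of_nat m ^ 2 * R m) \<longlonglongrightarrow> 0"
  proof (rule Lim_null_comparison)
    show "(\<lambda>m. C * (\<Sum>j. 1 / real (j + m) ^ 2)) \<longlonglongrightarrow> 0" using tendsto_mult_right_zero[OF tail] .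
    show "eventually (\<lambda>m. norm (of_nat m ^ 2 * R m) \<le> C * (\<Sum>j. 1 / real (j + m) ^ 2)) sequentially"
      using eventually_ge_at_top[of m0]
    proof eventually_elim
      case (elim m)
      have sm: "summable (\<lambda>j. 1 / real (j + m) ^ 2)" using s2 by (subst summable_iff_shift)
      have "norm (R m) \<le> (\<Sum>j. C / real m ^ 2 * (1 / real (j + m) ^ 2))"
        unfolding R_def
      proof (rule norm_suminf_le[OF _ summable_mult[OF sm]])
        fix j
        have jm: "j + m \<ge> m0" using elim by simp
        have "real m ^ 2 * real (j + m) ^ 2 \<le> real (j + m) ^ 2 * real (j + m) ^ 2"
          by (intro mult_right_mono power_mono) auto
        also have "\<dots> = real (j + m) ^ 4" by (simp add: power_add[symmetric])
        finally have "C * (1 / real (j + m) ^ 4) \<le> C * (1 / (real m ^ 2 * real (j + m) ^ 2))"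
          using m0[OF elim] m0[OF jm] C by (intro mult_left_mono divide_left_mono) auto
        thus "norm (H (1 / of_nat (j + m))) \<le> C / real m ^ 2 * (1 / real (j + m) ^ 2)"
          using Hm[OF jm] by simp
      qed
      also have "\<dots> = C / real m ^ 2 * (\<Sum>j. 1 / real (j + m) ^ 2)" by (rule suminf_mult[OF sm])
      finally show ?case using m0[OF elim] by (simp add: norm_mult norm_power field_simps)
    qed
  qed
  have inv2: "(\<lambda>m. 1 / of_nat m ^ 2 :: complex) \<longlonglongrightarrow> 0"
  proof -
    have "(\<lambda>m. 1 / real m ^ 2) \<longlonglongrightarrow> 0" by real_asymp
    from tendsto_of_real[OF this, where 'a = complex] show ?thesis by simp
  qed
  define y where "y = (\<lambda>m. e * (1 / of_nat m ^ 2) - R m)"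
  have R00: "R \<longlonglongrightarrow> 0"
  proof (rule Lim_transform_eventually)
    show "(\<lambda>m. (1 / of_nat m ^ 2) * (of_nat m ^ 2 * R m)) \<longlonglongrightarrow> 0" using tendsto_mult[OF inv2 R0] by simp
    show "eventually (\<lambda>m. (1 / of_nat m ^ 2) * (of_nat m ^ 2 * R m) = R m) sequentially"
      using eventually_gt_at_top[of 0] by eventually_elim simp
  qed
  have y0: "y \<longlonglongrightarrow> 0" unfolding y_def using tendsto_diff[OF tendsto_mult_left[OF inv2, of e] R00] by simp
  have y2: "(\<lambda>m. of_nat m ^ 2 * y m) \<longlonglongrightarrow> e"
  proof (rule Lim_transform_eventually)
    show "(\<lambda>m. e - of_nat m ^ 2 * R m) \<longlonglongrightarrow> e" using tendsto_diff[OF tendsto_const R0] by simp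
    show "eventually (\<lambda>m. e - of_nat m ^ 2 * R m = of_nat m ^ 2 * y m) sequentially"
      using eventually_gt_at_top[of 0] by eventually_elim (simp add: y_def field_simps)
  qed
  \<comment> \<open>\<open>P\<close> is constant from \<open>m0\<close> on and tends to 1, hence
    equals 1 there: the exponential formula is exact, not merely asymptotic.\<close>
  define P where "P = (\<lambda>m. sine_coeff s m * of_nat m powr (1 - s) * exp (- y m))"
  have P_Suc: "P (Suc m) = P m" if m: "m \<ge> m0" for m
  proof -
    have mp: "m > 0" using m0[OF m] by simp
    define x where "x = (1 / of_nat m :: complex)"
    have xr: "x = of_real (1 / real m)" by (simp add: x_def)
    have nz: "1 + a * x \<noteq> 0" "1 + (1 - a) * x \<noteq> 0" "1 + x \<noteq> 0"
      using s mp add_pos_nonneg[of 1 "1 / real m"] by (auto simp: complex_eq_iff xr a_def)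
    have x0: "x \<noteq> 0" using mp by (simp add: x_def)
    have pw: "of_nat (Suc m) powr (1 - s) = of_nat m powr (1 - s) * exp ((1 - s) * Ln (1 + x))"
    proof -
      have "of_nat (Suc m) = complex_of_real (real m) * complex_of_real (1 + 1 / real m)"
        using mp by (simp add: field_simps)
      also have "\<dots> powr (1 - s) = of_real (real m) powr (1 - s) * of_real (1 + 1 / real m) powr (1 - s)"
        by (rule powr_times_real) auto
      also have "of_real (1 + 1 / real m) powr (1 - s) = exp ((1 - s) * Ln (1 + x))"
        using nz by (simp add: powr_def xr del: of_real_divide)
      finally show ?thesis by simp
    qed
    have "sine_coeff s (Suc m) = sine_coeff s m * (1 + a * x) / (1 + (1 - a) * x)"
    proof -
      have "of_nat m * (1 + a * x) = of_nat m + s / 2" "of_nat m * (1 + (1 - a) * x) = of_nat m + (1 - s / 2)"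
        using mp by (simp_all add: x_def a_def field_simps)
      hence "of_nat m * ((1 + (1 - a) * x) * sine_coeff s (Suc m)) = of_nat m * ((1 + a * x) * sine_coeff s m)"
        using sine_coeff_Suc[OF s, of m] by (simp only: mult.assoc[symmetric])
      hence "(1 + (1 - a) * x) * sine_coeff s (Suc m) = (1 + a * x) * sine_coeff s m"
        using mp mult_left_cancel[of "of_nat m :: complex"] by fastforce
      thus ?thesis unfolding nonzero_eq_divide_eq[OF nz(2)] by (simp only: mult.commute)
    qed
    also have "\<dots> = sine_coeff s m * exp (Ln (1 + a * x) - Ln (1 + (1 - a) * x))"
      using nz by (simp add: exp_diff)
    finally have c: "sine_coeff s (Suc m) = sine_coeff s m * exp (Ln (1 + a * x) - Ln (1 + (1 - a) * x))" .
    have x': "1 / of_nat (Suc m) ^ 2 = x\<^sup>2 / (1 + x)\<^sup>2"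
      using mp nz by (simp add: x_def field_simps)
    have "Ln (1 + a * x) - Ln (1 + (1 - a) * x) + (1 - s) * Ln (1 + x) - y (Suc m) = - y m"
      using R_Suc[of m] unfolding y_def x' by (simp add: H_def x_def[symmetric] power_one_over)
         (simp add: x_def power_one_over)
    hence "exp (Ln (1 + a * x) - Ln (1 + (1 - a) * x)) * exp ((1 - s) * Ln (1 + x)) * exp (- y (Suc m)) = exp (- y m)"
      by (simp only: exp_add[symmetric] diff_conv_add_uminus)
    thus ?thesis unfolding P_def c pw by (simp add: mult_ac)
  qed
  have "P m = P m0" if "m \<ge> m0" for m
    using that by (induction rule: dec_induct) (simp_all add: P_Suc)
  hence ev: "eventually (\<lambda>m. P m = P m0) sequentially"
    by (rule eventually_mono[OF eventually_ge_at_top])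
  hence "P \<longlonglongrightarrow> P m0" by (rule tendsto_eventually)
  moreover have "P \<longlonglongrightarrow> 1 * exp (- 0)"
    unfolding P_def by (intro tendsto_intros sine_coeff_asymp[OF s] y0)
  ultimately have "P m0 = 1 * exp (- 0)" by (rule LIMSEQ_unique)
  hence P1: "eventually (\<lambda>m. P m = 1) sequentially" using ev by simp
  \<comment> \<open>The difference quotient of \<open>exp\<close> at 0 with its removable value,
    which covers \<open>y m = 0\<close> as well.\<close>
  define g where "g = (\<lambda>z::complex. if z = 0 then 1 else (exp z - 1) / z)"
  have g: "exp z - 1 = z * g z" for z by (simp add: g_def)
  have "((\<lambda>z::complex. (exp z - 1) / z) \<longlongrightarrow> 1) (at 0)"
    using DERIV_exp[of "0::complex"] by (simp add: has_field_derivative_iff)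
  hence "(g \<longlongrightarrow> 1) (at 0)"
    by (rule Lim_transform_eventually) (auto simp: g_def eventually_at_filter)
  hence "isCont g 0" by (simp add: isCont_def g_def)
  from isCont_tendsto_compose[OF this y0] have gy: "(\<lambda>m. g (y m)) \<longlonglongrightarrow> 1" by (simp add: g_def)
  have "(\<lambda>m. of_nat m ^ 2 * y m * g (y m)) \<longlonglongrightarrow> e * 1" by (intro tendsto_mult y2 gy)
  moreover have "eventually (\<lambda>m. of_nat m ^ 2 * y m * g (y m) = of_nat m ^ 2 * (sine_coeff s m * of_nat m powr (1 - s) - 1)) sequentially"
    using P1
  proof eventually_elim
    case (elim m)
    hence "sine_coeff s m * of_nat m powr (1 - s) = exp (y m)" by (simp add: P_def exp_minus field_simps)
    thus ?case by (simp add: g)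
  qed
  ultimately have "(\<lambda>m. of_nat m ^ 2 * (sine_coeff s m * of_nat m powr (1 - s) - 1)) \<longlonglongrightarrow> e * 1"
    by (rule Lim_transform_eventually)
  thus ?thesis by (simp add: e_def)
qed

section \<open>The Fourier expansion of \<open>(sin x)\<^sup>-\<^sup>s\<close>\<close>

text \<open>The factor 2 collects the frequencies \<open>m\<close> and \<open>- m\<close>.\<close>

definition sine_sum :: "complex \<Rightarrow> nat \<Rightarrow> real \<Rightarrow> complex" where
  "sine_sum s M x = sine_coeff s 0 + 2 * (\<Sum>m=1..M. sine_coeff s m * of_real (cos (2 * real m * x)))"

text \<open>Fixed by the constant term: \<open>pi * sine_const s * sine_coeff s 0\<close> is the
  integral of \<open>sin x powr (- s)\<close> over \<open>{0..pi}\<close>.\<close>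

definition sine_const :: "complex \<Rightarrow> complex" where
  "sine_const s = Gamma ((1 - s) / 2) / (of_real (sqrt pi) * Gamma (s / 2))"

section \<open>Passing from \<open>s\<close> to \<open>s - 2\<close>\<close>

text \<open>The coefficient side of multiplying by \<open>4 * (sin x)^2\<close>, which sends
  \<open>cos (2 * m * x)\<close> to minus a second difference of cosines. The second equation is the
  case of frequency 0, where the coefficients continue evenly to \<open>-1\<close>. All terms are
  polynomial multiples of one coefficient for \<open>s - 2\<close>.\<close>

lemma sine_coeff_shift:
  assumes s: "Im s \<noteq> 0"
  shows "2 * sine_coeff s (Suc m) - sine_coeff s (Suc (Suc m)) - sine_coeff s m
           = (1 - s) * (s - 2) * sine_coeff (s - 2) (Suc m)"
    and "sine_coeff s 0 - sine_coeff s 1 = (1 - s) * (s - 2) / 2 * sine_coeff (s - 2) 0"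
proof -
  define a where "a = s / 2"
  have s_eq: "s = 2 * a" by (simp add: a_def)
  have nz: "of_nat m + a \<noteq> 0" "of_nat m - a \<noteq> 0" for m using s by (auto simp: complex_eq_iff a_def)
  have G: "Gamma (z + 1) = z * Gamma z" if "Im z \<noteq> 0" for z :: complex
    using that Gamma_plus1[of z] by (simp add: nonreal_not_nonpos_Int)
  have main: "sine_coeff s m = (of_nat m + a - 1) * (of_nat m + 1 - a) * sine_coeff (s - 2) m" for m
  proof -
    have "Gamma (of_nat m + a) = (of_nat m + a - 1) * Gamma (of_nat m + (a - 1))"
      using G[of "of_nat m + (a - 1)"] s by (simp add: a_def algebra_simps)
    moreover have "Gamma (of_nat m + (1 - (a - 1))) = (of_nat m + 1 - a) * Gamma (of_nat m + (1 - a))"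
      using G[of "of_nat m + (1 - a)"] s by (simp add: a_def algebra_simps)
    moreover have "of_nat m + 1 - a \<noteq> 0" using nz(2)[of "Suc m"] by (simp add: add_ac)
    moreover have "sine_coeff (s - 2) m = Gamma (of_nat m + (a - 1)) / Gamma (of_nat m + (1 - (a - 1)))"
      by (simp add: sine_coeff_def a_def diff_divide_distrib)
    moreover have "sine_coeff s m = Gamma (of_nat m + a) / Gamma (of_nat m + (1 - a))"
      by (simp add: sine_coeff_def a_def)
    ultimately show ?thesis by (simp only: times_divide_eq_right mult_divide_mult_cancel_left) simp
  qed
  have rec: "(of_nat m + 1 - a) * sine_coeff s (Suc m) = (of_nat m + a) * sine_coeff s m" for m
    using sine_coeff_Suc[OF s, of m] by (simp add: a_def algebra_simps)
  define g where "g = sine_coeff (s - 2) (Suc m)"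
  define n where "n = (of_nat (Suc m) :: complex)"
  have 0: "sine_coeff s (Suc m) = (n + a - 1) * (n + 1 - a) * g" unfolding n_def g_def by (rule main)
  have 1: "sine_coeff s (Suc (Suc m)) = (n + a - 1) * (n + a) * g"
  proof -
    have "n + 1 - a \<noteq> 0" using nz(2)[of "Suc (Suc m)"] by (simp add: n_def add_ac)
    moreover have "(n + 1 - a) * sine_coeff s (Suc (Suc m)) = (n + 1 - a) * ((n + a - 1) * (n + a) * g)"
      using rec[of "Suc m"] unfolding 0 n_def[symmetric] by (simp add: mult_ac)
    ultimately show ?thesis using mult_left_cancel by blast
  qed
  have 2: "sine_coeff s m = (n + 1 - a) * (n - a) * g"
  proof -
    have "n + a - 1 \<noteq> 0" using nz(1)[of m] by (simp add: n_def)
    moreover have "(n + a - 1) * sine_coeff s m = (n + a - 1) * ((n + 1 - a) * (n - a) * g)"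
    proof -
      have e: "of_nat m + a = n + a - 1" "of_nat m + 1 - a = n - a" by (simp_all add: n_def)
      show ?thesis using rec[of m] unfolding 0 e by (simp only: mult_ac)
    qed
    ultimately show ?thesis using mult_left_cancel by blast
  qed
  show "2 * sine_coeff s (Suc m) - sine_coeff s (Suc (Suc m)) - sine_coeff s m
           = (1 - s) * (s - 2) * sine_coeff (s - 2) (Suc m)"
    unfolding 0 1 2 g_def[symmetric] unfolding s_eq by (simp add: algebra_simps)
  define h where "h = sine_coeff (s - 2) 0"
  have h0: "sine_coeff s 0 = (a - 1) * (1 - a) * h" using main[of 0] by (simp add: h_def)
  have h1: "sine_coeff s 1 = a * (a - 1) * h"
  proof -
    have "1 - a \<noteq> 0" using nz(2)[of 1] by simp
    moreover have "(1 - a) * sine_coeff s 1 = (1 - a) * (a * (a - 1) * h)"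
      using rec[of 0] unfolding h0 by (simp add: mult_ac)
    ultimately show ?thesis using mult_left_cancel by blast
  qed
  show "sine_coeff s 0 - sine_coeff s 1 = (1 - s) * (s - 2) / 2 * sine_coeff (s - 2) 0"
    unfolding h0 h1 h_def[symmetric] unfolding s_eq by (simp add: field_simps)
qed

text \<open>The last two terms come from cutting off the second difference at \<open>M\<close>; they
  vanish in the limit when \<open>Re s < 1\<close>.\<close>

lemma sine_sum_shift:
  assumes s: "Im s \<noteq> 0"
  shows "4 * of_real ((sin x)\<^sup>2) * sine_sum s M x =
    (1 - s) * (s - 2) * sine_sum (s - 2) M x + 2 * sine_coeff s (Suc M) * of_real (cos (2 * real M * x))
      - 2 * sine_coeff s M * of_real (cos (2 * real (Suc M) * x))"
proof (induction M)
  case 0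
  have "(sin x)\<^sup>2 = (1 - cos (2 * x)) / 2" by (simp add: cos_double_sin)
  hence S: "complex_of_real ((sin x)\<^sup>2) = (1 - of_real (cos (2 * x))) / 2"
    by (simp only: of_real_divide of_real_diff of_real_1 of_real_numeral)
  moreover have "(1 - s) * (s - 2) * sine_coeff (s - 2) 0 = 2 * (sine_coeff s 0 - sine_coeff s 1)"
    unfolding sine_coeff_shift(2)[OF s] by simp
  moreover have "4 * ((1 - C) / 2) * c0 = 2 * (c0 - c1) + 2 * c1 * 1 - 2 * c0 * C" for C c0 c1 :: complex
    by (simp add: field_simps)
  ultimately show ?case unfolding S by (simp add: sine_sum_def)
next
  case (Suc M)
  have "(sin x)\<^sup>2 * cos (2 * real (Suc M) * x) = (2 * cos (2 * real (Suc M) * x) - cos (2 * real (Suc (Suc M)) * x) - cos (2 * real M * x)) / 4"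
  proof -
    have a: "2 * real (Suc (Suc M)) * x = 2 * real (Suc M) * x + 2 * x"
      "2 * real M * x = 2 * real (Suc M) * x - 2 * x" by (auto simp: algebra_simps)
    have sq: "(sin x)\<^sup>2 = (1 - cos (2 * x)) / 2" by (simp add: cos_double_sin)
    have "(1 - c) / 2 * C = (2 * C - (C * c - S * S') - (C * c + S * S')) / 4" for c C S S' :: real
      by (simp add: field_simps)
    thus ?thesis unfolding a cos_add cos_diff sq .
  qed
  note sq = this
  have "4 * complex_of_real ((sin x)\<^sup>2) * of_real (cos (2 * real (Suc M) * x)) = of_real (4 * ((sin x)\<^sup>2 * cos (2 * real (Suc M) * x)))"
    by simp
  also have "4 * ((sin x)\<^sup>2 * cos (2 * real (Suc M) * x)) = 2 * cos (2 * real (Suc M) * x) - cos (2 * real (Suc (Suc M)) * x) - cos (2 * real M * x)"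
    unfolding sq by simp
  finally have "4 * complex_of_real ((sin x)\<^sup>2) * of_real (cos (2 * real (Suc M) * x))
     = of_real (2 * cos (2 * real (Suc M) * x) - cos (2 * real (Suc (Suc M)) * x) - cos (2 * real M * x))" .
  hence e: "4 * complex_of_real ((sin x)\<^sup>2) * of_real (cos (2 * real (Suc M) * x))
     = 2 * of_real (cos (2 * real (Suc M) * x)) - of_real (cos (2 * real (Suc (Suc M)) * x)) - of_real (cos (2 * real M * x))"
    by simp
  have S: "sine_sum s (Suc M) x = sine_sum s M x + 2 * sine_coeff s (Suc M) * of_real (cos (2 * real (Suc M) * x))" for s
    by (simp add: sine_sum_def algebra_simps)
  define C0 C1 C2 where "C0 = complex_of_real (cos (2 * real M * x))" and "C1 = complex_of_real (cos (2 * real (Suc M) * x))"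
    and "C2 = complex_of_real (cos (2 * real (Suc (Suc M)) * x))"
  define k where "k = (1 - s) * (s - 2)"
  define q where "q = 4 * complex_of_real ((sin x)\<^sup>2)"
  note sh = sine_coeff_shift(1)[OF s, of M, folded k_def]
  have "q * sine_sum s (Suc M) x = q * sine_sum s M x + 2 * sine_coeff s (Suc M) * (q * C1)"
    unfolding S C1_def by (simp add: algebra_simps)
  also have "q * C1 = 2 * C1 - C2 - C0" using e by (simp add: q_def C0_def C1_def C2_def)
  also have "q * sine_sum s M x = k * sine_sum (s - 2) M x + 2 * sine_coeff s (Suc M) * C0 - 2 * sine_coeff s M * C1"
    using Suc.IH by (simp add: q_def C0_def C1_def k_def)
  also have "k * sine_sum (s - 2) M x + 2 * sine_coeff s (Suc M) * C0 - 2 * sine_coeff s M * C1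
      + 2 * sine_coeff s (Suc M) * (2 * C1 - C2 - C0)
    = k * sine_sum (s - 2) M x + 2 * (k * sine_coeff (s - 2) (Suc M)) * C1
      + 2 * sine_coeff s (Suc (Suc M)) * C1 - 2 * sine_coeff s (Suc M) * C2"
    unfolding sh[symmetric] by (simp add: algebra_simps)
  also have "k * sine_sum (s - 2) M x + 2 * (k * sine_coeff (s - 2) (Suc M)) * C1 = k * sine_sum (s - 2) (Suc M) x"
    unfolding S C1_def by (simp add: algebra_simps)
  finally show ?case by (simp add: q_def C1_def C2_def k_def)
qed

text \<open>The same factor as in \<open>sine_sum_shift\<close>, so that the normalised expansion
  for \<open>s - 2\<close>, divided by \<open>(sin x)^2\<close>, is the normalised expansion for
  \<open>s\<close>.\<close>

lemma sine_const_shift: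
  assumes s: "Im s \<noteq> 0"
  shows "4 * sine_const (s - 2) = (1 - s) * (s - 2) * sine_const s"
proof -
  have G: "Gamma (z + 1) = z * Gamma z" if "Im z \<noteq> 0" for z :: complex
    using that Gamma_plus1[of z] by (simp add: nonreal_not_nonpos_Int)
  have 1: "Gamma ((1 - (s - 2)) / 2) = (1 - s) / 2 * Gamma ((1 - s) / 2)"
    using G[of "(1 - s) / 2"] s by (simp add: field_simps)
  have 2: "Gamma (s / 2) = (s - 2) / 2 * Gamma ((s - 2) / 2)"
    using G[of "(s - 2) / 2"] s by (simp add: field_simps)
  have "s - 2 \<noteq> 0" using s by auto
  moreover have "Gamma ((s - 2) / 2) \<noteq> 0" using s by (intro Gamma_nonzero nonreal_not_nonpos_Int) auto
  ultimately show ?thesis unfolding sine_const_def 1 2 by (simp add: field_simps)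
qed

lemma sine_coeff_LIMSEQ_0:
  assumes s: "Im s \<noteq> 0" and "Re s < 1"
  shows "sine_coeff s \<longlonglongrightarrow> 0"
proof -
  obtain B where B: "B \<ge> 0" "\<And>n. n > 0 \<Longrightarrow> norm (sine_coeff s n) \<le> B * real n powr (Re s - 1)"
    using norm_sine_coeff_le[OF s] by blast
  have "(\<lambda>n. real n powr (Re s - 1)) \<longlonglongrightarrow> 0"
    using tendsto_neg_powr[OF _ filterlim_real_sequentially, of "Re s - 1"] assms by simp
  from tendsto_mult_left[OF this, of B] have lim: "(\<lambda>n. B * real n powr (Re s - 1)) \<longlonglongrightarrow> 0" by simp
  show ?thesis
    by (rule Lim_null_comparison[OF _ lim], rule eventually_mono[OF eventually_gt_at_top[of 0]])
       (use B in auto)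
qed

lemma sine_sum_LIMSEQ_shift:
  assumes s: "Im s \<noteq> 0" "Re s < 1" and x: "sin x \<noteq> 0"
    and lim: "(\<lambda>M. sine_const (s - 2) * sine_sum (s - 2) M x) \<longlonglongrightarrow> of_real (sin x) powr (- (s - 2))"
  shows "(\<lambda>M. sine_const s * sine_sum s M x) \<longlonglongrightarrow> of_real (sin x) powr (- s)"
proof -
  define K S where "K = sine_const s" and "S = complex_of_real ((sin x)\<^sup>2)"
  have S: "S \<noteq> 0" using x by (simp add: S_def)
  have bd: "(\<lambda>M. c M * of_real (cos (t M))) \<longlonglongrightarrow> 0" if "c \<longlonglongrightarrow> 0" for c :: "nat \<Rightarrow> complex" and t
    by (rule Lim_null_comparison[OF _ tendsto_norm_zero[OF that]])
       (auto simp: norm_mult intro!: mult_left_le always_eventually)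
  have c0: "sine_coeff s \<longlonglongrightarrow> 0" by (rule sine_coeff_LIMSEQ_0[OF s])
  have 1: "(\<lambda>M. (2 * K) * (sine_coeff s (Suc M) * of_real (cos (2 * real M * x)))) \<longlonglongrightarrow> (2 * K) * 0"
    by (intro tendsto_mult_left bd LIMSEQ_Suc[OF c0])
  have 2: "(\<lambda>M. (2 * K) * (sine_coeff s M * of_real (cos (2 * real (Suc M) * x)))) \<longlonglongrightarrow> (2 * K) * 0"
    by (intro tendsto_mult_left bd c0)
  have "(\<lambda>M. (4 * (sine_const (s - 2) * sine_sum (s - 2) M x)
      + (2 * K) * (sine_coeff s (Suc M) * of_real (cos (2 * real M * x)))
      - (2 * K) * (sine_coeff s M * of_real (cos (2 * real (Suc M) * x)))) / (4 * S))
    \<longlonglongrightarrow> (4 * of_real (sin x) powr (- (s - 2)) + (2 * K) * 0 - (2 * K) * 0) / (4 * S)"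
    using S by (intro tendsto_divide tendsto_diff tendsto_add tendsto_mult_left lim 1 2 tendsto_const) auto
  moreover have "(4 * (sine_const (s - 2) * sine_sum (s - 2) M x)
      + (2 * K) * (sine_coeff s (Suc M) * of_real (cos (2 * real M * x)))
      - (2 * K) * (sine_coeff s M * of_real (cos (2 * real (Suc M) * x)))) / (4 * S) = K * sine_sum s M x" for M
  proof -
    have "4 * S * (K * sine_sum s M x) = K * (4 * S * sine_sum s M x)" by (simp add: mult_ac)
    also have "\<dots> = (K * ((1 - s) * (s - 2))) * sine_sum (s - 2) M x
       + (2 * K) * (sine_coeff s (Suc M) * of_real (cos (2 * real M * x)))
      - (2 * K) * (sine_coeff s M * of_real (cos (2 * real (Suc M) * x)))"
      unfolding S_def sine_sum_shift[OF s(1)] by (simp add: algebra_simps)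
    also have "K * ((1 - s) * (s - 2)) = 4 * sine_const (s - 2)"
      using sine_const_shift[OF s(1)] by (simp add: K_def mult_ac)
    finally show ?thesis using S by (simp add: field_simps)
  qed
  moreover have "4 * of_real (sin x) powr (- (s - 2)) / (4 * S) = of_real (sin x) powr (- s)"
  proof -
    have "of_real (sin x) powr (- (s - 2)) = of_real (sin x) powr (- s) * of_real (sin x) powr (2 :: complex)"
      unfolding powr_add[symmetric] by (rule arg_cong[where f = "\<lambda>t. _ powr t"]) simp
    also have "of_real (sin x) powr (2 :: complex) = S" using x by (simp add: S_def powr_numeral)
    finally show ?thesis using S by simp
  qed
  ultimately show ?thesis by (simp add: K_def)
qed

section \<open>Integrals of complex powers of the sine\<close>

definition sin_powr :: "complex \<Rightarrow> real \<Rightarrow> complex" where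
  "sin_powr p x = complex_of_real (sin x) powr p"

lemma continuous_on_sin_powr:
  assumes "Re p > 0"
  shows "continuous_on {0..pi} (sin_powr p)"
  unfolding sin_powr_def
  by (rule continuous_on_powr_complex) (use assms in \<open>auto intro!: continuous_intros simp: sin_ge_zero\<close>)

lemma norm_sin_powr: "sin x \<ge> 0 \<Longrightarrow> norm (sin_powr p x) = sin x powr Re p"
  by (simp add: sin_powr_def norm_powr_real_powr)

lemma has_vector_derivative_sin_powr:
  assumes "sin x > 0"
  shows "(sin_powr p has_vector_derivative p * sin_powr (p - 1) x * of_real (cos x)) (at x)"
proof -
  have "((\<lambda>x. complex_of_real (sin x)) has_vector_derivative of_real (cos x)) (at x)"
    by (auto intro!: derivative_eq_intros has_vector_derivative_of_real simp: has_real_derivative_iff_has_vector_derivative[symmetric])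
  moreover have "((\<lambda>z. z powr p) has_field_derivative p * of_real (sin x) powr (p - 1)) (at (complex_of_real (sin x)))"
    using assms by (intro has_field_derivative_powr) (auto simp: complex_nonpos_Reals_iff)
  ultimately have "((\<lambda>z. z powr p) \<circ> (\<lambda>x. complex_of_real (sin x)) has_vector_derivative
     of_real (cos x) * (p * of_real (sin x) powr (p - 1))) (at x)"
    by (rule field_vector_diff_chain_at)
  thus ?thesis by (simp add: sin_powr_def[abs_def] o_def mult_ac)
qed

lemma sin_powr_add: "sin_powr (p + q) x = sin_powr p x * sin_powr q x"
  by (simp add: sin_powr_def powr_add)

lemma sin_powr_1: "sin_powr 1 x = of_real (sin x)"
  by (simp add: sin_powr_def)

lemma sin_powr_2: "sin_powr 2 x = of_real ((sin x)\<^sup>2)"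
  using sin_powr_add[of 1 1 x] by (simp add: sin_powr_1 power2_eq_square)

definition sin_powr_integral :: "complex \<Rightarrow> complex" where
  "sin_powr_integral p = integral {0..pi} (sin_powr p)"

lemma has_integral_sin_powr:
  "Re p > 0 \<Longrightarrow> (sin_powr p has_integral sin_powr_integral p) {0..pi}"
  unfolding sin_powr_integral_def
  by (intro integrable_integral integrable_continuous_real continuous_on_sin_powr)

text \<open>Wallis's recurrence with complex exponent. \<open>F\<close> vanishes at both ends and is
  differentiated only in the interior, where \<open>sin x > 0\<close>.\<close>

lemma sin_powr_integral_rec:
  assumes "Re p > 0"
  shows "(p + 2) * sin_powr_integral (p + 2) = (p + 1) * sin_powr_integral p"
proof -
  define F where "F = (\<lambda>x. - (of_real (cos x) * sin_powr (p + 1) x))"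
  have "((\<lambda>x. (p + 2) * sin_powr (p + 2) x - (p + 1) * sin_powr p x) has_integral F pi - F 0) {0..pi}"
  proof (rule fundamental_theorem_of_calculus_interior)
    show "continuous_on {0..pi} F"
      unfolding F_def using assms by (intro continuous_intros continuous_on_sin_powr) auto
    fix x :: real assume "x \<in> {0<..<pi}"
    hence sx: "sin x > 0" by (simp add: sin_gt_zero)
    have "((\<lambda>x. complex_of_real (cos x)) has_vector_derivative of_real (- sin x)) (at x)"
      by (auto intro!: derivative_eq_intros has_vector_derivative_of_real simp: has_real_derivative_iff_has_vector_derivative[symmetric])
    from has_vector_derivative_minus[OF has_vector_derivative_mult[OF this has_vector_derivative_sin_powr[OF sx, of "p + 1"]]]
    have "(F has_vector_derivative - (of_real (cos x) * ((p + 1) * sin_powr p x * of_real (cos x)) + of_real (- sin x) * sin_powr (p + 1) x)) (at x)"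
      by (simp add: F_def)
    moreover have "sin_powr (p + 1) x = of_real (sin x) * sin_powr p x" "sin_powr (p + 2) x = of_real ((sin x)\<^sup>2) * sin_powr p x"
      by (simp_all add: sin_powr_add sin_powr_1 sin_powr_2)
    moreover have "complex_of_real (cos x) * of_real (cos x) = 1 - of_real ((sin x)\<^sup>2)"
    proof -
      have "cos x * cos x = 1 - (sin x)\<^sup>2" by (simp add: cos_squared_eq[of x] flip: power2_eq_square)
      hence "complex_of_real (cos x * cos x) = of_real (1 - (sin x)\<^sup>2)" by (simp only:)
      thus ?thesis by (simp only: of_real_mult of_real_diff of_real_1)
    qed
    hence "- (of_real (cos x) * ((p + 1) * S * of_real (cos x)) + of_real (- sin x) * (of_real (sin x) * S))
       = (p + 2) * (of_real ((sin x)\<^sup>2) * S) - (p + 1) * S" for S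
    proof -
      assume *: "complex_of_real (cos x) * of_real (cos x) = 1 - of_real ((sin x)\<^sup>2)"
      have "- (of_real (cos x) * ((p + 1) * S * of_real (cos x)) + of_real (- sin x) * (of_real (sin x) * S))
          = - ((p + 1) * S * (of_real (cos x) * of_real (cos x))) + of_real ((sin x)\<^sup>2) * S"
        by (simp add: power2_eq_square algebra_simps)
      thus ?thesis unfolding * by (simp add: algebra_simps)
    qed
    ultimately show "(F has_vector_derivative (p + 2) * sin_powr (p + 2) x - (p + 1) * sin_powr p x) (at x)"
      by simp
  qed auto
  hence "((\<lambda>x. (p + 2) * sin_powr (p + 2) x - (p + 1) * sin_powr p x) has_integral 0) {0..pi}"
    by (simp add: F_def sin_powr_def)
  moreover have "((\<lambda>x. (p + 2) * sin_powr (p + 2) x - (p + 1) * sin_powr p x) has_integral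
      (p + 2) * sin_powr_integral (p + 2) - (p + 1) * sin_powr_integral p) {0..pi}"
    using assms by (intro has_integral_diff has_integral_mult_right has_integral_sin_powr) auto
  ultimately have "0 = (p + 2) * sin_powr_integral (p + 2) - (p + 1) * sin_powr_integral p"
    by (rule has_integral_unique)
  thus ?thesis by simp
qed

lemma sin_powr_integral_1: "sin_powr_integral 1 = 2"
proof -
  have "((\<lambda>x. of_real (sin x) :: complex) has_integral of_real (- cos pi) - of_real (- cos 0)) {0..pi}"
    by (rule fundamental_theorem_of_calculus)
       (auto intro!: derivative_eq_intros has_vector_derivative_of_real simp: has_real_derivative_iff_has_vector_derivative[symmetric])
  hence "(sin_powr 1 has_integral 2) {0..pi}" by (simp add: sin_powr_1[abs_def])
  thus ?thesis using has_integral_sin_powr[of 1] by (auto dest: has_integral_unique)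
qed

text \<open>On the segment from \<open>u\<close> to 1 the derivative
  \<open>q * z powr (q - 1)\<close> has modulus at most \<open>norm q\<close>, because
  \<open>Re q >= 1\<close>.\<close>

lemma norm_powr_minus_one_le:
  fixes u :: real
  assumes u: "0 < u" "u \<le> 1" and q: "Re q \<ge> 1"
  shows "norm (of_real u powr q - 1) \<le> norm q * (1 - u)"
proof -
  have "norm (of_real u powr q - of_real 1 powr q) \<le> norm q * norm (complex_of_real u - of_real 1)"
  proof (rule field_differentiable_bound[of "closed_segment (of_real u) (of_real 1)"])
    fix z :: complex assume "z \<in> closed_segment (of_real u) (of_real 1)"
    hence "z \<in> of_real ` closed_segment u 1" by (simp only: closed_segment_of_real)
    then obtain v where v: "z = of_real v" "u \<le> v" "v \<le> 1"
      using u by (auto simp: closed_segment_eq_real_ivl)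
    show "((\<lambda>z. z powr q) has_field_derivative q * z powr (q - 1)) (at z within closed_segment (of_real u) (of_real 1))"
      using v u by (intro has_field_derivative_at_within[OF has_field_derivative_powr]) (auto simp: complex_nonpos_Reals_iff)
    have "v powr (Re q - 1) \<le> 1" using v u q by (intro powr_le1) auto
    thus "norm (q * z powr (q - 1)) \<le> norm q"
      using v u by (simp add: norm_mult norm_powr_real_powr mult_left_le)
  qed auto
  also have "complex_of_real u - of_real 1 = of_real (u - 1)" by simp
  finally show ?thesis using u by (simp only: norm_of_real) simp
qed

lemma sin_powr_integral_1_odd:
  "sin_powr_integral (1 + 2 * of_nat J) = of_real (integral {0..pi} (\<lambda>x. sin x ^ (2 * J + 1)))"
  "((\<lambda>x. sin x ^ (2 * J + 1)) has_integral Re (sin_powr_integral (1 + 2 * of_nat J))) {0..pi}"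
proof -
  have eq: "sin_powr (1 + 2 * of_nat J) = (\<lambda>x. complex_of_real (sin x ^ (2 * J + 1)))"
  proof
    fix x show "sin_powr (1 + 2 * of_nat J) x = of_real (sin x ^ (2 * J + 1))"
      using powr_nat'[of "complex_of_real (sin x)" "2 * J + 1"] by (cases "sin x = 0") (auto simp: sin_powr_def add_ac)
  qed
  have "(sin_powr (1 + 2 * of_nat J) has_integral sin_powr_integral (1 + 2 * of_nat J)) {0..pi}"
    by (rule has_integral_sin_powr) simp
  hence *: "((\<lambda>x. complex_of_real (sin x ^ (2 * J + 1))) has_integral sin_powr_integral (1 + 2 * of_nat J)) {0..pi}"
    by (simp only: eq)
  from has_integral_Re[OF this] show **: "((\<lambda>x. sin x ^ (2 * J + 1)) has_integral Re (sin_powr_integral (1 + 2 * of_nat J))) {0..pi}"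
    by simp
  hence "((\<lambda>x. complex_of_real (sin x ^ (2 * J + 1))) has_integral of_real (integral {0..pi} (\<lambda>x. sin x ^ (2 * J + 1)))) {0..pi}"
    by (intro has_integral_of_real) (simp add: integral_unique)
  with * show "sin_powr_integral (1 + 2 * of_nat J) = of_real (integral {0..pi} (\<lambda>x. sin x ^ (2 * J + 1)))"
    by (rule has_integral_unique)
qed

text \<open>For large \<open>J\<close> the mass concentrates at \<open>pi / 2\<close>, where the
  extra factor \<open>sin_powr (p - 1)\<close> is close to 1. The error is at most
  \<open>N * (W J - W (Suc J))\<close>, and the recurrence gives
  \<open>(W J - W (Suc J)) / W J = 1 / (2 * J + 3)\<close>.\<close>

lemma sin_powr_integral_asymp:
  assumes p: "Re p \<ge> 2"
  shows "(\<lambda>J. sin_powr_integral (p + 2 * of_nat J) / sin_powr_integral (1 + 2 * of_nat J)) \<longlonglongrightarrow> 1"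
proof -
  define W where "W = (\<lambda>J. integral {0..pi} (\<lambda>x. sin x ^ (2 * J + 1)))"
  have W: "sin_powr_integral (1 + 2 * of_nat J) = of_real (W J)" for J
    unfolding W_def by (rule sin_powr_integral_1_odd)
  have WI: "((\<lambda>x. sin x ^ (2 * J + 1)) has_integral W J) {0..pi}" for J
    using sin_powr_integral_1_odd(2)[of J] by (simp add: W)
  have Wrec: "(2 * real J + 3) * W (Suc J) = (2 * real J + 2) * W J" for J
  proof -
    have "of_real ((2 * real J + 3) * W (Suc J)) = complex_of_real ((2 * real J + 2) * W J)"
      using sin_powr_integral_rec[of "1 + 2 * of_nat J"] W[of J] W[of "Suc J"] by (simp add: algebra_simps)
    thus ?thesis by (simp only: of_real_eq_iff)
  qed
  have "W 0 = 2" using W[of 0] sin_powr_integral_1 by (metis add.right_neutral mult_zero_right of_nat_0 of_real_eq_iff of_real_numeral)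
  have Wpos: "W J > 0" for J
  proof (induction J)
    case (Suc J)
    have "0 < (2 * real J + 3) * W (Suc J)" unfolding Wrec using Suc by simp
    thus ?case by (simp add: zero_less_mult_iff)
  qed (use \<open>W 0 = 2\<close> in simp)
  define N where "N = norm (p - 1)"
  have bound: "norm (sin_powr_integral (p + 2 * of_nat J) - of_real (W J)) \<le> N * (W J - W (Suc J))" for J
  proof -
    define q where "q = p + 2 * of_nat J - (1 + 2 * of_nat J)"
    have I1: "((\<lambda>x. sin_powr (p + 2 * of_nat J) x - sin_powr (1 + 2 * of_nat J) x) has_integral
       sin_powr_integral (p + 2 * of_nat J) - sin_powr_integral (1 + 2 * of_nat J)) {0..pi}"
      using p by (intro has_integral_diff has_integral_sin_powr) auto
    have I2: "((\<lambda>x. N * (sin x ^ (2 * J + 1) - sin x ^ (2 * Suc J + 1))) has_integral N * (W J - W (Suc J))) {0..pi}"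
      by (intro has_integral_mult_right has_integral_diff WI)
    have le: "norm (sin_powr (p + 2 * of_nat J) x - sin_powr (1 + 2 * of_nat J) x)
      \<le> N * (sin x ^ (2 * J + 1) - sin x ^ (2 * Suc J + 1))" if x: "x \<in> {0..pi}" for x
    proof (cases "sin x = 0")
      case False
      hence sx: "sin x > 0" using sin_ge_zero[of x] x by simp
      have eq: "p + 2 * of_nat J = (1 + 2 * of_nat J) + (p - 1)" by simp
      have "sin_powr (p + 2 * of_nat J) x - sin_powr (1 + 2 * of_nat J) x = sin_powr (1 + 2 * of_nat J) x * (sin_powr (p - 1) x - 1)"
        unfolding eq sin_powr_add[of "1 + 2 * of_nat J"] by (simp add: algebra_simps)
      also have "norm \<dots> \<le> sin x ^ (2 * J + 1) * (N * (1 - sin x))"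
        unfolding norm_mult
      proof (intro mult_mono)
        have "norm (sin_powr (1 + 2 * of_nat J) x) = sin x powr real (2 * J + 1)"
          using sx by (subst norm_sin_powr) (auto simp: add_ac)
        also have "\<dots> = sin x ^ (2 * J + 1)" using sx by (subst powr_realpow) auto
        finally show "norm (sin_powr (1 + 2 * of_nat J) x) \<le> sin x ^ (2 * J + 1)" by simp
        show "norm (sin_powr (p - 1) x - 1) \<le> N * (1 - sin x)"
          unfolding sin_powr_def N_def using sx p by (intro norm_powr_minus_one_le) auto
      qed (use sx in auto)
      \<comment> \<open>Weakened to \<open>1 - (sin x)^2\<close> so that the bound integrates to
        \<open>N * (W J - W (Suc J))\<close>.\<close>
      also have "sin x ^ (2 * J + 1) * (N * (1 - sin x)) \<le> sin x ^ (2 * J + 1) * (N * (1 - sin x ^ 2))"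
      proof (intro mult_left_mono)
        show "1 - sin x \<le> 1 - (sin x)\<^sup>2" using sx mult_left_le[of "sin x" "sin x"] by (simp add: power2_eq_square)
      qed (use sx in \<open>auto simp: N_def\<close>)
      finally show ?thesis by (simp add: algebra_simps power2_eq_square)
    qed (simp add: sin_powr_def)
    have "norm (sin_powr_integral (p + 2 * of_nat J) - sin_powr_integral (1 + 2 * of_nat J)) \<le> N * (W J - W (Suc J))"
      using integral_norm_bound_integral[OF has_integral_integrable[OF I1] has_integral_integrable[OF I2] le]
      unfolding integral_unique[OF I1] integral_unique[OF I2] .
    thus ?thesis by (simp only: W)
  qed
  have "(\<lambda>J. sin_powr_integral (p + 2 * of_nat J) / of_real (W J) - 1) \<longlonglongrightarrow> 0"
  proof (rule Lim_null_comparison)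
    show "eventually (\<lambda>J. norm (sin_powr_integral (p + 2 * of_nat J) / of_real (W J) - 1) \<le> N / (2 * real J + 3)) sequentially"
    proof (intro always_eventually allI)
      fix J
      have WS: "W (Suc J) = (2 * real J + 2) * W J / (2 * real J + 3)" using Wrec[of J] by (simp add: field_simps)
      have "sin_powr_integral (p + 2 * of_nat J) / of_real (W J) - 1 = (sin_powr_integral (p + 2 * of_nat J) - of_real (W J)) / of_real (W J)"
        using Wpos[of J] by (simp add: field_simps)
      also have "norm \<dots> \<le> N * (W J - W (Suc J)) / W J"
        unfolding norm_divide norm_of_real using bound[of J] Wpos[of J] by (simp add: divide_right_mono)
      also have "\<dots> = N / (2 * real J + 3)" 
      proof -
        define D where "D = 2 * real J + 3"
        have D: "D > 0" "2 * real J + 2 = D - 1" by (simp_all add: D_def)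
        have "W J - (D - 1) * W J / D = W J / D" using D by (simp add: field_simps)
        thus ?thesis unfolding WS D(2) D_def[symmetric] using Wpos[of J] by simp
      qed
      finally show "norm (sin_powr_integral (p + 2 * of_nat J) / of_real (W J) - 1) \<le> N / (2 * real J + 3)" .
    qed
    show "(\<lambda>J. N / (2 * real J + 3)) \<longlonglongrightarrow> 0" by real_asymp
  qed
  from tendsto_add[OF this tendsto_const[of 1]] show ?thesis by (simp add: W)
qed

lemma not_nonpos_Ints_Re_pos: "Re z > 0 \<Longrightarrow> z \<notin> \<int>\<^sub>\<le>\<^sub>0"
  by (auto elim!: nonpos_Ints_cases)

text \<open>\<open>E\<close> compares the integral with its closed form and is unchanged when
  \<open>p\<close> grows by 2. Since \<open>E (p + 2 * J) / E (1 + 2 * J)\<close> tends to 1,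
  \<open>E p = E 1 = sqrt pi\<close>.\<close>

lemma sin_powr_integral_eq:
  assumes p: "Re p \<ge> 2"
  shows "sin_powr_integral p * Gamma (p / 2 + 1) = of_real (sqrt pi) * Gamma ((p + 1) / 2)"
proof -
  define E where "E = (\<lambda>p. sin_powr_integral p * (Gamma (p / 2 + 1) / Gamma ((p + 1) / 2)))"
  have E2: "E (p + 2) = E p" if "Re p > 0" for p
  proof -
    have g1: "Gamma ((p + 2) / 2 + 1) = (p / 2 + 1) * Gamma (p / 2 + 1)"
      using Gamma_plus1[of "p / 2 + 1"] that by (simp add: not_nonpos_Ints_Re_pos add_ac add_divide_distrib)
    have g2: "Gamma ((p + 2 + 1) / 2) = (p + 1) / 2 * Gamma ((p + 1) / 2)"
      using Gamma_plus1[of "(p + 1) / 2"] that by (simp add: not_nonpos_Ints_Re_pos add_ac add_divide_distrib)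
    have nz: "(p + 1) / 2 \<noteq> 0" using that by (auto simp: complex_eq_iff)
    have rec: "sin_powr_integral (p + 2) * (p / 2 + 1) = sin_powr_integral p * ((p + 1) / 2)"
      using sin_powr_integral_rec[OF that] by (simp add: field_simps)
    have gen: "I2 * (q * G / (r * H)) = I1 * (G / H)" if "I2 * q = I1 * r" "r \<noteq> 0" for I1 I2 q r G H :: complex
    proof -
      have "I2 * (q * G / (r * H)) = (I2 * q) * G / (r * H)" by simp
      thus ?thesis using that by simp
    qed
    show ?thesis unfolding E_def g1 g2 by (rule gen[OF rec nz])
  qed
  have EJ: "E (p + 2 * of_nat J) = E p" if "Re p > 0" for p J
  proof (induction J)
    case (Suc J)
    have eq: "p + 2 * of_nat (Suc J) = (p + 2 * of_nat J) + 2" by simp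
    show ?case unfolding eq using E2[of "p + 2 * of_nat J"] Suc that by simp
  qed simp
  have E1: "E 1 = of_real (sqrt pi)"
  proof -
    have "Gamma (1 / 2 + 1 :: complex) = 1 / 2 * Gamma (1 / 2)" by (rule Gamma_plus1) (auto simp: not_nonpos_Ints_Re_pos)
    thus ?thesis by (simp add: E_def sin_powr_integral_1 Gamma_one_half_complex mult.commute)
  qed
  have "(\<lambda>J. sin_powr_integral (p + 2 * of_nat J) / sin_powr_integral (1 + 2 * of_nat J) *
     ((Gamma (of_nat J + (p / 2 + 1)) / Gamma (of_nat J + (p + 1) / 2) * of_nat J powr ((p + 1) / 2 - (p / 2 + 1))) /
     (Gamma (of_nat J + 3 / 2) / Gamma (of_nat J + 1) * of_nat J powr (1 - 3 / 2)))) \<longlonglongrightarrow> 1 * (1 / 1)"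
    using p by (intro tendsto_mult tendsto_divide Gamma_quotient_asymp sin_powr_integral_asymp) (auto intro!: not_nonpos_Ints_Re_pos)
  moreover have "eventually (\<lambda>J. sin_powr_integral (p + 2 * of_nat J) / sin_powr_integral (1 + 2 * of_nat J) *
     ((Gamma (of_nat J + (p / 2 + 1)) / Gamma (of_nat J + (p + 1) / 2) * of_nat J powr ((p + 1) / 2 - (p / 2 + 1))) /
     (Gamma (of_nat J + 3 / 2) / Gamma (of_nat J + 1) * of_nat J powr (1 - 3 / 2)))
     = E p / of_real (sqrt pi)) sequentially"
    using eventually_gt_at_top[of 0]
  proof eventually_elim
    case (elim J)
    \<comment> \<open>The powers of \<open>J\<close> attached to the two Gamma quotients have the
      same exponent and cancel.\<close>
    have e: "(p + 1) / 2 - (p / 2 + 1) = - (1 / 2)" "1 - 3 / 2 = - (1 / 2 :: complex)" by (simp_all add: field_simps)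
    have nz: "of_nat J powr (- (1 / 2)) \<noteq> (0 :: complex)" using elim by simp
    have a1: "(p + 2 * of_nat J) / 2 + 1 = of_nat J + (p / 2 + 1)" "((p + 2 * of_nat J) + 1) / 2 = of_nat J + (p + 1) / 2"
      "(1 + 2 * of_nat J) / 2 + 1 = of_nat J + 3 / (2::complex)" "((1 + 2 * of_nat J) + 1) / 2 = of_nat J + (1::complex)"
      by (simp_all add: field_simps)
    have "E p / of_real (sqrt pi) = E (p + 2 * of_nat J) / E (1 + 2 * of_nat J)"
      using EJ[of p J] EJ[of 1 J] E1 p by simp
    thus ?case unfolding e E_def a1 using nz by (simp add: mult_ac)
  qed
  ultimately have "(\<lambda>J::nat. E p / of_real (sqrt pi)) \<longlonglongrightarrow> 1" by (simp add: filterlim_cong)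
  hence "E p / of_real (sqrt pi) = 1" by (simp add: LIMSEQ_const_iff)
  moreover have "Gamma ((p + 1) / 2) \<noteq> 0" using p by (simp add: Gamma_eq_zero_iff not_nonpos_Ints_Re_pos)
  ultimately show ?thesis by (simp add: E_def field_simps)
qed

section \<open>The differential equation and the absolutely convergent case\<close>

text \<open>\<open>sin x powr (- s)\<close> solves \<open>sin x * y' + s * cos x * y = 0\<close>.
  For partial sums, the product formulas and \<open>sine_coeff_Suc\<close> make the left side
  telescope to a single term at the cut-off.\<close>

lemma sine_sum_ode:
  assumes s: "Im s \<noteq> 0"
  shows "of_real (sin x) * (\<Sum>m=1..M. - 4 * of_nat m * sine_coeff s m * of_real (sin (2 * real m * x)))
           + s * of_real (cos x) * sine_sum s M x
         = (2 * of_nat M + s) * sine_coeff s M * of_real (cos (real (2 * M + 1) * x))"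
proof (induction M)
  case 0
  show ?case by (simp add: sine_sum_def)
next
  case (Suc M)
  define c where "c = sine_coeff s (Suc M)"
  define C0 C1 where "C0 = complex_of_real (cos (real (2 * M + 1) * x))" and "C1 = complex_of_real (cos (real (2 * Suc M + 1) * x))"
  define D where "D = (\<Sum>m=1..M. - 4 * of_nat m * sine_coeff s m * of_real (sin (2 * real m * x)))"
  have rec: "(2 * of_nat M + s) * sine_coeff s M = (2 * of_nat (Suc M) - s) * c"
  proof -
    have e: "2 * of_nat M + s = 2 * (of_nat M + s / 2)" "2 * of_nat (Suc M) - s = 2 * (of_nat M + (1 - s / 2))"
      by (simp_all add: field_simps)
    show ?thesis unfolding e mult.assoc c_def sine_coeff_Suc[OF s] ..
  qed
  have ang: "real (2 * M + 1) * x = 2 * real (Suc M) * x - x" "real (2 * Suc M + 1) * x = 2 * real (Suc M) * x + x"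
    by (simp_all add: algebra_simps)
  have e1: "2 * (sin x * sin (2 * real (Suc M) * x)) = cos (real (2 * M + 1) * x) - cos (real (2 * Suc M + 1) * x)"
    and e2: "2 * (cos x * cos (2 * real (Suc M) * x)) = cos (real (2 * M + 1) * x) + cos (real (2 * Suc M + 1) * x)"
    unfolding ang cos_add cos_diff by simp_all
  have "complex_of_real (2 * (sin x * sin (2 * real (Suc M) * x))) = C0 - C1"
    unfolding e1 C0_def C1_def by simp
  hence f1: "of_real (sin x) * of_real (sin (2 * real (Suc M) * x)) = (C0 - C1) / 2" by (simp add: mult_ac)
  have "complex_of_real (2 * (cos x * cos (2 * real (Suc M) * x))) = C0 + C1"
    unfolding e2 C0_def C1_def by simp
  hence f2: "of_real (cos x) * of_real (cos (2 * real (Suc M) * x)) = (C0 + C1) / 2" by (simp add: mult_ac)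
  have "of_real (sin x) * (D - 4 * of_nat (Suc M) * c * of_real (sin (2 * real (Suc M) * x)))
        + s * of_real (cos x) * (sine_sum s M x + 2 * c * of_real (cos (2 * real (Suc M) * x)))
     = (of_real (sin x) * D + s * of_real (cos x) * sine_sum s M x)
       - 4 * of_nat (Suc M) * c * (of_real (sin x) * of_real (sin (2 * real (Suc M) * x)))
       + 2 * s * c * (of_real (cos x) * of_real (cos (2 * real (Suc M) * x)))"
    by (simp only: right_diff_distrib distrib_left mult_ac) (simp only: add_ac diff_conv_add_uminus)
  also have "of_real (sin x) * D + s * of_real (cos x) * sine_sum s M x = (2 * of_nat (Suc M) - s) * c * C0"
    using Suc.IH unfolding D_def C0_def rec .
  also have "(2 * of_nat (Suc M) - s) * c * C0 - 4 * of_nat (Suc M) * c * (of_real (sin x) * of_real (sin (2 * real (Suc M) * x)))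
       + 2 * s * c * (of_real (cos x) * of_real (cos (2 * real (Suc M) * x))) = (2 * of_nat (Suc M) + s) * c * C1"
    unfolding f1 f2 by (simp add: field_simps)
  finally show ?case
    by (simp add: D_def c_def C1_def sine_sum_def algebra_simps)
qed

lemma sine_sum_has_vector_derivative:
  "(sine_sum s M has_vector_derivative (\<Sum>m=1..M. - 4 * of_nat m * sine_coeff s m * of_real (sin (2 * real m * x)))) (at x)"
proof -
  have c: "((\<lambda>x. complex_of_real (cos (2 * real m * x))) has_vector_derivative of_real (- (2 * real m) * sin (2 * real m * x))) (at x)" for m
    by (rule has_vector_derivative_of_real) (auto intro!: derivative_eq_intros)
  have "(sine_sum s M has_vector_derivative 0 + 2 * (\<Sum>m=1..M. sine_coeff s m * of_real (- (2 * real m) * sin (2 * real m * x)))) (at x)"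
    unfolding sine_sum_def[abs_def]
    by (intro has_vector_derivative_add has_vector_derivative_const has_vector_derivative_mult_right has_vector_derivative_sum c)
  thus ?thesis by (simp add: sum_distrib_left mult_ac)
qed

text \<open>By the differential equation, \<open>sine_sum s M * sin_powr s\<close> has a derivative
  of order \<open>M powr Re s\<close> on the segment from \<open>x\<close> to \<open>pi / 2\<close>,
  so its variation there tends to 0.\<close>

lemma sine_sum_ratio_const:
  assumes s: "Im s \<noteq> 0" "Re s < 0" and x: "0 < x" "x < pi"
  shows "(\<lambda>M. sine_sum s M x * sin_powr s x - sine_sum s M (pi / 2)) \<longlonglongrightarrow> 0"
proof -
  obtain B where B: "B \<ge> 0" "\<And>n. n > 0 \<Longrightarrow> norm (sine_coeff s n) \<le> B * real n powr (Re s - 1)"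
    using norm_sine_coeff_le[OF s(1)] by blast
  define I where "I = closed_segment x (pi / 2)"
  have Isin: "sin y > 0" if "y \<in> I" for y
  proof -
    have "y \<in> {0<..<pi}"
      using that x closed_segment_subset[of x "{0<..<pi}" "pi / 2"] by (auto simp: I_def)
    thus ?thesis by (simp add: sin_gt_zero)
  qed
  \<comment> \<open>The exponent is negative; the power stays bounded because the segment is compact
    inside the open interval, away from the zeros of the sine.\<close>
  have "continuous_on I (\<lambda>y. sin y powr (Re s - 1))" 
  proof (intro continuous_intros)
    show "\<forall>y\<in>I. sin y \<noteq> 0" using Isin by (metis less_irrefl)
  qed
  hence "compact ((\<lambda>y. sin y powr (Re s - 1)) ` I)" unfolding I_def by (intro compact_continuous_image) auto
  hence "bdd_above ((\<lambda>y. sin y powr (Re s - 1)) ` I)" by (intro bounded_imp_bdd_above compact_imp_bounded)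
  then obtain R where R: "\<And>y. y \<in> I \<Longrightarrow> sin y powr (Re s - 1) \<le> R"
    unfolding bdd_above_def by blast
  define b where "b = (\<lambda>M. (2 * real M + norm s) * (B * real M powr (Re s - 1)))"
  have le: "norm (sine_sum s M x * sin_powr s x - sine_sum s M (pi / 2)) \<le> (R * b M) * norm (x - pi / 2)" if M: "M > 0" for M
  proof -
    define F where "F = (\<lambda>y. sine_sum s M y * sin_powr s y)"
    have "norm (F x - F (pi / 2)) \<le> (R * b M) * norm (x - pi / 2)"
    proof (rule differentiable_bound)
      fix y assume y: "y \<in> I"
      have sy: "sin y > 0" using Isin[OF y] .
      define A where "A = sine_sum s M y"
      define A' where "A' = (\<Sum>m=1..M. - 4 * of_nat m * sine_coeff s m * of_real (sin (2 * real m * y)))"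
      define v where "v = sin_powr (s - 1) y * ((2 * of_nat M + s) * sine_coeff s M * of_real (cos (real (2 * M + 1) * y)))"
      have "(F has_vector_derivative (A * (s * sin_powr (s - 1) y * of_real (cos y)) + A' * sin_powr s y)) (at y)"
        unfolding F_def A_def A'_def
        by (intro has_vector_derivative_mult sine_sum_has_vector_derivative has_vector_derivative_sin_powr sy)
      also have "A * (s * sin_powr (s - 1) y * of_real (cos y)) + A' * sin_powr s y = v"
      proof -
        have "sin_powr s y = of_real (sin y) * sin_powr (s - 1) y"
          using sin_powr_add[of 1 "s - 1" y] by (simp add: sin_powr_1)
        hence "A * (s * sin_powr (s - 1) y * of_real (cos y)) + A' * sin_powr s y
           = sin_powr (s - 1) y * (of_real (sin y) * A' + s * of_real (cos y) * A)" by (simp add: algebra_simps)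
        thus ?thesis unfolding A_def A'_def v_def sine_sum_ode[OF s(1)] .
      qed
      finally show "(F has_derivative (\<lambda>h. h *\<^sub>R v)) (at y within I)"
        unfolding has_vector_derivative_def by (rule has_derivative_at_withinI)
      have "norm v \<le> R * (b M * 1)"
        unfolding v_def norm_mult b_def
      proof (intro mult_mono)
        show "norm (sin_powr (s - 1) y) \<le> R" using R[OF y] sy by (simp add: norm_sin_powr)
        show "norm (2 * of_nat M + s) \<le> 2 * real M + norm s"
          using norm_triangle_ineq[of "2 * of_nat M" s] by simp
        show "norm (sine_coeff s M) \<le> B * real M powr (Re s - 1)" by (rule B(2)[OF M])
      qed (use R[OF y] sy B(1) order_trans[OF powr_ge_zero R[OF y]] in auto)
      thus "onorm (\<lambda>h. h *\<^sub>R v) \<le> R * b M"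
        by (intro onorm_bound) (auto simp: mult.commute intro: order_trans[OF norm_ge_zero] mult_left_mono)
    qed (auto simp: I_def)
    thus ?thesis by (simp add: F_def sin_powr_def)
  qed
  show ?thesis
  proof (rule Lim_null_comparison)
    show "eventually (\<lambda>M. norm (sine_sum s M x * sin_powr s x - sine_sum s M (pi / 2)) \<le> (R * b M) * norm (x - pi / 2)) sequentially"
      using eventually_gt_at_top[of 0] by eventually_elim (rule le)
    have "b \<longlonglongrightarrow> 0"
    proof (rule Lim_null_comparison)
      have "(\<lambda>M. real M powr (Re s)) \<longlonglongrightarrow> 0"
        using tendsto_neg_powr[OF s(2) filterlim_real_sequentially] .
      from tendsto_mult_left[OF this, of "(2 + norm s) * B"]
      show "(\<lambda>M. (2 + norm s) * B * real M powr (Re s)) \<longlonglongrightarrow> 0" by simp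
      show "eventually (\<lambda>M. norm (b M) \<le> (2 + norm s) * B * real M powr (Re s)) sequentially"
        using eventually_gt_at_top[of 0]
      proof eventually_elim
        case (elim M)
        have "2 * real M + norm s \<le> (2 + norm s) * real M"
          using elim mult_left_mono[of 1 "real M" "norm s"] by (simp add: algebra_simps)
        hence "b M \<le> ((2 + norm s) * real M) * (B * real M powr (Re s - 1))"
          unfolding b_def using B(1) by (intro mult_right_mono) auto
        also have "\<dots> = (2 + norm s) * B * real M powr (Re s)"
          using elim by (simp add: powr_diff)
        finally show ?case using B(1) by (simp add: b_def)
      qed
    qed
    from tendsto_mult_left[OF this, of "R * norm (x - pi / 2)"]
    show "(\<lambda>M. (R * b M) * norm (x - pi / 2)) \<longlonglongrightarrow> 0" by (simp add: mult_ac)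
  qed
qed

text \<open>The series converges uniformly to \<open>T\<close>, and \<open>T * sin_powr s\<close> is
  constant on the open interval. Integration over \<open>{0..pi}\<close> determines the constant, as
  only frequency 0 survives. The bound -2 is the range of \<open>sin_powr_integral_eq\<close> at
  exponent \<open>- s\<close>.\<close>

lemma sine_sum_LIMSEQ_base:
  assumes s: "Im s \<noteq> 0" "Re s \<le> -2" and x: "0 < x" "x < pi"
  shows "(\<lambda>M. sine_const s * sine_sum s M x) \<longlonglongrightarrow> of_real (sin x) powr (- s)"
proof -
  obtain B where B: "B \<ge> 0" "\<And>n. n > 0 \<Longrightarrow> norm (sine_coeff s n) \<le> B * real n powr (Re s - 1)"
    using norm_sine_coeff_le[OF s(1)] by blast
  define t where "t = (\<lambda>m x. if m = 0 then sine_coeff s 0 else 2 * sine_coeff s m * of_real (cos (2 * real m * x)))"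
  define bd where "bd = (\<lambda>m. if m = 0 then norm (sine_coeff s 0) else 2 * B * real m powr (Re s - 1))"
  define T where "T = (\<lambda>x. \<Sum>m. t m x)"
  have tsum: "(\<Sum>m<Suc M. t m x) = sine_sum s M x" for M x
    by (induction M) (auto simp: sine_sum_def t_def algebra_simps)
  have "norm (t m x) \<le> bd m" for m x
  proof (cases "m = 0")
    case False
    have "norm (t m x) = 2 * (norm (sine_coeff s m) * \<bar>cos (2 * real m * x)\<bar>)" using False by (simp add: t_def norm_mult)
    also have "\<dots> \<le> 2 * (norm (sine_coeff s m) * 1)" by (intro mult_left_mono) auto
    also have "\<dots> \<le> bd m" using False B(2)[of m] by (simp add: bd_def)
    finally show ?thesis .
  qed (simp add: t_def bd_def)
  moreover have "summable bd"
  proof -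
    have "summable (\<lambda>m. 2 * B * real m powr (Re s - 1))"
      using s by (intro summable_mult) (simp add: summable_real_powr_iff)
    thus ?thesis by (rule summable_comparison_test'[of _ 1]) (use B(1) in \<open>auto simp: bd_def\<close>)
  qed
  ultimately have U: "uniform_limit S (\<lambda>n x. \<Sum>m<n. t m x) T sequentially" for S
    unfolding T_def by (intro Weierstrass_m_test) auto
  have lim: "(\<lambda>M. sine_sum s M x) \<longlonglongrightarrow> T x" for x
  proof -
    have "(\<lambda>n. \<Sum>m<Suc n. t m x) \<longlonglongrightarrow> T x"
      by (rule LIMSEQ_Suc[OF tendsto_uniform_limitI[OF U[of "{x}"]]]) simp
    thus ?thesis by (simp only: tsum)
  qed
  define C where "C = T (pi / 2)"
  have TC: "T x = C * sin_powr (-s) x" if x: "0 < x" "x < pi" for x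
  proof -
    have "(\<lambda>M. sine_sum s M x * sin_powr s x - sine_sum s M (pi / 2)) \<longlonglongrightarrow> T x * sin_powr s x - C"
      unfolding C_def by (intro tendsto_diff tendsto_mult_right lim)
    moreover have "(\<lambda>M. sine_sum s M x * sin_powr s x - sine_sum s M (pi / 2)) \<longlonglongrightarrow> 0"
      using s x by (intro sine_sum_ratio_const) auto
    ultimately have "T x * sin_powr s x - C = 0" by (rule LIMSEQ_unique)
    hence "T x * (sin_powr s x * sin_powr (-s) x) = C * sin_powr (-s) x" by (simp add: mult.assoc[symmetric])
    moreover have "sin x > 0" using x by (simp add: sin_gt_zero)
    hence "sin_powr s x * sin_powr (-s) x = 1" using sin_powr_add[of s "-s" x] by (simp add: sin_powr_def)
    ultimately show ?thesis by simp
  qed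
  have I: "((\<lambda>x. sine_sum s M x) has_integral of_real pi * sine_coeff s 0) {0..pi}" for M
  proof -
    have "((\<lambda>x. complex_of_real (cos (2 * real m * x))) has_integral 0) {0..pi}" if "m \<in> {1..M}" for m
    proof -
      have m: "m > 0" using that by simp
      have "((\<lambda>x. cos (2 * real m * x)) has_integral sin (2 * real m * pi) / (2 * real m) - sin (2 * real m * 0) / (2 * real m)) {0..pi}"
        using m by (intro fundamental_theorem_of_calculus)
          (auto intro!: derivative_eq_intros simp: has_real_derivative_iff_has_vector_derivative[symmetric])
      moreover have "sin (2 * real m * pi) = 0" using sin_npi[of "2 * m"] by simp
      ultimately have "((\<lambda>x. cos (2 * real m * x)) has_integral 0) {0..pi}" by simp
      from has_integral_of_real[OF this] show ?thesis by simp
    qed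
    hence "((\<lambda>x. \<Sum>m=1..M. sine_coeff s m * of_real (cos (2 * real m * x))) has_integral (\<Sum>m=1..M. sine_coeff s m * 0)) {0..pi}"
      by (intro has_integral_sum has_integral_mult_right) auto
    moreover have "((\<lambda>x. sine_coeff s 0) has_integral (pi - 0) *\<^sub>R sine_coeff s 0) {0..pi}"
      using has_integral_const_real[of "sine_coeff s 0" 0 pi] by simp
    ultimately have "((\<lambda>x. sine_coeff s 0 + 2 * (\<Sum>m=1..M. sine_coeff s m * of_real (cos (2 * real m * x)))) has_integral
       (pi - 0) *\<^sub>R sine_coeff s 0 + 2 * (\<Sum>m=1..M. sine_coeff s m * 0)) {0..pi}"
      by (intro has_integral_add has_integral_mult_right)
    thus ?thesis by (simp add: sine_sum_def[abs_def] scaleR_conv_of_real)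
  qed
  have TI: "(T has_integral of_real pi * sine_coeff s 0) {0..pi}"
  proof -
    have "continuous_on {0..pi} (\<lambda>x. \<Sum>m<n. t m x)" for n
    proof (rule continuous_on_sum)
      fix m show "continuous_on {0..pi} (t m)"
        unfolding t_def by (cases "m = 0") (auto intro!: continuous_intros)
    qed
    from uniform_limit_integral[OF U this trivial_limit_sequentially]
    obtain I' J where IJ: "\<And>n. ((\<lambda>x. \<Sum>m<n. t m x) has_integral I' n) {0..pi}" "(T has_integral J) {0..pi}" "I' \<longlonglongrightarrow> J"
      by blast
    have "I' (Suc n) = of_real pi * sine_coeff s 0" for n
      using IJ(1)[of "Suc n"] I[of n] unfolding tsum by (rule has_integral_unique)
    with LIMSEQ_Suc[OF IJ(3)] have "J = of_real pi * sine_coeff s 0" by (simp add: LIMSEQ_const_iff)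
    thus ?thesis using IJ(2) by simp
  qed
  have "((\<lambda>x. C * sin_powr (-s) x) has_integral C * sin_powr_integral (-s)) {0..pi}"
    using s by (intro has_integral_mult_right has_integral_sin_powr) auto
  \<comment> \<open>\<open>TC\<close> covers only the open interval; the two end points do not
    affect the integral.\<close>
  hence "(T has_integral C * sin_powr_integral (-s)) {0..pi}"
    by (rule has_integral_spike_finite[of "{0, pi}", rotated 2]) (auto intro!: TC)
  hence CB: "C * sin_powr_integral (-s) = of_real pi * sine_coeff s 0" using TI by (rule has_integral_unique)
  have G1: "Gamma (1 - s / 2) \<noteq> 0" and G2: "Gamma ((1 - s) / 2) \<noteq> 0" and G3: "Gamma (s / 2) \<noteq> 0"
    using s(1) by (auto intro!: Gamma_nonzero nonreal_not_nonpos_Int)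
  have B': "sin_powr_integral (-s) * Gamma (1 - s / 2) = of_real (sqrt pi) * Gamma ((1 - s) / 2)"
    using sin_powr_integral_eq[of "-s"] s by (simp add: add_ac)
  have "C * (sin_powr_integral (-s) * Gamma (1 - s / 2)) = of_real pi * (sine_coeff s 0 * Gamma (1 - s / 2))"
    using CB by (simp only: mult.assoc[symmetric])
  also have "sine_coeff s 0 * Gamma (1 - s / 2) = Gamma (s / 2)" using G1 by (simp add: sine_coeff_def)
  also have "complex_of_real pi = of_real (sqrt pi) * of_real (sqrt pi)" by (simp flip: of_real_mult)
  finally have "C * Gamma ((1 - s) / 2) = of_real (sqrt pi) * Gamma (s / 2)" unfolding B' by simp
  hence "sine_const s * C = 1" using G2 G3 by (simp add: sine_const_def field_simps)
  moreover have "(\<lambda>M. sine_const s * sine_sum s M x) \<longlonglongrightarrow> sine_const s * T x" by (intro tendsto_mult_left lim)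
  moreover have "sine_const s * T x = (sine_const s * C) * sin_powr (-s) x" using TC[OF x] by simp
  ultimately show ?thesis by (simp add: sin_powr_def)
qed

text \<open>Two shifts, because \<open>Re (s - 2)\<close> is still above -2 while
  \<open>Re (s - 4) < -3\<close>.\<close>

lemma sine_sum_LIMSEQ:
  assumes s: "Im s \<noteq> 0" "0 < Re s" "Re s < 1" and x: "0 < x" "x < pi"
  shows "(\<lambda>M. sine_const s * sine_sum s M x) \<longlonglongrightarrow> of_real (sin x) powr (- s)"
proof -
  have sx: "sin x \<noteq> 0" using sin_gt_zero[OF x] by simp
  have "(\<lambda>M. sine_const (s - 2 - 2) * sine_sum (s - 2 - 2) M x) \<longlonglongrightarrow> of_real (sin x) powr (- (s - 2 - 2))"
    by (rule sine_sum_LIMSEQ_base) (use s x in auto)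
  from sine_sum_LIMSEQ_shift[OF _ _ sx this]
  have "(\<lambda>M. sine_const (s - 2) * sine_sum (s - 2) M x) \<longlonglongrightarrow> of_real (sin x) powr (- (s - 2))"
    using s by simp
  from sine_sum_LIMSEQ_shift[OF _ _ sx this] show ?thesis using s by simp
qed

section \<open>Gauss sums\<close>

definition root_char :: "nat \<Rightarrow> int \<Rightarrow> complex" where
  "root_char k x = cis (2 * pi * of_int x / real k)"

lemma root_char_add: "root_char k (x + y) = root_char k x * root_char k y"
  by (simp add: root_char_def cis_mult add_divide_distrib distrib_left)

lemma root_char_mult_modulus: "k > 0 \<Longrightarrow> root_char k (int k * x) = 1"
proof -
  assume "k > 0"
  hence e: "2 * pi * of_int (int k * x) / real k = 2 * pi * of_int x" by simp
  show ?thesis unfolding root_char_def e by simp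
qed

lemma root_char_mod: "k > 0 \<Longrightarrow> root_char k (x mod int k) = root_char k x"
  using root_char_add[of k "int k * (x div int k)" "x mod int k"] by (simp add: root_char_mult_modulus)

lemma root_char_uminus: "root_char k (- x) = cnj (root_char k x)"
  by (simp add: root_char_def cis_cnj)

lemma root_char_power: "root_char k x ^ n = root_char k (int n * x)"
  unfolding root_char_def Complex.DeMoivre by (simp add: mult_ac)

lemma root_char_eq_1_iff:
  assumes "k > 0"
  shows "root_char k x = 1 \<longleftrightarrow> int k dvd x"
proof
  assume "root_char k x = 1"
  hence "cos (2 * pi * of_int x / real k) = 1" by (simp add: root_char_def complex_eq_iff)
  then obtain n :: int where "2 * pi * of_int x / real k = of_int n * 2 * pi"
    unfolding cos_one_2pi_int by blast
  hence "real_of_int x = real_of_int (n * int k)" using assms by (simp add: field_simps)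
  hence "x = n * int k" by (simp only: of_int_eq_iff)
  thus "int k dvd x" by simp
qed (use assms root_char_mult_modulus in auto)

lemma sum_root_char:
  assumes "k > 0"
  shows "(\<Sum>l<k. root_char k (int l * x)) = (if int k dvd x then of_nat k else 0)"
proof -
  have "(\<Sum>l<k. root_char k (int l * x)) = (\<Sum>l<k. root_char k x ^ l)" by (simp add: root_char_power)
  also have "\<dots> = (if root_char k x = 1 then of_nat k else (1 - root_char k x ^ k) / (1 - root_char k x))"
    by (rule sum_gp_strict)
  also have "root_char k x ^ k = 1" using assms by (simp add: root_char_power root_char_mult_modulus)
  finally show ?thesis using assms by (simp add: root_char_eq_1_iff)
qed

text \<open>Multiplication by a unit permutes the residues.\<close>

lemma sum_residues_mult:
  assumes k: "k > 0" and a: "coprime a (int k)" and F: "\<And>x. F (x mod int k) = (F x :: complex)"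
  shows "(\<Sum>j<k. F (a * int j)) = (\<Sum>j<k. F (int j))"
proof -
  define h where "h = (\<lambda>j. nat ((a * int j) mod int k))"
  have h: "int (h j) = (a * int j) mod int k" for j using k by (simp add: h_def)
  have inj: "inj_on h {..<k}"
  proof (rule inj_onI)
    fix i j assume ij: "i \<in> {..<k}" "j \<in> {..<k}" "h i = h j"
    hence "[a * int i = a * int j] (mod int k)" using h[of i] h[of j] by (simp add: cong_def)
    hence "[int i = int j] (mod int k)" using a by (simp add: cong_mult_lcancel)
    thus "i = j" using ij by (simp add: cong_int_iff cong_less_modulus_unique_nat)
  qed
  moreover have "h ` {..<k} \<subseteq> {..<k}" using k by (auto simp: h_def nat_less_iff)
  ultimately have "h ` {..<k} = {..<k}" by (intro endo_inj_surj) auto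
  hence "bij_betw h {..<k} {..<k}" using inj by (simp add: bij_betw_def)
  from sum.reindex_bij_betw[OF this, of "\<lambda>j. F (int j)"]
  have "(\<Sum>j<k. F (int j)) = (\<Sum>j<k. F (int (h j)))" by simp
  also have "\<dots> = (\<Sum>j<k. F (a * int j))" by (simp add: h F)
  finally show ?thesis by simp
qed

section \<open>Values of a Dirichlet character\<close>

context
  fixes k :: nat and chi :: "int \<Rightarrow> complex"
  assumes chi: "dirichlet_character k chi"
begin

lemma chi_modulus_pos: "k > 0" and chi_mult: "chi (a * b) = chi a * chi b"
  and chi_nonzero_iff: "chi a \<noteq> 0 \<longleftrightarrow> coprime a (int k)"
  using chi by (auto simp: dirichlet_character_def)

lemma chi_add_multiple: "chi (a + int k * b) = chi a"
proof -
  have per: "chi (a + int k) = chi a" for a using chi by (simp add: dirichlet_character_def)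
  have nat: "chi (a + int k * int n) = chi a" for n a
  proof (induction n)
    case (Suc n)
    have "chi (a + int k * int (Suc n)) = chi ((a + int k * int n) + int k)" by (simp add: algebra_simps)
    thus ?case unfolding per Suc .
  qed simp
  show ?thesis
  proof (cases b)
    case (nonneg n)
    thus ?thesis using nat by simp
  next
    case (neg n)
    have e: "a + int k * b + int k * int (Suc n) = a" unfolding neg mult_minus_right by simp
    show ?thesis using nat[of "a + int k * b" "Suc n"] unfolding e by simp
  qed
qed

lemma chi_mod: "chi (a mod int k) = chi a"
  using chi_add_multiple[of "a mod int k" "a div int k"] by simp

lemma chi_cong: "[a = b] (mod int k) \<Longrightarrow> chi a = chi b"
  by (metis chi_mod cong_def)

lemma chi_1: "chi 1 = 1"
  using chi_mult[of 1 1] chi_nonzero_iff[of 1] by simp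

text \<open>By Euler's theorem \<open>chi a ^ totient k = 1\<close> for every unit
  \<open>a\<close>.\<close>

lemma norm_chi: "norm (chi a) = (if coprime a (int k) then 1 else 0)"
proof (cases "coprime a (int k)")
  case True
  define a' where "a' = nat (a mod int k)"
  have a': "int a' = a mod int k" using chi_modulus_pos by (simp add: a'_def)
  have "coprime (int a') (int k)" using True chi_modulus_pos by (simp add: a' coprime_mod_left_iff)
  hence "coprime a' k" by (simp only: coprime_int_iff)
  hence "[a' ^ totient k = 1] (mod k)" by (rule euler_theorem)
  hence "[int (a' ^ totient k) = int 1] (mod int k)" by (simp only: cong_int_iff)
  from chi_cong[OF this] have "chi (int a' ^ totient k) = 1" by (simp add: chi_1)
  moreover have "chi (b ^ n) = chi b ^ n" for b n by (induction n) (simp_all add: chi_1 chi_mult)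
  ultimately have "chi a ^ totient k = 1" by (simp add: a' chi_mod)
  hence "norm (chi a ^ totient k) = 1" by simp
  hence "norm (chi a) ^ totient k = 1 ^ totient k" by (simp add: norm_power)
  moreover have "totient k > 0" using chi_modulus_pos by simp
  ultimately have "norm (chi a) = 1" by (intro power_eq_imp_eq_base[of "norm (chi a)" "totient k" 1]) auto
  thus ?thesis using True by simp
qed (use chi_nonzero_iff in auto)

lemma norm_chi_le: "norm (chi a) \<le> 1"
  by (simp add: norm_chi)

lemma chi_mult_cnj: "chi a * cnj (chi a) = (if coprime a (int k) then 1 else 0)"
  unfolding complex_norm_square[symmetric] norm_chi by simp

lemma dirichlet_character_cnj: "dirichlet_character k (\<lambda>a. cnj (chi a))"
  using chi by (simp add: dirichlet_character_def)

end

section \<open>Gauss sums of primitive characters\<close>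

definition gauss_sum :: "nat \<Rightarrow> (int \<Rightarrow> complex) \<Rightarrow> int \<Rightarrow> complex" where
  "gauss_sum k chi l = (\<Sum>j<k. chi (int j) * root_char k (l * int j))"

lemma primitive_character_imp_dirichlet: "primitive_character k chi \<Longrightarrow> dirichlet_character k chi"
  by (simp add: primitive_character_def)

lemma primitive_character_cnj:
  assumes "primitive_character k chi"
  shows "primitive_character k (\<lambda>a. cnj (chi a))"
proof -
  have "cnj z = 1 \<longleftrightarrow> z = 1" for z by (metis complex_cnj_one complex_cnj_cnj)
  thus ?thesis
    using assms dirichlet_character_cnj[OF primitive_character_imp_dirichlet[OF assms]]
    unfolding primitive_character_def induced_modulus_def by simp
qed

text \<open>Since 1 is not an induced modulus, some unit \<open>a\<close> has
  \<open>chi a \<noteq> 1\<close>; replacing \<open>j\<close> by \<open>a * j\<close> multiplies the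
  sum by \<open>chi a\<close> without changing it.\<close>

lemma sum_character_period:
  assumes prim: "primitive_character k chi" and k: "k > 1"
  shows "(\<Sum>j<k. chi (int j)) = 0"
proof -
  note chi = primitive_character_imp_dirichlet[OF prim]
  have "\<not> induced_modulus k chi 1" using prim k by (simp add: primitive_character_def)
  then obtain a where a: "coprime a (int k)" "chi a \<noteq> 1" by (auto simp: induced_modulus_def)
  have "(\<Sum>j<k. chi (a * int j)) = (\<Sum>j<k. chi (int j))"
    using a k by (intro sum_residues_mult chi_mod[OF chi]) auto
  hence "(chi a - 1) * (\<Sum>j<k. chi (int j)) = 0"
    by (simp add: chi_mult[OF chi] left_diff_distrib flip: sum_distrib_left)
  thus ?thesis using a by simp
qed

text \<open>For a unit \<open>l\<close>, substitute \<open>l * j\<close>. Otherwise let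
  \<open>d = gcd l k > 1\<close>: as \<open>k / d\<close> is not an induced modulus, some unit
  \<open>a\<close> congruent to 1 modulo \<open>k / d\<close> has \<open>chi a \<noteq> 1\<close>.
  Then \<open>l * a\<close> and \<open>l\<close> agree modulo \<open>k\<close>, so substituting
  \<open>a * j\<close> multiplies the sum by \<open>chi a\<close> and leaves it unchanged; it
  vanishes, as does \<open>chi l\<close>.\<close>

lemma gauss_sum_eq:
  assumes prim: "primitive_character k chi"
  shows "gauss_sum k chi l = cnj (chi l) * gauss_sum k chi 1"
proof -
  note chi = primitive_character_imp_dirichlet[OF prim]
  have k: "k > 0" using chi_modulus_pos[OF chi] .
  show ?thesis
  proof (cases "coprime l (int k)")
    case True
    define F where "F = (\<lambda>x. chi x * root_char k x)"
    have "(\<Sum>j<k. F (l * int j)) = (\<Sum>j<k. F (int j))"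
      using True k by (intro sum_residues_mult) (auto simp: F_def chi_mod[OF chi] root_char_mod)
    hence "chi l * gauss_sum k chi l = gauss_sum k chi 1"
      by (simp add: F_def gauss_sum_def chi_mult[OF chi] sum_distrib_left mult.assoc)
    hence "(cnj (chi l) * chi l) * gauss_sum k chi l = cnj (chi l) * gauss_sum k chi 1" by (simp add: mult.assoc)
    thus ?thesis using chi_mult_cnj[OF chi, of l] True by (simp add: mult.commute)
  next
    case False
    define d where "d = gcd l (int k)"
    have "d \<noteq> 1" using False by (simp add: d_def coprime_iff_gcd_eq_1)
    moreover have "d > 0" using k by (simp add: d_def)
    ultimately have d: "d > 1" by linarith
    obtain l' k' where l': "l = d * l'" and k': "int k = d * k'" unfolding d_def by (meson dvdE gcd_dvd1 gcd_dvd2)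
    have "d * k' > 0" using k k' by simp
    hence k'pos: "k' > 0" using d by (simp add: zero_less_mult_iff)
    define k0 where "k0 = nat k'"
    have k0: "int k0 = k'" using k'pos by (simp add: k0_def)
    have "int k0 dvd int k" using k' k0 by simp
    hence "k0 dvd k" by simp
    moreover have "int k0 < int k" using k' k0 d k'pos mult_strict_right_mono[of 1 d k'] by simp
    ultimately obtain a where a: "coprime a (int k)" "[a = 1] (mod int k0)" "chi a \<noteq> 1"
      using prim by (auto simp: primitive_character_def induced_modulus_def)
    obtain m where m: "a - 1 = k' * m" using a(2) k0 by (metis cong_iff_dvd_diff dvdE)
    have e: "root_char k (l * (a * x)) = root_char k (l * x)" for x
    proof -
      have "l * (a * x) = l * x + l * x * (a - 1)" by (simp add: algebra_simps)
      also have "l * x * (a - 1) = int k * (l' * x * m)" unfolding m l' k' by simp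
      finally show ?thesis using k by (simp add: root_char_add root_char_mult_modulus)
    qed
    define F where "F = (\<lambda>x. chi x * root_char k (l * x))"
    have "root_char k (l * (x mod int k)) = root_char k (l * x)" for x
      using root_char_mod[OF k, of "l * (x mod int k)"] root_char_mod[OF k, of "l * x"] by (simp add: mod_mult_right_eq)
    hence "(\<Sum>j<k. F (a * int j)) = (\<Sum>j<k. F (int j))"
      using a k by (intro sum_residues_mult) (auto simp: F_def chi_mod[OF chi])
    hence "chi a * gauss_sum k chi l = gauss_sum k chi l"
      by (simp add: F_def gauss_sum_def e chi_mult[OF chi] sum_distrib_left mult.assoc)
    hence "(chi a - 1) * gauss_sum k chi l = 0" by (simp add: left_diff_distrib)
    hence "gauss_sum k chi l = 0" using a by simp
    moreover have "chi l = 0" using False chi_nonzero_iff[OF chi] by blast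
    ultimately show ?thesis by simp
  qed
qed

text \<open>The squared moduli of the Gauss sums at all \<open>l\<close> add up to
  \<open>k * S\<close> by orthogonality of the exponentials and to \<open>|t|^2 * S\<close> by
  \<open>gauss_sum_eq\<close>, where \<open>S\<close> is the number of units.\<close>

lemma norm_gauss_sum:
  assumes prim: "primitive_character k chi"
  shows "norm (gauss_sum k chi 1) = sqrt (real k)"
proof -
  note chi = primitive_character_imp_dirichlet[OF prim]
  have k: "k > 0" using chi_modulus_pos[OF chi] .
  define S where "S = (\<Sum>l<k. chi (int l) * cnj (chi (int l)))"
  define t where "t = gauss_sum k chi 1"
  have "(\<Sum>l<k. gauss_sum k chi (int l) * cnj (gauss_sum k chi (int l)))
      = (\<Sum>l<k. \<Sum>i<k. \<Sum>j<k. chi (int i) * cnj (chi (int j)) * root_char k (int l * (int i - int j)))"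
    unfolding gauss_sum_def cnj_sum sum_product
    by (intro sum.cong refl)
       (simp add: right_diff_distrib root_char_add[of k _ "- _", simplified] root_char_uminus mult_ac)
  also have "\<dots> = (\<Sum>i<k. \<Sum>j<k. chi (int i) * cnj (chi (int j)) * (\<Sum>l<k. root_char k (int l * (int i - int j))))"
    unfolding sum_distrib_left by (subst sum.swap, rule sum.cong[OF refl], rule sum.swap)
  also have "\<dots> = (\<Sum>i<k. \<Sum>j<k. if i = j then chi (int i) * cnj (chi (int j)) * of_nat k else 0)"
  proof (intro sum.cong refl)
    fix i j assume "i \<in> {..<k}" "j \<in> {..<k}"
    hence "int k dvd int i - int j \<longleftrightarrow> i = j"
      by (auto simp: cong_int_iff cong_less_modulus_unique_nat simp flip: cong_iff_dvd_diff)
    thus "chi (int i) * cnj (chi (int j)) * (\<Sum>l<k. root_char k (int l * (int i - int j)))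
       = (if i = j then chi (int i) * cnj (chi (int j)) * of_nat k else 0)"
      using k by (simp add: sum_root_char)
  qed
  also have "\<dots> = of_nat k * S" by (simp add: S_def sum_distrib_left mult_ac)
  also have "(\<Sum>l<k. gauss_sum k chi (int l) * cnj (gauss_sum k chi (int l))) = (t * cnj t) * S"
    unfolding gauss_sum_eq[OF prim, of "int _"] t_def[symmetric] S_def sum_distrib_left
    by (intro sum.cong refl) (simp add: mult_ac)
  finally have eq: "(t * cnj t) * S = of_nat k * S" .
  have cardS: "S = of_nat (card {l \<in> {..<k}. coprime (int l) (int k)})"
    unfolding S_def chi_mult_cnj[OF chi] by (simp add: sum.If_cases Int_def)
  have cardpos: "card {l \<in> {..<k}. coprime (int l) (int k)} > 0"
  proof -
    \<comment> \<open>\<open>1 mod k\<close> also covers \<open>k = 1\<close>, where the only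
      residue is 0.\<close>
    have "1 mod k \<in> {l \<in> {..<k}. coprime (int l) (int k)}" using k by (cases "k = 1") auto
    thus ?thesis by (subst card_gt_0_iff) auto
  qed
  have "S \<noteq> 0" unfolding cardS using cardpos by (metis of_nat_eq_0_iff less_irrefl)
  hence "t * cnj t = of_nat k" using eq by simp
  hence "of_real (norm t ^ 2) = complex_of_real (real k)" by (simp only: complex_norm_square) simp
  hence "norm t ^ 2 = real k" by (simp only: of_real_eq_iff)
  thus ?thesis by (simp add: t_def real_sqrt_unique)
qed

section \<open>The dual series\<close>

text \<open>Evenness replaces the cosine by an exponential. With \<open>j = r + q * k\<close>, the
  sum over \<open>q\<close> runs through powers of an \<open>n\<close>-th root of unity and is 0
  unless \<open>n dvd m\<close>; then the sum over \<open>r\<close> is the Gauss sum at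
  \<open>m div n\<close>.\<close>

lemma sum_chi_cos:
  assumes prim: "primitive_character k chi" and ev: "even_character chi" and n: "n > 0"
  shows "(\<Sum>j<k*n. chi (int j) * of_real (cos (2 * real m * (pi * real j / real (k * n)))))
           = (if n dvd m then of_nat n * gauss_sum k chi (int (m div n)) else 0)"
proof -
  note chi = primitive_character_imp_dirichlet[OF prim]
  have k: "k > 0" using chi_modulus_pos[OF chi] .
  define N where "N = k * n"
  have N: "N > 0" using k n by (simp add: N_def)
  define F where "F = (\<lambda>x. chi x * root_char N (int m * x))"
  have "F (x mod int N) = F x" for x
  proof -
    have "[x mod int N = x] (mod int k)" by (simp add: N_def cong_def mod_mod_cancel)
    hence "chi (x mod int N) = chi x" by (rule chi_cong[OF chi])
    moreover have "root_char N (int m * (x mod int N)) = root_char N (int m * x)"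
      using root_char_mod[OF N, of "int m * (x mod int N)"] root_char_mod[OF N, of "int m * x"] by (simp add: mod_mult_right_eq)
    ultimately show ?thesis by (simp add: F_def)
  qed
  \<comment> \<open>\<open>-1\<close> is a unit modulo \<open>N\<close>, so the terms at
    \<open>j\<close> and \<open>- j\<close> may be averaged.\<close>
  hence neg: "(\<Sum>j<N. F (- int j)) = (\<Sum>j<N. F (int j))"
    using sum_residues_mult[of N "-1" F] N by simp
  have "chi (- a) = chi a" for a
    using chi_mult[OF chi, of "-1" a] ev by (simp add: even_character_def)
  hence Fneg: "F (- int j) = chi (int j) * cnj (root_char N (int m * int j))" for j
    by (simp add: F_def flip: root_char_uminus)
  have "chi (int j) * of_real (cos (2 * real m * (pi * real j / real N))) = (F (int j) + F (- int j)) / 2" for j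
  proof -
    have "root_char N (int m * int j) + cnj (root_char N (int m * int j)) = of_real (2 * cos (2 * real m * (pi * real j / real N)))"
      unfolding complex_add_cnj by (simp add: root_char_def mult_ac)
    hence "F (int j) + F (- int j) = chi (int j) * of_real (2 * cos (2 * real m * (pi * real j / real N)))"
      unfolding Fneg by (simp add: F_def flip: distrib_left)
    thus ?thesis by simp
  qed
  hence "(\<Sum>j<N. chi (int j) * of_real (cos (2 * real m * (pi * real j / real N)))) = (\<Sum>j<N. (F (int j) + F (- int j)) / 2)"
    by (simp only:)
  also have "\<dots> = ((\<Sum>j<N. F (int j)) + (\<Sum>j<N. F (- int j))) / 2"
    by (simp add: sum.distrib flip: sum_divide_distrib)
  also have "\<dots> = (\<Sum>j<N. F (int j))" unfolding neg by simp
  also have "\<dots> = (\<Sum>q<n. \<Sum>r<k. F (int (r + q * k)))"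
  proof -
    have "(\<Sum>j<N. F (int j)) = (\<Sum>q<n. sum (\<lambda>j. F (int j)) {q * k..<q * k + k})"
      using sum.nat_group[of "\<lambda>j. F (int j)" k n] by (simp add: N_def mult.commute)
    also have "\<dots> = (\<Sum>q<n. \<Sum>r<k. F (int (r + q * k)))"
    proof (rule sum.cong[OF refl])
      fix q
      show "sum (\<lambda>j. F (int j)) {q * k..<q * k + k} = (\<Sum>r<k. F (int (r + q * k)))"
        using sum.shift_bounds_nat_ivl[of "\<lambda>j. F (int j)" 0 "q * k" k] by (simp add: lessThan_atLeast0 add.commute)
    qed
    finally show ?thesis .
  qed
  also have "\<dots> = (\<Sum>q<n. \<Sum>r<k. F (int r) * root_char n (int q * int m))"
  proof (intro sum.cong refl)
    fix q r
    have "chi (int (r + q * k)) = chi (int r)"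
      using chi_add_multiple[OF chi, of "int r" "int q"] by (simp add: mult.commute)
    moreover have "root_char N (int m * int (r + q * k)) = root_char N (int m * int r) * root_char N (int k * (int q * int m))"
      unfolding root_char_add[symmetric] by (rule arg_cong[where f = "root_char N"]) (simp add: algebra_simps)
    moreover have "root_char N (int k * x) = root_char n x" for x
      using k by (simp add: root_char_def N_def mult.assoc)
    ultimately show "F (int (r + q * k)) = F (int r) * root_char n (int q * int m)" by (simp add: F_def)
  qed
  also have "\<dots> = (\<Sum>r<k. F (int r)) * (\<Sum>q<n. root_char n (int q * int m))"
    by (simp add: sum_product[of _ "{..<k}"] sum.swap[of _ "{..<n}"])
  also have "\<dots> = (if n dvd m then of_nat n * gauss_sum k chi (int (m div n)) else 0)"
  proof (cases "n dvd m")
    case True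
    then obtain l where l: "m = n * l" by blast
    have "root_char N (int m * int r) = root_char k (int l * int r)" for r
      using n by (simp add: root_char_def N_def l mult.assoc)
    hence "(\<Sum>r<k. F (int r)) = gauss_sum k chi (int l)" by (simp add: F_def gauss_sum_def)
    thus ?thesis using True n l by (simp add: sum_root_char mult.commute)
  qed (use n in \<open>simp add: sum_root_char\<close>)
  finally show ?thesis by (simp add: N_def)
qed

text \<open>The Fourier expansions at all \<open>x j\<close> are summed against \<open>chi\<close>,
  which leaves only frequencies divisible by \<open>n\<close>. Cutting off at \<open>n * P\<close>
  keeps exactly the terms \<open>l = 1..P\<close>.\<close>

lemma cyclic_L_dual_sums:
  assumes prim: "primitive_character k chi" and ev: "even_character chi" and k: "k > 1" and n: "n > 0"
    and s: "Im s \<noteq> 0" "0 < Re s" "Re s < 1"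
  shows "(\<lambda>l. 2 * of_nat n * gauss_sum k chi 1 * sine_const s * (cnj (chi (int (Suc l))) * sine_coeff s (n * Suc l)))
           sums cyclic_L k chi n s"
proof -
  note chi = primitive_character_imp_dirichlet[OF prim]
  have chi0: "chi 0 = 0" using chi_nonzero_iff[OF chi, of 0] k by auto
  define x where "x = (\<lambda>j. pi * real j / real (k * n))"
  define N where "N = k * n"
  have set: "(\<Sum>j = 1..N - 1. chi (int j) * f j) = (\<Sum>j<N. chi (int j) * f j)" for f :: "nat \<Rightarrow> complex"
    using k n by (intro sum.mono_neutral_left) (auto simp: N_def chi0 Suc_le_eq intro!: Nat.gr0I)
  have fin: "(\<Sum>j<N. chi (int j) * sine_sum s (n * P) (x j))
      = (\<Sum>l<P. 2 * of_nat n * gauss_sum k chi 1 * (cnj (chi (int (Suc l))) * sine_coeff s (n * Suc l)))" for P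
  proof -
    have W: "(\<Sum>j<N. chi (int j) * of_real (cos (2 * real m * x j))) = (if n dvd m then of_nat n * gauss_sum k chi (int (m div n)) else 0)" for m
      using sum_chi_cos[OF prim ev n, of m] by (simp add: N_def x_def)
    \<comment> \<open>Frequency 0 drops out: the Gauss sum at 0 carries the factor
      \<open>cnj (chi 0) = 0\<close>.\<close>
    have W0: "(\<Sum>j<N. chi (int j)) = 0" using W[of 0] gauss_sum_eq[OF prim, of 0] chi0 by simp
    have "(\<Sum>j<N. chi (int j) * sine_sum s (n * P) (x j))
       = (\<Sum>j<N. sine_coeff s 0 * chi (int j) + (\<Sum>m=1..n*P. 2 * sine_coeff s m * (chi (int j) * of_real (cos (2 * real m * x j)))))"
      by (intro sum.cong refl) (simp add: sine_sum_def algebra_simps sum_distrib_left)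
    also have "\<dots> = sine_coeff s 0 * (\<Sum>j<N. chi (int j)) + (\<Sum>m=1..n*P. 2 * sine_coeff s m * (\<Sum>j<N. chi (int j) * of_real (cos (2 * real m * x j))))"
      unfolding sum.distrib sum_distrib_left by (simp only: sum.swap[of _ "{..<N}"])
    also have "\<dots> = (\<Sum>m=1..n*P. if n dvd m then 2 * sine_coeff s m * (of_nat n * gauss_sum k chi (int (m div n))) else 0)"
      unfolding W0 W by (simp add: if_distrib cong: if_cong)
    also have "\<dots> = (\<Sum>m | m \<in> {1..n*P} \<and> n dvd m. 2 * sine_coeff s m * (of_nat n * gauss_sum k chi (int (m div n))))"
      by (rule sum.inter_filter[symmetric]) simp
    also have "\<dots> = (\<Sum>l<P. 2 * sine_coeff s (n * Suc l) * (of_nat n * gauss_sum k chi (int (Suc l))))"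
    proof (rule sum.reindex_bij_witness[where i = "\<lambda>l. n * Suc l" and j = "\<lambda>m. m div n - 1"])
      fix m assume "m \<in> {m. m \<in> {1..n * P} \<and> n dvd m}"
      then obtain l where l: "m = n * l" "1 \<le> n * l" "n * l \<le> n * P" by (auto elim!: dvdE)
      have "l \<ge> 1" "l \<le> P" using l n by (auto simp: Suc_le_eq)
      thus "n * Suc (m div n - 1) = m" "m div n - 1 \<in> {..<P}"
        "2 * sine_coeff s (n * Suc (m div n - 1)) * (of_nat n * gauss_sum k chi (int (Suc (m div n - 1))))
         = 2 * sine_coeff s m * (of_nat n * gauss_sum k chi (int (m div n)))"
        using n by (auto simp: l(1))
    next
      fix l assume "l \<in> {..<P}"
      thus "n * Suc l div n - 1 = l" "n * Suc l \<in> {m. m \<in> {1..n * P} \<and> n dvd m}"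
        using n by (auto simp: Suc_le_eq simp del: mult_Suc_right intro!: mult_le_mono2)
    qed
    also have "\<dots> = (\<Sum>l<P. 2 * of_nat n * gauss_sum k chi 1 * (cnj (chi (int (Suc l))) * sine_coeff s (n * Suc l)))"
      by (intro sum.cong refl) (simp only: gauss_sum_eq[OF prim, of "int (Suc _)"] mult_ac)
    finally show ?thesis .
  qed
  have "(\<lambda>P. \<Sum>j = 1..N - 1. chi (int j) * (sine_const s * sine_sum s (n * P) (x j))) \<longlonglongrightarrow>
     (\<Sum>j = 1..N - 1. chi (int j) * complex_of_real (sin (x j)) powr (-s))"
  proof (intro tendsto_sum tendsto_mult_left)
    fix j assume j: "j \<in> {1..N - 1}"
    have "x j > 0" using j k n by (simp add: x_def)
    moreover have "x j < pi"
    proof -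
      have "j < k * n" using j k n by (auto simp: N_def)
      hence "real j < real (k * n)" by (simp only: of_nat_less_iff)
      thus ?thesis by (simp add: x_def field_simps)
    qed
    ultimately have "(\<lambda>M. sine_const s * sine_sum s M (x j)) \<longlonglongrightarrow> complex_of_real (sin (x j)) powr (-s)"
      using s by (intro sine_sum_LIMSEQ)
    moreover have "filterlim (\<lambda>P. n * P) at_top sequentially"
      using n by (intro mult_nat_left_at_top)
    ultimately show "(\<lambda>P. sine_const s * sine_sum s (n * P) (x j)) \<longlonglongrightarrow> complex_of_real (sin (x j)) powr (-s)"
      by (rule filterlim_compose)
  qed
  moreover have "(\<Sum>j = 1..N - 1. chi (int j) * complex_of_real (sin (x j)) powr (-s)) = cyclic_L k chi n s"
    by (simp add: cyclic_L_def x_def N_def)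
  moreover have "(\<Sum>j = 1..N - 1. chi (int j) * (sine_const s * sine_sum s (n * P) (x j)))
     = (\<Sum>l<P. 2 * of_nat n * gauss_sum k chi 1 * sine_const s * (cnj (chi (int (Suc l))) * sine_coeff s (n * Suc l)))" for P
  proof -
    have "(\<Sum>j = 1..N - 1. chi (int j) * (sine_const s * sine_sum s (n * P) (x j))) = sine_const s * (\<Sum>j<N. chi (int j) * sine_sum s (n * P) (x j))"
      unfolding set sum_distrib_left by (simp only: mult_ac)
    thus ?thesis unfolding fin sum_distrib_left by (simp only: mult_ac)
  qed
  ultimately show ?thesis by (simp add: sums_def)
qed

section \<open>Convergence to the Dirichlet \<open>L\<close>-function\<close>

text \<open>Summation by parts in which \<open>C * g\<close> controls both the size and the
  variation of \<open>f\<close>, so that the variation telescopes.\<close>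

lemma Abel_summation_bound:
  fixes x f :: "nat \<Rightarrow> complex" and g :: "nat \<Rightarrow> real"
  assumes S: "\<And>m. norm (\<Sum>j<m. x j) \<le> B"
    and f: "\<And>j. M \<le> j \<Longrightarrow> j \<le> N \<Longrightarrow> norm (f j) \<le> C * g j"
    and df: "\<And>j. M \<le> j \<Longrightarrow> Suc j \<le> N \<Longrightarrow> norm (f j - f (Suc j)) \<le> C * (g j - g (Suc j))"
    and MN: "M \<le> N"
  shows "norm (\<Sum>j=M..N. x j * f j) \<le> 2 * B * C * g M"
proof -
  define S where "S = (\<lambda>m. \<Sum>j<m. x j)"
  have B: "B \<ge> 0" using S[of 0] by simp
  have SB: "norm (S m * z) \<le> B * c" if "norm z \<le> c" for m z c
    unfolding norm_mult S_def using that S B by (intro mult_mono) auto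
  \<comment> \<open>With the upper boundary term moved to the left, \<open>g M\<close> comes from
    the lower end and \<open>g M - g n\<close> from the variation.\<close>
  have "norm ((\<Sum>j=M..n. x j * f j) - S (Suc n) * f n) \<le> B * (C * (2 * g M - g n))" if "M \<le> n" "n \<le> N" for n
    using that
  proof (induction n rule: dec_induct)
    case base
    have "(\<Sum>j=M..M. x j * f j) - S (Suc M) * f M = - (S M * f M)" by (simp add: S_def algebra_simps)
    thus ?case using SB[OF f[of M], of M] base by simp
  next
    case (step n)
    have "(\<Sum>j=M..Suc n. x j * f j) - S (Suc (Suc n)) * f (Suc n)
        = ((\<Sum>j=M..n. x j * f j) - S (Suc n) * f n) + S (Suc n) * (f n - f (Suc n))"
      using step by (simp add: S_def algebra_simps)
    also have "norm \<dots> \<le> B * (C * (2 * g M - g n)) + B * (C * (g n - g (Suc n)))"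
      using step by (intro norm_triangle_mono SB df step.IH) auto
    finally show ?case by (simp add: algebra_simps)
  qed
  from this[OF MN order.refl] SB[OF f[OF MN order.refl], of "Suc N"]
  have "norm ((\<Sum>j=M..N. x j * f j) - S (Suc N) * f N) + norm (S (Suc N) * f N) \<le> B * (C * (2 * g M))"
    by (simp add: algebra_simps)
  thus ?thesis using norm_triangle_sub[of "\<Sum>j=M..N. x j * f j" "S (Suc N) * f N"] by (simp add: mult_ac)
qed

text \<open>The derivative of \<open>x powr (- s)\<close> has modulus \<open>norm s / Re s\<close>
  times that of the derivative of \<open>x powr (- Re s)\<close>, and the latter has constant
  sign.\<close>

lemma norm_powr_diff_le:
  fixes a b :: real
  assumes s: "Re s > 0" and ab: "0 < a" "a \<le> b"
  shows "norm (complex_of_real a powr (-s) - of_real b powr (-s)) \<le> norm s / Re s * (a powr (-Re s) - b powr (-Re s))"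
proof (cases "a = b")
  case False
  have "norm (complex_of_real b powr (-s) - of_real a powr (-s)) \<le> (- norm s / Re s * b powr (-Re s)) - (- norm s / Re s * a powr (-Re s))"
  proof (rule differentiable_bound_general)
    show "a < b" using False ab by simp
    show "continuous_on {a..b} (\<lambda>x. complex_of_real x powr (-s))"
      using ab by (intro continuous_intros) (auto simp: complex_nonpos_Reals_iff)
    show "continuous_on {a..b} (\<lambda>x. - norm s / Re s * x powr (-Re s))"
      using ab by (intro continuous_intros) auto
    fix x assume x: "a < x" "x < b"
    have "((\<lambda>x. complex_of_real x) has_vector_derivative 1) (at x)"
    proof -
      have "((\<lambda>x. complex_of_real x) has_vector_derivative of_real 1) (at x)"
        by (rule has_vector_derivative_of_real) (rule DERIV_ident)
      thus ?thesis by simp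
    qed
    moreover have "((\<lambda>z. z powr (-s)) has_field_derivative (-s) * of_real x powr (-s - 1)) (at (complex_of_real x))"
      using x ab by (intro has_field_derivative_powr) (auto simp: complex_nonpos_Reals_iff)
    ultimately have "((\<lambda>z. z powr (-s)) \<circ> (\<lambda>x. complex_of_real x) has_vector_derivative 1 * ((-s) * of_real x powr (-s - 1))) (at x)"
      by (rule field_vector_diff_chain_at)
    thus "((\<lambda>x. complex_of_real x powr (-s)) has_vector_derivative (-s) * of_real x powr (-s - 1)) (at x)"
      by (simp add: o_def)
    have "((\<lambda>x. x powr (-Re s)) has_real_derivative (-Re s) * x powr (-Re s - 1)) (at x)"
      using x ab by (intro has_real_derivative_powr) auto
    from DERIV_cmult[OF this, of "- norm s / Re s"]
    have "((\<lambda>x. - norm s / Re s * x powr (-Re s)) has_real_derivative norm s * x powr (-Re s - 1)) (at x)"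
      using s by simp
    thus "((\<lambda>x. - norm s / Re s * x powr (-Re s)) has_vector_derivative norm s * x powr (-Re s - 1)) (at x)"
      by (simp add: has_real_derivative_iff_has_vector_derivative)
    show "norm ((-s) * of_real x powr (-s - 1)) \<le> norm s * x powr (-Re s - 1)"
      using x ab by (simp add: norm_mult norm_powr_real_powr)
  qed
  thus ?thesis by (simp add: norm_minus_commute algebra_simps)
qed auto

lemma norm_sum_powr_le:
  fixes x :: "nat \<Rightarrow> complex" and a :: "nat \<Rightarrow> real"
  assumes S: "\<And>m. norm (\<Sum>j<m. x j) \<le> B" and s: "Re s > 0"
    and pos: "\<And>j. M \<le> j \<Longrightarrow> j \<le> N \<Longrightarrow> a j > 0"
    and mono: "\<And>j. M \<le> j \<Longrightarrow> Suc j \<le> N \<Longrightarrow> a j \<le> a (Suc j)" and MN: "M \<le> N"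
  shows "norm (\<Sum>j=M..N. x j * of_real (a j) powr (-s)) \<le> 2 * B * (norm s / Re s) * a M powr (-Re s)"
proof (rule Abel_summation_bound[where g = "\<lambda>j. a j powr (-Re s)", OF S _ _ MN])
  fix j assume j: "M \<le> j" "j \<le> N"
  have "norm s / Re s \<ge> 1" using s complex_Re_le_cmod[of s] by simp
  thus "norm (complex_of_real (a j) powr (-s)) \<le> norm s / Re s * a j powr (-Re s)"
    using pos[OF j] mult_right_mono[of 1 "norm s / Re s" "a j powr (-Re s)"] by (simp add: norm_powr_real_powr)
next
  fix j assume j: "M \<le> j" "Suc j \<le> N"
  thus "norm (complex_of_real (a j) powr (-s) - of_real (a (Suc j)) powr (-s)) \<le> norm s / Re s * (a j powr (-Re s) - a (Suc j) powr (-Re s))"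
    using pos[of j] mono[of j] s by (intro norm_powr_diff_le) auto
qed

lemma powr_tail_LIMSEQ_0:
  assumes "\<sigma> > 0" "c > 0"
  shows "(\<lambda>M. D * (c * real M) powr (-\<sigma>)) \<longlonglongrightarrow> 0"
proof -
  have "filterlim (\<lambda>M. c * real M) at_top sequentially"
    using assms by (intro filterlim_tendsto_pos_mult_at_top[OF tendsto_const] filterlim_real_sequentially)
  hence "(\<lambda>M. (c * real M) powr (-\<sigma>)) \<longlonglongrightarrow> 0" using assms by (intro tendsto_neg_powr) auto
  from tendsto_mult_left[OF this, of D] show ?thesis by simp
qed

lemma summable_powr_of_bounded_sums:
  fixes x :: "nat \<Rightarrow> complex"
  assumes S: "\<And>m. norm (\<Sum>j<m. x j) \<le> B" and s: "Re s > 0"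
  shows "summable (\<lambda>j. x j * of_nat j powr (-s))"
  unfolding summable_Cauchy
proof (intro allI impI)
  fix e :: real assume e: "e > 0"
  define D where "D = 2 * B * (norm s / Re s)"
  have "(\<lambda>M. D * (1 * real M) powr (-Re s)) \<longlonglongrightarrow> 0" using s by (intro powr_tail_LIMSEQ_0) auto
  from order_tendstoD(2)[OF this e] obtain M0 where M0: "\<And>M. M \<ge> M0 \<Longrightarrow> D * real M powr (-Re s) < e"
    by (auto simp: eventually_at_top_linorder)
  have "norm (sum (\<lambda>j. x j * of_nat j powr (-s)) {m..<n}) < e" if "m \<ge> max 1 M0" for m n
  proof (cases "m < n")
    case True
    have "norm (\<Sum>j=m..n - 1. x j * complex_of_real (real j) powr (-s)) \<le> 2 * B * (norm s / Re s) * real m powr (-Re s)"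
      by (rule norm_sum_powr_le[OF S s]) (use that True in auto)
    also have "\<dots> < e" using M0[of m] that by (simp add: D_def)
    finally show ?thesis using True by (cases n) (auto simp: atLeastLessThanSuc_atLeastAtMost)
  qed (use e in auto)
  thus "\<exists>N. \<forall>m\<ge>N. \<forall>n. norm (sum (\<lambda>j. x j * of_nat j powr (-s)) {m..<n}) < e" by blast
qed

text \<open>Tannery's theorem for conditional convergence: monotonicity of \<open>a n\<close> and
  the lower bound \<open>c * j\<close> make the tails beyond \<open>J\<close> small uniformly in
  \<open>n\<close>, and the finite rest converges term by term.\<close>

lemma tendsto_sum_powr_of_bounded_sums:
  fixes x :: "nat \<Rightarrow> complex" and a :: "nat \<Rightarrow> nat \<Rightarrow> real" and h :: "nat \<Rightarrow> nat"
  assumes S: "\<And>m. norm (\<Sum>j<m. x j) \<le> B" and s: "Re s > 0" and c: "c > 0"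
    and low: "\<And>n j. 1 \<le> j \<Longrightarrow> j \<le> h n \<Longrightarrow> c * real j \<le> a n j"
    and mono: "\<And>n j. 1 \<le> j \<Longrightarrow> Suc j \<le> h n \<Longrightarrow> a n j \<le> a n (Suc j)"
    and lim: "\<And>j. 1 \<le> j \<Longrightarrow> (\<lambda>n. a n j) \<longlonglongrightarrow> real j"
    and h: "filterlim h at_top sequentially"
  shows "(\<lambda>n. \<Sum>j=1..h n. x j * of_real (a n j) powr (-s)) \<longlonglongrightarrow> (\<Sum>j. x j * of_nat j powr (-s))"
proof (rule tendstoI)
  fix e :: real assume e: "e > 0"
  define L where "L = (\<Sum>j. x j * of_nat j powr (-s))"
  define D where "D = 2 * B * (norm s / Re s)"
  have B: "B \<ge> 0" using S[of 0] by simp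
  have D: "D \<ge> 0" using s B by (simp add: D_def)
  have "(\<lambda>M. D * (c * real M) powr (-Re s)) \<longlonglongrightarrow> 0" using s c by (intro powr_tail_LIMSEQ_0) auto
  hence ev1: "eventually (\<lambda>M. D * (c * real M) powr (-Re s) < e / 3) sequentially"
    using e by (intro order_tendstoD(2)) auto
  have "(\<lambda>M. \<Sum>j<M. x j * of_nat j powr (-s)) \<longlonglongrightarrow> L"
    unfolding L_def by (intro summable_LIMSEQ summable_powr_of_bounded_sums[OF S s])
  hence ev2: "eventually (\<lambda>M. dist (\<Sum>j<M. x j * of_nat j powr (-s)) L < e / 3) sequentially"
    using e by (intro tendstoD) auto
  obtain J where J: "D * (c * real J) powr (-Re s) < e / 3" "dist (\<Sum>j<J. x j * of_nat j powr (-s)) L < e / 3" "J \<ge> 1"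
    using eventually_happens[OF eventually_conj[OF ev1 eventually_conj[OF ev2 eventually_ge_at_top[of 1]]]] by auto
  have "(\<lambda>n. \<Sum>j=1..<J. x j * of_real (a n j) powr (-s)) \<longlonglongrightarrow> (\<Sum>j=1..<J. x j * of_real (real j) powr (-s))"
  proof (intro tendsto_sum tendsto_mult_left)
    fix j assume j: "j \<in> {1..<J}"
    have "isCont (\<lambda>z. z powr (-s)) (complex_of_real (real j))"
      using j by (intro continuous_intros) (auto simp: complex_nonpos_Reals_iff)
    thus "(\<lambda>n. complex_of_real (a n j) powr (-s)) \<longlonglongrightarrow> of_real (real j) powr (-s)"
      by (rule isCont_tendsto_compose) (rule tendsto_of_real[OF lim], use j in simp)
  qed
  \<comment> \<open>The index 0 adds nothing because \<open>0 powr (- s) = 0\<close>.\<close>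
  also have "(\<Sum>j=1..<J. x j * of_real (real j) powr (-s)) = (\<Sum>j<J. x j * of_nat j powr (-s))"
    by (intro sum.mono_neutral_cong_left) (auto simp: not_le)
  finally have "eventually (\<lambda>n. dist (\<Sum>j=1..<J. x j * of_real (a n j) powr (-s)) (\<Sum>j<J. x j * of_nat j powr (-s)) < e / 3) sequentially"
    using e by (intro tendstoD) auto
  moreover have "eventually (\<lambda>n. h n \<ge> J) sequentially" using h by (simp add: filterlim_at_top)
  ultimately show "eventually (\<lambda>n. dist (\<Sum>j=1..h n. x j * of_real (a n j) powr (-s)) L < e) sequentially"
  proof eventually_elim
    case (elim n)
    have pos: "a n j > 0" if "1 \<le> j" "j \<le> h n" for j
      using low[OF that] c that mult_pos_pos[of c "real j"] by linarith
    have "norm (\<Sum>j=J..h n. x j * of_real (a n j) powr (-s)) \<le> D * a n J powr (-Re s)"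
      unfolding D_def by (rule norm_sum_powr_le[OF S s]) (use pos mono J elim in auto)
    also have "\<dots> \<le> D * (c * real J) powr (-Re s)"
      using D low[of J n] J elim c s by (intro mult_left_mono powr_mono2') auto
    finally have tail: "norm (\<Sum>j=J..h n. x j * of_real (a n j) powr (-s)) < e / 3" using J by linarith
    have "{1..h n} = {1..<J} \<union> {J..h n}" using J elim by auto
    hence split: "(\<Sum>j=1..h n. x j * of_real (a n j) powr (-s)) = (\<Sum>j=1..<J. x j * of_real (a n j) powr (-s)) + (\<Sum>j=J..h n. x j * of_real (a n j) powr (-s))"
      by (simp only:) (intro sum.union_disjoint, auto)
    have gen: "dist (A + T) L < e" if "norm T < e / 3" "dist A A' < e / 3" "dist A' L < e / 3" for A A' T
    proof -
      have "norm (A + T - L) = norm ((A - A') + (A' - L) + T)" by (simp add: algebra_simps)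
      also have "\<dots> \<le> norm (A - A') + norm (A' - L) + norm T" by (intro norm_triangle_mono order.refl)
      finally show ?thesis using that by (simp add: dist_norm)
    qed
    show ?case unfolding split by (rule gen[OF tail elim(1) J(2)])
  qed
qed

section \<open>Convergence of the normalised cyclic sums\<close>

text \<open>Any \<open>k\<close> consecutive values sum to 0, so windows of length \<open>k\<close>
  can be removed until fewer than \<open>k\<close> terms remain.\<close>

lemma norm_sum_character_le:
  assumes prim: "primitive_character k chi" and k: "k > 1"
  shows "norm (\<Sum>j<m. chi (int j)) \<le> real k"
proof -
  note chi = primitive_character_imp_dirichlet[OF prim]
  have per: "chi (int (m + k)) = chi (int m)" for m
    using chi_add_multiple[OF chi, of "int m" 1] by simp
  have window: "(\<Sum>j=m..<m+k. chi (int j)) = 0" for m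
  proof (induction m)
    case 0
    show ?case using sum_character_period[OF prim k] by (simp add: lessThan_atLeast0)
  next
    case (Suc m)
    have "(\<Sum>j=m..<m+k. chi (int j)) + chi (int (m + k)) = chi (int m) + (\<Sum>j=Suc m..<Suc m+k. chi (int j))"
      using sum.atLeastLessThan_Suc[of m "m + k" "\<lambda>j. chi (int j)"] sum.atLeast_Suc_lessThan[of m "Suc (m + k)" "\<lambda>j. chi (int j)"] k
      by simp
    thus ?case using Suc per[of m] by simp
  qed
  show ?thesis
  proof (induction m rule: less_induct)
    case (less m)
    show ?case
    proof (cases "m < k")
      case True
      have "norm (\<Sum>j<m. chi (int j)) \<le> (\<Sum>j<m. 1)"
        by (intro sum_norm_le norm_chi_le[OF chi])
      thus ?thesis using True by simp
    next
      case False
      define m' where "m' = m - k"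
      have m': "m = m' + k" "m' < m" using False k by (auto simp: m'_def)
      have "(\<Sum>j<m. chi (int j)) = (\<Sum>j<m'. chi (int j)) + (\<Sum>j=m'..<m'+k. chi (int j))"
        unfolding m'(1) lessThan_atLeast0 by (rule sum.atLeastLessThan_concat[symmetric]) auto
      thus ?thesis unfolding window using less.IH[OF m'(2)] by simp
    qed
  qed
qed

lemma dirichlet_L_sums:
  assumes prim: "primitive_character k chi" and k: "k > 1" and s: "Re s > 0"
  shows "(\<lambda>j. chi (int (Suc j)) * of_nat (Suc j) powr (-s)) sums dirichlet_L chi s"
    and "dirichlet_L chi s = (\<Sum>j. chi (int j) * of_nat j powr (-s))"
proof -
  have S: "summable (\<lambda>j. chi (int j) * of_nat j powr (-s))"
    by (rule summable_powr_of_bounded_sums[OF norm_sum_character_le[OF prim k] s])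
  hence "summable (\<lambda>j. chi (int (Suc j)) * of_nat (Suc j) powr (-s))"
    by (subst summable_Suc_iff)
  thus "(\<lambda>j. chi (int (Suc j)) * of_nat (Suc j) powr (-s)) sums dirichlet_L chi s"
    using s by (simp add: dirichlet_L_def summable_sums)
  show "dirichlet_L chi s = (\<Sum>j. chi (int j) * of_nat j powr (-s))"
    using s suminf_split_head[OF S] by (simp add: dirichlet_L_def)
qed

text \<open>The rescaled sines \<open>a n j\<close> tend to \<open>j\<close> but increase only up to
  \<open>j = k * n / 2\<close>. There the sum is folded by \<open>j -> k * n - j\<close>, a symmetry
  because \<open>chi\<close> is even; each half tends to the \<open>L\<close>-value.\<close>

lemma cyclic_L_LIMSEQ:
  assumes prim: "primitive_character k chi" and ev: "even_character chi" and k: "k > 1" and s: "Re s > 0"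
  shows "(\<lambda>n. of_real (real (k * n) / pi) powr (-s) * cyclic_L k chi n s) \<longlonglongrightarrow> 2 * dirichlet_L chi s"
proof -
  note chi = primitive_character_imp_dirichlet[OF prim]
  define a where "a = (\<lambda>n j. real (k * n) / pi * sin (pi * real j / real (k * n)))"
  have half: "(\<lambda>n. \<Sum>j=1..h n. chi (int j) * of_real (a n j) powr (-s)) \<longlonglongrightarrow> dirichlet_L chi s"
    if h: "filterlim h at_top sequentially" "\<And>n. 2 * h n \<le> k * n" for h
    unfolding dirichlet_L_sums(2)[OF prim k s]
  proof (rule tendsto_sum_powr_of_bounded_sums[OF norm_sum_character_le[OF prim k] s, of "2 / pi" h a])
    show "2 / pi > 0" by simp
    have arg: "0 < real (k * n)" "pi * real j / real (k * n) \<le> pi / 2" "pi * real j / real (k * n) \<ge> 0" if "1 \<le> j" "j \<le> h n" for n j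
    proof -
      have "2 * j \<le> k * n" using that h(2)[of n] by linarith
      hence "2 * real j \<le> real (k * n)" by (metis of_nat_le_iff of_nat_mult of_nat_numeral)
      thus "0 < real (k * n)" "pi * real j / real (k * n) \<le> pi / 2" "pi * real j / real (k * n) \<ge> 0" using that
        by (auto simp: field_simps)
    qed
    {
      fix n j assume j: "1 \<le> j" "j \<le> h n"
      define y where "y = pi * real j / real (k * n)"
      \<comment> \<open>Jordan's inequality, from concavity of the sine on \<open>{0..pi/2}\<close>;
        it supplies \<open>c = 2 / pi\<close>.\<close>
      have "2 / pi * y \<le> sin y"
      proof -
        have "convex_on {0..pi/2} (\<lambda>x. - sin x)"
        proof (rule convex_on_realI)
          show "((\<lambda>x. - sin x) has_real_derivative - cos x) (at x)" for x :: real
            by (auto intro!: derivative_eq_intros)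
          show "- cos x \<le> - cos y" if "x \<in> {0..pi/2}" "y \<in> {0..pi/2}" "x \<le> y" for x y :: real
            using that by (auto intro!: cos_monotone_0_pi_le)
        qed auto
        moreover have "y \<ge> 0" "y \<le> pi / 2" using arg[OF j] by (auto simp: y_def)
        ultimately have "- sin ((1 - 2 * y / pi) *\<^sub>R 0 + (2 * y / pi) *\<^sub>R (pi / 2)) \<le> (1 - 2 * y / pi) * (- sin 0) + (2 * y / pi) * (- sin (pi / 2))"
          by (intro convex_onD) (auto simp: field_simps)
        thus ?thesis by simp
      qed
      thus "2 / pi * real j \<le> a n j"
        using arg[OF j] by (simp add: a_def y_def field_simps)
    }
    {
      fix n j assume j: "1 \<le> j" "Suc j \<le> h n"
      have "sin (pi * real j / real (k * n)) \<le> sin (pi * real (Suc j) / real (k * n))"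
      proof (rule sin_monotone_2pi_le)
        show "- (pi / 2) \<le> pi * real j / real (k * n)" using arg(3)[of j n] j pi_gt_zero by linarith
        show "pi * real j / real (k * n) \<le> pi * real (Suc j) / real (k * n)" by (simp add: divide_right_mono)
      qed (use arg(2)[of "Suc j" n] j in auto)
      thus "a n j \<le> a n (Suc j)" unfolding a_def by (intro mult_left_mono) auto
    }
    show "(\<lambda>n. a n j) \<longlonglongrightarrow> real j" if "1 \<le> j" for j
    proof -
      have "real k > 0" "real j > 0" using k that by auto
      thus ?thesis unfolding a_def of_nat_mult by (real_asymp simp: field_simps)
    qed
    show "filterlim h at_top sequentially" by (rule h)
  qed
  \<comment> \<open>Two different upper limits, so that for even \<open>k * n\<close> the middle
    index is counted once.\<close>
  have "filterlim (\<lambda>n. (k * n - 1) div 2) at_top sequentially"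
    and "filterlim (\<lambda>n. k * n div 2) at_top sequentially"
  proof -
    have *: "eventually (\<lambda>n. f n \<ge> Z) sequentially" if "\<And>n. f n \<ge> (n - 1) div 2" for f :: "nat \<Rightarrow> nat" and Z
      using eventually_ge_at_top[of "2 * Z + 1"] 
    proof eventually_elim
      case (elim n)
      hence "Z \<le> (n - 1) div 2" by linarith
      thus ?case using that[of n] by linarith
    qed
    have kn: "n \<le> k * n" for n using k by (cases k) auto
    show "filterlim (\<lambda>n. (k * n - 1) div 2) at_top sequentially"
      unfolding filterlim_at_top using kn by (intro allI * div_le_mono diff_le_mono)
    have "(n - 1) div 2 \<le> k * n div 2" for n using kn[of n] by (intro div_le_mono) linarith
    thus "filterlim (\<lambda>n. k * n div 2) at_top sequentially"
      unfolding filterlim_at_top by (intro allI *)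
  qed
  from tendsto_add[OF half[OF this(1)] half[OF this(2)]]
  have "(\<lambda>n. (\<Sum>j=1..(k * n - 1) div 2. chi (int j) * of_real (a n j) powr (-s)) + (\<Sum>j=1..k * n div 2. chi (int j) * of_real (a n j) powr (-s)))
     \<longlonglongrightarrow> dirichlet_L chi s + dirichlet_L chi s" by simp
  moreover have "eventually (\<lambda>n. (\<Sum>j=1..(k * n - 1) div 2. chi (int j) * of_real (a n j) powr (-s)) + (\<Sum>j=1..k * n div 2. chi (int j) * of_real (a n j) powr (-s))
     = of_real (real (k * n) / pi) powr (-s) * cyclic_L k chi n s) sequentially"
    using eventually_gt_at_top[of 0]
  proof eventually_elim
    case (elim n)
    define N where "N = k * n"
    have N: "N > 0" using elim k by (simp add: N_def)
    define F where "F = (\<lambda>j. chi (int j) * of_real (a n j) powr (-s))"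
    have reflect: "F (N - j) = F j" if "j \<le> N" for j
    proof -
      have "chi (- int j + int k * int n) = chi (- int j)" by (rule chi_add_multiple[OF chi])
      also have "\<dots> = chi (int j)" using chi_mult[OF chi, of "-1" "int j"] ev by (simp add: even_character_def)
      also have "- int j + int k * int n = int (N - j)" using that by (simp add: N_def of_nat_diff)
      finally have "chi (int (N - j)) = chi (int j)" .
      moreover have "pi * real (N - j) / real N = pi - pi * real j / real N"
        using that N by (simp add: of_nat_diff field_simps)
      hence "a n (N - j) = a n j" unfolding a_def N_def[symmetric] by simp
      ultimately show ?thesis by (simp add: F_def)
    qed
    have "(\<Sum>j=1..N div 2. F j) = (\<Sum>j=(N - 1) div 2 + 1..N - 1. F j)"
      by (rule sum.reindex_bij_witness[where i = "\<lambda>j. N - j" and j = "\<lambda>j. N - j"]) (use reflect N in auto)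
    moreover have "(\<Sum>j=1..(N - 1) div 2. F j) + (\<Sum>j=(N - 1) div 2 + 1..N - 1. F j) = (\<Sum>j=1..N - 1. F j)"
    proof -
      have "{1..N - 1} = {1..(N - 1) div 2} \<union> {(N - 1) div 2 + 1..N - 1}" by auto
      thus ?thesis by (simp only:) (rule sum.union_disjoint[symmetric], auto)
    qed
    moreover have "(\<Sum>j=1..N - 1. F j) = of_real (real N / pi) powr (-s) * cyclic_L k chi n s"
      unfolding cyclic_L_def N_def[symmetric] sum_distrib_left
    proof (rule sum.cong[OF refl])
      fix j assume j: "j \<in> {1..N - 1}"
      have "sin (pi * real j / real N) \<ge> 0"
        using j N by (intro sin_ge_zero) (auto simp: field_simps)
      hence "complex_of_real (a n j) powr (-s) = of_real (real N / pi) powr (-s) * of_real (sin (pi * real j / real N)) powr (-s)"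
        unfolding a_def N_def[symmetric] of_real_mult by (intro powr_times_real) auto
      thus "F j = of_real (real N / pi) powr (-s) * (chi (int j) * of_real (sin (pi * real j / real N)) powr (-s))"
        by (simp add: F_def)
    qed
    ultimately show ?case by (simp add: F_def N_def)
  qed
  ultimately have "(\<lambda>n. of_real (real (k * n) / pi) powr (-s) * cyclic_L k chi n s) \<longlonglongrightarrow> dirichlet_L chi s + dirichlet_L chi s"
    by (rule Lim_transform_eventually)
  thus ?thesis by simp
qed

section \<open>Expansion of \<open>\<xi>\<^sub>n\<close> to second order\<close>

text \<open>Dominated convergence for the counting measure.\<close>

lemma tendsto_suminf_dominated:
  fixes f :: "nat \<Rightarrow> nat \<Rightarrow> complex"
  assumes "\<And>l. (\<lambda>n. f n l) \<longlonglongrightarrow> g l" "\<And>n l. norm (f n l) \<le> M l" "summable M"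
  shows "(\<lambda>n. \<Sum>l. f n l) \<longlonglongrightarrow> (\<Sum>l. g l)"
proof -
  let ?C = "count_space (UNIV :: nat set)"
  have Mnn: "0 \<le> M l" for l using order_trans[OF norm_ge_zero assms(2)] .
  have M: "integrable ?C M" using assms(3) Mnn by (simp add: integrable_count_space_nat_iff)
  have "norm (g l) \<le> M l" for l
    by (rule LIMSEQ_le_const2[OF tendsto_norm[OF assms(1)]]) (use assms(2) in auto)
  hence "summable (\<lambda>l. norm (g l))" "\<And>n. summable (\<lambda>l. norm (f n l))"
    using assms(2) by (auto intro!: summable_comparison_test'[OF assms(3), of 0])
  moreover have "(\<lambda>n. integral\<^sup>L ?C (f n)) \<longlonglongrightarrow> integral\<^sup>L ?C g"
    by (rule integral_dominated_convergence[OF _ _ M]) (use assms in auto)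
  ultimately show ?thesis by (simp add: integral_count_space_nat integrable_count_space_nat_iff)
qed

lemma norm_real_powr:
  fixes r :: real
  shows "r > 0 \<Longrightarrow> norm (complex_of_real r powr s) = r powr Re s"
  by (simp add: norm_powr_real_powr)

text \<open>The part independent of \<open>n\<close> and \<open>l\<close> when the dual series is
  inserted into \<open>cyclic_xi\<close>: the explicit powers of \<open>n\<close> cancel against the
  leading power in \<open>sine_coeff s (n * l)\<close>.\<close>

definition dual_factor :: "nat \<Rightarrow> (int \<Rightarrow> complex) \<Rightarrow> complex \<Rightarrow> complex" where
  "dual_factor k chi s = of_real (pi / real k) powr (s / 2) * Gamma (s / 2) * (2 * gauss_sum k chi 1 * sine_const s)"

text \<open>\<open>Gamma (s / 2)\<close> cancels against \<open>sine_const s\<close>, and the Gauss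
  sum has modulus \<open>sqrt k\<close>. What remains is the modulus of the factor that completes
  the \<open>L\<close>-value at \<open>1 - s\<close>.\<close>

lemma norm_dual_factor:
  assumes prim: "primitive_character k chi" and s: "Im s \<noteq> 0"
  shows "norm (dual_factor k chi s) = 2 * ((real k / pi) powr (Re (1 - s) / 2) * norm (Gamma ((1 - s) / 2)))"
proof -
  have k: "k > 0" using chi_modulus_pos[OF primitive_character_imp_dirichlet[OF prim]] .
  have "Gamma (s / 2) \<noteq> 0" using s by (intro Gamma_nonzero nonreal_not_nonpos_Int) auto
  hence "norm (dual_factor k chi s) = (pi / real k) powr (Re s / 2) * (2 * (sqrt (real k) / sqrt pi) * norm (Gamma ((1 - s) / 2)))"
    using k by (simp add: dual_factor_def sine_const_def norm_mult norm_divide norm_real_powr norm_gauss_sum[OF prim] del: of_real_divide)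
  also have "sqrt (real k) / sqrt pi = (real k / pi) powr (1 / 2)"
    using k by (simp add: powr_half_sqrt real_sqrt_divide)
  also have "(pi / real k) powr (Re s / 2) = (real k / pi) powr (- Re s / 2)"
  proof -
    have l: "ln (pi / real k) = - ln (real k / pi)" using k by (simp add: ln_div)
    show ?thesis unfolding powr_def l using k by simp
  qed
  finally have "norm (dual_factor k chi s) = 2 * (((real k / pi) powr (- Re s / 2) * (real k / pi) powr (1 / 2)) * norm (Gamma ((1 - s) / 2)))"
    by (simp add: mult_ac)
  also have "(real k / pi) powr (- Re s / 2) * (real k / pi) powr (1 / 2) = (real k / pi) powr (Re (1 - s) / 2)"
    unfolding powr_add[symmetric] by (rule arg_cong[where f = "\<lambda>t. _ powr t"]) (simp add: field_simps)
  finally show ?thesis .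
qed

lemma cyclic_xi_LIMSEQ:
  assumes prim: "primitive_character k chi" and ev: "even_character chi" and k: "k > 1" and s: "Re s > 0"
  shows "(\<lambda>n. cyclic_xi k chi n s) \<longlonglongrightarrow> 2 * (of_real (real k / pi) powr (s / 2) * Gamma (s / 2) * dirichlet_L chi s)"
proof -
  define r where "r = real k / pi"
  have r: "r > 0" using k by (simp add: r_def)
  have e: "complex_of_real t powr z = exp (z * of_real (ln t))" if "t > 0" for t z
    using that by (simp add: powr_def Ln_of_real)
  define C where "C = of_real (pi / real k) powr (s / 2) * Gamma (s / 2) * of_real r powr s"
  have "(\<lambda>n. C * (of_real (real (k * n) / pi) powr (-s) * cyclic_L k chi n s)) \<longlonglongrightarrow> C * (2 * dirichlet_L chi s)"
    by (intro tendsto_mult_left cyclic_L_LIMSEQ assms)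
  moreover have "eventually (\<lambda>n. C * (of_real (real (k * n) / pi) powr (-s) * cyclic_L k chi n s) = cyclic_xi k chi n s) sequentially"
    using eventually_gt_at_top[of 0]
  proof eventually_elim
    case (elim n)
    have "real (k * n) / pi = r * real n" by (simp add: r_def)
    hence "complex_of_real (real (k * n) / pi) powr (-s) = of_real r powr (-s) * of_real (real n) powr (-s)"
      using r by (simp only: of_real_mult) (intro powr_times_real, auto)
    hence eq: "C * (of_real (real (k * n) / pi) powr (-s) * cyclic_L k chi n s)
       = (of_real r powr s * of_real r powr (-s)) * (of_real (pi / real k) powr (s / 2) * Gamma (s / 2) * of_nat n powr (-s) * cyclic_L k chi n s)"
      by (simp add: C_def mult_ac)
    have "of_real r powr s * of_real r powr (-s) = (1 :: complex)"
      using r by (simp flip: powr_add)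
    thus ?case unfolding eq by (simp add: cyclic_xi_def mult_ac)
  qed
  moreover have "C * (2 * dirichlet_L chi s) = 2 * (of_real (real k / pi) powr (s / 2) * Gamma (s / 2) * dirichlet_L chi s)"
  proof -
    have "complex_of_real (pi / real k) powr (s / 2) = exp (- (s / 2) * of_real (ln r))"
    proof -
      have "ln (pi / real k) = - ln r" using k by (simp add: r_def ln_div)
      moreover have "complex_of_real (pi / real k) powr (s / 2) = exp (s / 2 * of_real (ln (pi / real k)))"
        using k by (intro e) auto
      ultimately show ?thesis by simp
    qed
    hence "complex_of_real (pi / real k) powr (s / 2) * of_real r powr s = exp (- (s / 2) * of_real (ln r) + s * of_real (ln r))"
      using r by (simp only: e exp_add)
    also have "- (s / 2) * of_real (ln r) + s * of_real (ln r) = s / 2 * of_real (ln r)" by (simp add: field_simps)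
    also have "exp \<dots> = of_real r powr (s / 2)" using r by (simp only: e)
    finally show ?thesis by (simp add: C_def r_def mult_ac)
  qed
  ultimately show ?thesis by (simp add: Lim_transform_eventually)
qed

text \<open>\<open>sine_coeff s (n * l)\<close> is
  \<open>(n * l) powr (s - 1) * (1 + d (n * l) / (n * l)^2)\<close> with \<open>d\<close> tending to
  \<open>e\<close>. The leading part sums to the \<open>L\<close>-value at \<open>1 - s\<close>,
  free of \<open>n\<close>. The rest carries \<open>l powr (s - 3)\<close> and is absolutely
  dominated, so the limit may be taken under the sum.\<close>

lemma cyclic_xi_second_order:
  assumes prim: "primitive_character k chi" and ev: "even_character chi" and k: "k > 1"
    and s: "Im s \<noteq> 0" "0 < Re s" "Re s < 1"
  shows "(\<lambda>n. of_nat n ^ 2 * (cyclic_xi k chi n s - dual_factor k chi s * dirichlet_L (\<lambda>a. cnj (chi a)) (1 - s)))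
           \<longlonglongrightarrow> dual_factor k chi s * (- s * (s - 1) * (s - 2) / 24) * dirichlet_L (\<lambda>a. cnj (chi a)) (3 - s)"
proof -
  define psi where "psi = (\<lambda>a. cnj (chi a))"
  have primc: "primitive_character k psi" unfolding psi_def by (rule primitive_character_cnj[OF prim])
  define V where "V = dual_factor k chi s"
  define d where "d = (\<lambda>m. of_nat m ^ 2 * (sine_coeff s m * of_nat m powr (1 - s) - 1))"
  define e where "e = - s * (s - 1) * (s - 2) / 24"
  have d: "d \<longlonglongrightarrow> e" unfolding d_def e_def by (rule sine_coeff_second_order[OF s(1)])
  obtain B where B: "\<And>m. norm (d m) \<le> B" using convergent_imp_Bseq[OF convergentI[OF d]] by (auto elim!: BseqE)
  have B0: "B \<ge> 0" using order_trans[OF norm_ge_zero B[of 0]] .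
  have c: "sine_coeff s m = of_nat m powr (s - 1) * (1 + d m / of_nat m ^ 2)" if "m > 0" for m
  proof -
    have "1 + d m / of_nat m ^ 2 = sine_coeff s m * of_nat m powr (1 - s)" using that by (simp add: d_def)
    moreover have "of_nat m powr (1 - s) * of_nat m powr (s - 1) = (1 :: complex)" using that by (simp flip: powr_add)
    ultimately show ?thesis by (simp add: mult_ac)
  qed
  have nr: "norm (psi a) \<le> 1" for a using norm_chi_le[OF primitive_character_imp_dirichlet[OF primc]] .
  define f where "f = (\<lambda>n l. V * (psi (int (Suc l)) * of_nat (Suc l) powr (- (3 - s)) * d (n * Suc l)))"
  have xi: "of_nat n ^ 2 * (cyclic_xi k chi n s - V * dirichlet_L psi (1 - s)) = (\<Sum>l. f n l)" if n: "n > 0" for n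
  proof -
    have "(\<lambda>l. of_nat n powr (-s) * of_real (pi / real k) powr (s / 2) * Gamma (s / 2) *
        (2 * of_nat n * gauss_sum k chi 1 * sine_const s * (cnj (chi (int (Suc l))) * sine_coeff s (n * Suc l)))) sums cyclic_xi k chi n s"
      unfolding cyclic_xi_def by (intro sums_mult cyclic_L_dual_sums assms n)
    moreover have "of_nat n powr (-s) * of_real (pi / real k) powr (s / 2) * Gamma (s / 2) *
        (2 * of_nat n * gauss_sum k chi 1 * sine_const s * (cnj (chi (int (Suc l))) * sine_coeff s (n * Suc l)))
       = V * (psi (int (Suc l)) * of_nat (Suc l) powr (- (1 - s))) + (1 / of_nat n ^ 2) * f n l" for l
    proof -
      define L where "L = (of_nat (Suc l) :: complex)"
      have L: "L \<noteq> 0" unfolding L_def by (simp only: of_nat_eq_0_iff)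
      have "of_nat (n * Suc l) powr (s - 1) = of_nat n powr (s - 1) * L powr (s - 1)"
        unfolding of_nat_mult L_def using powr_times_real[of "of_nat n" "of_nat (Suc l)" "s - 1"] by simp
      moreover have "of_nat n powr (-s) * of_nat n * of_nat n powr (s - 1) = (1 :: complex)"
      proof -
        have "of_nat n powr (-s) * of_nat n * of_nat n powr (s - 1) = (of_nat n powr (-s) * of_nat n powr 1 * of_nat n powr (s - 1) :: complex)"
          using n by simp
        also have "\<dots> = of_nat n powr (-s + 1 + (s - 1))" by (simp only: powr_add)
        finally show ?thesis using n by simp
      qed
      moreover have "L powr (s - 1) / L ^ 2 = L powr (- (3 - s))"
      proof -
        have "L powr (- (3 - s)) = L powr (s - 1 - 2)" by (rule arg_cong[where f = "\<lambda>t. _ powr t"]) simp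
        also have "\<dots> = L powr (s - 1) / L powr 2" by (rule powr_diff)
        also have "L powr 2 = L ^ 2" using L by (simp add: powr_numeral)
        finally show ?thesis by simp
      qed
      moreover have "psi (int (Suc l)) = cnj (chi (int (Suc l)))" by (simp add: psi_def)
      moreover have "p * q * g * (2 * n' * t * K * (y * (a * z * (1 + D / (n' * L) ^ 2))))
          = (q * g * (2 * t * K)) * (y * z) + 1 / n' ^ 2 * ((q * g * (2 * t * K)) * (y * z' * D))"
        if "p * n' * a = 1" "z / L ^ 2 = z'" "n' \<noteq> 0" for p q g n' t K y a z D z' :: complex
      proof -
        have "p * q * g * (2 * n' * t * K * (y * (a * z * (1 + D / (n' * L) ^ 2))))
           = (p * n' * a) * (q * g * (2 * t * K)) * (y * z * (1 + D / (n' * L) ^ 2))" by (simp add: mult_ac)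
        also have "z * (1 + D / (n' * L) ^ 2) = z + 1 / n' ^ 2 * (z' * D)"
          using that(2,3) L by (simp add: field_simps power_mult_distrib)
        hence "y * z * (1 + D / (n' * L) ^ 2) = y * (z + 1 / n' ^ 2 * (z' * D))" by (simp only: mult.assoc)
        finally show ?thesis unfolding that(1) by (simp add: algebra_simps)
      qed
      ultimately show ?thesis
        unfolding V_def dual_factor_def f_def using n c[of "n * Suc l"]
        by (simp add: L_def[symmetric] del: of_nat_Suc mult_Suc_right of_nat_add)
    qed
    ultimately have SA: "(\<lambda>l. V * (psi (int (Suc l)) * of_nat (Suc l) powr (- (1 - s))) + (1 / of_nat n ^ 2) * f n l) sums cyclic_xi k chi n s"
      by (simp only:)
    have SB: "(\<lambda>l. V * (psi (int (Suc l)) * of_nat (Suc l) powr (- (1 - s)))) sums (V * dirichlet_L psi (1 - s))"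
      by (intro sums_mult dirichlet_L_sums(1)[OF primc k]) (use s in auto)
    from sums_diff[OF SA SB]
    have "(\<lambda>l. (1 / of_nat n ^ 2) * f n l) sums (cyclic_xi k chi n s - V * dirichlet_L psi (1 - s))"
      by (simp only: add_diff_cancel_left')
    from sums_mult[OF this, of "of_nat n ^ 2"] n
    have "f n sums (of_nat n ^ 2 * (cyclic_xi k chi n s - V * dirichlet_L psi (1 - s)))" by simp
    thus ?thesis by (simp add: sums_iff)
  qed
  have "(\<lambda>n. \<Sum>l. f (Suc n) l) \<longlonglongrightarrow> (\<Sum>l. V * (psi (int (Suc l)) * of_nat (Suc l) powr (- (3 - s)) * e))"
  proof (rule tendsto_suminf_dominated)
    fix l
    have "filterlim (\<lambda>n. Suc n * Suc l) at_top sequentially"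
      by (rule filterlim_subseq) (auto simp: strict_mono_def intro!: add_less_le_mono mult_le_mono1)
    hence "(\<lambda>n. d (Suc n * Suc l)) \<longlonglongrightarrow> e" by (rule filterlim_compose[OF d])
    thus "(\<lambda>n. f (Suc n) l) \<longlonglongrightarrow> V * (psi (int (Suc l)) * of_nat (Suc l) powr (- (3 - s)) * e)"
      unfolding f_def by (intro tendsto_mult_left)
  next
    fix n l
    have "norm (f (Suc n) l) = norm V * (norm (psi (int (Suc l))) * real (Suc l) powr (Re s - 3) * norm (d (Suc n * Suc l)))"
      unfolding f_def norm_mult using norm_real_powr[of "real (Suc l)" "- (3 - s)"] by simp
    also have "\<dots> \<le> norm V * (1 * real (Suc l) powr (Re s - 3) * B)"
      by (intro mult_left_mono mult_mono nr B) auto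
    finally show "norm (f (Suc n) l) \<le> norm V * B * real (Suc l) powr (Re s - 3)" by (simp add: mult_ac)
  next
    have "summable (\<lambda>l. real l powr (Re s - 3))" using s by (simp add: summable_real_powr_iff)
    hence "summable (\<lambda>l. real (Suc l) powr (Re s - 3))" by (subst summable_Suc_iff)
    thus "summable (\<lambda>l. norm V * B * real (Suc l) powr (Re s - 3))" by (rule summable_mult)
  qed
  also have "(\<Sum>l. V * (psi (int (Suc l)) * of_nat (Suc l) powr (- (3 - s)) * e)) = V * e * dirichlet_L psi (3 - s)"
  proof -
    have "(\<lambda>l. V * e * (psi (int (Suc l)) * of_nat (Suc l) powr (- (3 - s)))) sums (V * e * dirichlet_L psi (3 - s))"
      by (intro sums_mult dirichlet_L_sums(1)[OF primc k]) (use s in auto)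
    thus ?thesis by (simp add: sums_iff mult_ac)
  qed
  finally have "(\<lambda>n. of_nat (Suc n) ^ 2 * (cyclic_xi k chi (Suc n) s - V * dirichlet_L psi (1 - s))) \<longlonglongrightarrow> V * e * dirichlet_L psi (3 - s)"
    by (simp only: xi[OF zero_less_Suc])
  hence "(\<lambda>n. of_nat n ^ 2 * (cyclic_xi k chi n s - V * dirichlet_L psi (1 - s))) \<longlonglongrightarrow> V * e * dirichlet_L psi (3 - s)"
    by (rule LIMSEQ_imp_Suc)
  thus ?thesis by (simp only: V_def e_def psi_def)
qed

section \<open>The limit of the ratio\<close>

lemma dirichlet_L_cnj:
  assumes prim: "primitive_character k chi" and k: "k > 1" and w: "Re w > 0"
  shows "dirichlet_L (\<lambda>a. cnj (chi a)) (cnj w) = cnj (dirichlet_L chi w)"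
proof -
  have "(\<lambda>j. cnj (chi (int (Suc j)) * of_nat (Suc j) powr (- w))) sums cnj (dirichlet_L chi w)"
    unfolding sums_cnj by (rule dirichlet_L_sums(1)[OF prim k w])
  moreover have "cnj (of_nat (Suc j) powr (- w)) = of_nat (Suc j) powr (- cnj w)" for j
    by (subst cnj_powr) (auto simp del: of_nat_Suc)
  ultimately have "(\<lambda>j. cnj (chi (int (Suc j))) * of_nat (Suc j) powr (- cnj w)) sums cnj (dirichlet_L chi w)"
    by (simp del: of_nat_Suc)
  moreover have "(\<lambda>j. cnj (chi (int (Suc j))) * of_nat (Suc j) powr (- cnj w)) sums dirichlet_L (\<lambda>a. cnj (chi a)) (cnj w)"
    using dirichlet_L_sums(1)[OF primitive_character_cnj[OF prim] k, of "cnj w"] w by simp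
  ultimately show ?thesis using sums_unique2 by blast
qed

text \<open>The factor 2 makes it the exact limit of \<open>cyclic_xi k chi n s\<close>.\<close>

definition completed_L :: "nat \<Rightarrow> (int \<Rightarrow> complex) \<Rightarrow> complex \<Rightarrow> complex" where
  "completed_L k chi s = 2 * (of_real (real k / pi) powr (s / 2) * Gamma (s / 2) * dirichlet_L chi s)"

text \<open>Both sides are limits of \<open>cyclic_xi k chi n s\<close>: one evaluates the sum
  directly, the other is the leading term of the dual expansion. Passing to moduli in the second
  part removes the root number.\<close>

lemma completed_L_eq_dual:
  assumes prim: "primitive_character k chi" and ev: "even_character chi" and k: "k > 1"
    and s: "Im s \<noteq> 0" "0 < Re s" "Re s < 1"
  shows "completed_L k chi s = dual_factor k chi s * dirichlet_L (\<lambda>a. cnj (chi a)) (1 - s)"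
    and "norm (completed_L k chi s) = norm (completed_L k (\<lambda>a. cnj (chi a)) (1 - s))"
proof -
  define D where "D = dual_factor k chi s * dirichlet_L (\<lambda>a. cnj (chi a)) (1 - s)"
  have inv2: "(\<lambda>n. 1 / of_nat n ^ 2 :: complex) \<longlonglongrightarrow> 0"
  proof -
    have "(\<lambda>m. 1 / real m ^ 2) \<longlonglongrightarrow> 0" by real_asymp
    from tendsto_of_real[OF this, where 'a = complex] show ?thesis by simp
  qed
  from tendsto_mult[OF inv2 cyclic_xi_second_order[OF prim ev k s, folded D_def]]
  have "(\<lambda>n. 1 / of_nat n ^ 2 * (of_nat n ^ 2 * (cyclic_xi k chi n s - D))) \<longlonglongrightarrow> 0" by simp
  moreover have "eventually (\<lambda>n. 1 / of_nat n ^ 2 * (of_nat n ^ 2 * (cyclic_xi k chi n s - D)) = cyclic_xi k chi n s - D) sequentially"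
    using eventually_gt_at_top[of 0] by eventually_elim simp
  ultimately have "(\<lambda>n. cyclic_xi k chi n s - D) \<longlonglongrightarrow> 0" by (rule Lim_transform_eventually)
  from tendsto_add[OF this tendsto_const[of D]] have "(\<lambda>n. cyclic_xi k chi n s) \<longlonglongrightarrow> D" by simp
  moreover have "(\<lambda>n. cyclic_xi k chi n s) \<longlonglongrightarrow> completed_L k chi s"
    unfolding completed_L_def by (rule cyclic_xi_LIMSEQ[OF prim ev k s(2)])
  ultimately show eq: "completed_L k chi s = D" by (intro LIMSEQ_unique)
  have "norm (completed_L k (\<lambda>a. cnj (chi a)) (1 - s)) = 2 * ((real k / pi) powr (Re (1 - s) / 2) * norm (Gamma ((1 - s) / 2))) * norm (dirichlet_L (\<lambda>a. cnj (chi a)) (1 - s))"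
    unfolding completed_L_def norm_mult using k norm_real_powr[of "real k / pi" "(1 - s) / 2"] by simp
  also have "\<dots> = norm D" unfolding D_def norm_mult norm_dual_factor[OF prim s(1)] by simp
  finally show "norm (completed_L k chi s) = norm (completed_L k (\<lambda>a. cnj (chi a)) (1 - s))" using eq by simp
qed

lemma completed_L_eq_0_iff:
  assumes k: "k > 1" and s: "Im s \<noteq> 0"
  shows "completed_L k chi s = 0 \<longleftrightarrow> dirichlet_L chi s = 0"
proof -
  have "Gamma (s / 2) \<noteq> 0" using s by (intro Gamma_nonzero nonreal_not_nonpos_Int) auto
  thus ?thesis using k by (simp add: completed_L_def)
qed

text \<open>
  At a zero of \<open>L(s, \<chi>)\<close> the limit is governed by the \<open>n\<^sup>-\<^sup>2\<close> term of the dual expansion, whose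
  modulus is, up to a factor common to \<open>s\<close> and \<open>1 - s\<close>, the following quantity.
\<close>

definition zero_weight :: "nat \<Rightarrow> (int \<Rightarrow> complex) \<Rightarrow> complex \<Rightarrow> real" where
  "zero_weight k chi s = (real k / pi) powr ((1 - Re s) / 2) * norm (Gamma ((3 - s) / 2)) * norm (dirichlet_L (\<lambda>a. cnj (chi a)) (3 - s))
     * (norm s * norm (2 - s))"

text \<open>The functional equation removes the leading term. The factor \<open>1 - s\<close> of the
  next one is absorbed by \<open>Gamma ((3 - s) / 2) = (1 - s) / 2 * Gamma ((1 - s) / 2)\<close>,
  and the numerical factors leave \<open>2 * 2 / 24 = 1/6\<close>.\<close>

lemma cyclic_xi_at_zero:
  assumes prim: "primitive_character k chi" and ev: "even_character chi" and k: "k > 1"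
    and s: "Im s \<noteq> 0" "0 < Re s" "Re s < 1" and zero: "dirichlet_L chi s = 0"
  shows "(\<lambda>n. real n ^ 2 * norm (cyclic_xi k chi n s)) \<longlonglongrightarrow> zero_weight k chi s / 6"
proof -
  have "dual_factor k chi s * dirichlet_L (\<lambda>a. cnj (chi a)) (1 - s) = 0"
  proof -
    have "completed_L k chi s = 0" by (simp add: completed_L_eq_0_iff[OF k s(1)] zero)
    with completed_L_eq_dual(1)[OF prim ev k s, symmetric] show ?thesis by (rule trans)
  qed
  with tendsto_norm[OF cyclic_xi_second_order[OF prim ev k s]]
  have "(\<lambda>n. real n ^ 2 * norm (cyclic_xi k chi n s)) \<longlonglongrightarrow>
     norm (dual_factor k chi s * (- s * (s - 1) * (s - 2) / 24) * dirichlet_L (\<lambda>a. cnj (chi a)) (3 - s))"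
    by (simp add: norm_mult norm_power)
  also have "norm (dual_factor k chi s * (- s * (s - 1) * (s - 2) / 24) * dirichlet_L (\<lambda>a. cnj (chi a)) (3 - s)) = zero_weight k chi s / 6"
  proof -
    have g: "Gamma ((3 - s) / 2) = (1 - s) / 2 * Gamma ((1 - s) / 2)"
      using Gamma_plus1[of "(1 - s) / 2"] s nonreal_not_nonpos_Int[of "(1 - s) / 2"] by (simp add: field_simps)
    have G: "norm (Gamma ((3 - s) / 2)) = norm (1 - s) / 2 * norm (Gamma ((1 - s) / 2))"
      unfolding g norm_mult norm_divide by simp
    have "norm (- s * (s - 1) * (s - 2) / 24) = norm s * norm (1 - s) * norm (2 - s) / 24"
      by (simp add: norm_mult norm_divide norm_minus_commute)
    thus ?thesis unfolding norm_mult norm_dual_factor[OF prim s(1)] zero_weight_def G by simp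
  qed
  finally show ?thesis .
qed

text \<open>Up to elementary factors both weights are values of one increasing function
  \<open>H\<close>, at \<open>a = Re s\<close> and at \<open>1 - a\<close>: the point
  \<open>2 + s\<close> is \<open>w a\<close>, and \<open>3 - s\<close> is the conjugate of
  \<open>w (1 - a)\<close>.\<close>

lemma zero_weight_less:
  assumes prim: "primitive_character k chi" and k: "k \<ge> 3" and s: "0 < Re s" "Re s < 1 / 2" "Im s \<ge> 8"
  shows "0 < zero_weight k (\<lambda>a. cnj (chi a)) (1 - s)"
    and "zero_weight k (\<lambda>a. cnj (chi a)) (1 - s) < zero_weight k chi s"
proof -
  note chi = primitive_character_imp_dirichlet[OF prim]
  define a t where "a = Re s" and "t = Im s"
  have s_eq: "s = of_real a + \<i> * of_real t" by (simp add: a_def t_def complex_eq_iff)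
  define w where "w = (\<lambda>x. complex_of_real x + (2 + \<i> * of_real t))"
  define H where "H = (\<lambda>x. (real k / pi) powr (x / 2) * cmod (Gamma (w x / 2)) * cmod (dirichlet_L chi (w x)))"
  have mono: "H a < H (1 - a)"
    unfolding H_def w_def
    by (rule completed_L_strict_mono[OF chi_mult[OF chi] chi_1[OF chi] norm_chi_le[OF chi]])
       (use k s in \<open>auto simp: a_def t_def\<close>)
  have pos: "H a > 0"
  proof -
    have "Gamma (w a / 2) \<noteq> 0" using s by (intro Gamma_nonzero nonreal_not_nonpos_Int) (auto simp: w_def t_def)
    moreover have "dirichlet_L chi (w a) \<noteq> 0"
      by (rule dirichlet_L_nonzero[OF chi_mult[OF chi] chi_1[OF chi] norm_chi_le[OF chi]]) (use s in \<open>auto simp: w_def a_def\<close>)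
    ultimately show ?thesis using k by (simp add: H_def)
  qed
  have "zero_weight k (\<lambda>a. cnj (chi a)) (1 - s) = H a * (norm (1 - s) * norm (1 + s))"
  proof -
    have "3 - (1 - s) = w a" "2 - (1 - s) = 1 + s" "(1 - Re (1 - s)) / 2 = a / 2" by (simp_all add: w_def s_eq)
    thus ?thesis by (simp add: zero_weight_def H_def)
  qed
  moreover have "zero_weight k chi s = H (1 - a) * (norm s * norm (2 - s))"
  proof -
    have ws: "3 - s = cnj (w (1 - a))" by (simp add: w_def s_eq complex_eq_iff)
    have "cnj (w (1 - a)) / 2 = cnj (w (1 - a) / 2)" by simp
    hence 1: "norm (Gamma ((3 - s) / 2)) = norm (Gamma (w (1 - a) / 2))"
      unfolding ws by (simp only: cnj_Gamma[symmetric] complex_mod_cnj)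
    have "Re (w (1 - a)) > 0" using s by (simp add: w_def a_def)
    hence 2: "norm (dirichlet_L (\<lambda>a. cnj (chi a)) (3 - s)) = norm (dirichlet_L chi (w (1 - a)))"
      unfolding ws using dirichlet_L_cnj[OF prim, of "w (1 - a)"] k by simp
    show ?thesis unfolding zero_weight_def H_def 1 2 a_def[symmetric] ..
  qed
  moreover have "norm (1 - s) * norm (1 + s) \<le> norm s * norm (2 - s)"
  proof -
    have "(norm (1 - s) * norm (1 + s))\<^sup>2 \<le> (norm s * norm (2 - s))\<^sup>2"
    proof -
      \<comment> \<open>For \<open>a < 1/2\<close> the sign is that of the second factor, positive
        since \<open>1 + 2 * a - 2 * a^2 <= 2\<close> and \<open>t^2 >= 64\<close>.\<close>
      have diff: "(norm s * norm (2 - s))\<^sup>2 - (norm (1 - s) * norm (1 + s))\<^sup>2 = (1 - 2 * a) * (2 * t\<^sup>2 - (1 + 2 * a - 2 * a\<^sup>2))"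
        unfolding power_mult_distrib cmod_power2 by (simp add: s_eq power2_eq_square algebra_simps)
      have "t\<^sup>2 \<ge> 8\<^sup>2" using s by (intro power_mono) (auto simp: t_def)
      hence "t\<^sup>2 \<ge> 64" by simp
      moreover have a: "2 * a \<le> 1" using s by (simp add: a_def)
      ultimately have "1 + 2 * a - 2 * a\<^sup>2 \<le> 2 * t\<^sup>2" using zero_le_power2[of a] by linarith
      with a have "(1 - 2 * a) * (2 * t\<^sup>2 - (1 + 2 * a - 2 * a\<^sup>2)) \<ge> 0"
        by (intro mult_nonneg_nonneg) auto
      with diff show ?thesis by linarith
    qed
    thus ?thesis by (rule power2_le_imp_le) simp
  qed
  moreover have "norm (1 - s) * norm (1 + s) > 0"
    using s by (auto simp: complex_eq_iff)
  ultimately show "0 < zero_weight k (\<lambda>a. cnj (chi a)) (1 - s)"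
    and "zero_weight k (\<lambda>a. cnj (chi a)) (1 - s) < zero_weight k chi s"
    using pos mono by (auto intro: mult_strict_mono' mult_less_le_imp_less)
qed

text \<open>Serves twice: on the critical line, where \<open>1 - s = cnj s\<close>, and off it to
  exchange the two sides of the line.\<close>

lemma zero_weight_reflect:
  assumes prim: "primitive_character k chi" and k: "k > 1" and s: "Re s < 1" "0 < Re s"
  shows "zero_weight k (\<lambda>a. cnj (chi a)) (cnj s) = zero_weight k chi s"
proof -
  have "3 - s = cnj (3 - cnj s)" by simp
  hence 1: "norm (dirichlet_L (\<lambda>a. cnj (chi a)) (3 - s)) = norm (dirichlet_L chi (3 - cnj s))"
    using dirichlet_L_cnj[OF prim k, of "3 - cnj s"] s by simp
  have "(3 - cnj s) / 2 = cnj ((3 - s) / 2)" by simp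
  hence 2: "norm (Gamma ((3 - cnj s) / 2)) = norm (Gamma ((3 - s) / 2))"
    by (simp only: cnj_Gamma[symmetric] complex_mod_cnj)
  have "2 - cnj s = cnj (2 - s)" by simp
  hence 3: "norm (2 - cnj s) = norm (2 - s)" by (simp only: complex_mod_cnj)
  show ?thesis unfolding zero_weight_def complex_cnj_cnj complex_mod_cnj 1 2 3 by simp
qed

text \<open>The first part allows the limits of numerator and denominator to be divided; the second
  says when the quotient is 1.\<close>

lemma zero_weight_quotient:
  assumes prim: "primitive_character k chi" and k: "k \<ge> 3" and s: "0 < Re s" "Re s < 1" "Im s \<ge> 8"
  shows "zero_weight k (\<lambda>a. cnj (chi a)) (1 - s) \<noteq> 0"
    and "zero_weight k chi s = zero_weight k (\<lambda>a. cnj (chi a)) (1 - s) \<longleftrightarrow> Re s = 1 / 2"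
proof -
  define psi where "psi = (\<lambda>a. cnj (chi a))"
  have primc: "primitive_character k psi" unfolding psi_def by (rule primitive_character_cnj[OF prim])
  have cc: "(\<lambda>a. cnj (psi a)) = chi" by (simp add: psi_def)
  have k1: "k > 1" using k by simp
  have half: "1 - s = cnj s" if "Re s = 1 / 2" using that by (simp add: complex_eq_iff)
  text \<open>Reflection in the critical line reduces \<open>Re s > 1/2\<close> to \<open>Re s < 1/2\<close>.\<close>
  define s' where "s' = 1 - cnj s"
  have s': "1 - s = cnj s'" "1 - s' = cnj s" by (simp_all add: s'_def)
  have r: "zero_weight k psi (1 - s) = zero_weight k chi s'" "zero_weight k chi s = zero_weight k psi (1 - s')"
  proof -
    have "Re s' < 1" "0 < Re s'" using s by (simp_all add: s'_def)
    thus "zero_weight k psi (1 - s) = zero_weight k chi s'"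
      unfolding s'(1) psi_def by (rule zero_weight_reflect[OF prim k1])
    show "zero_weight k chi s = zero_weight k psi (1 - s')"
      unfolding s'(2) psi_def by (rule zero_weight_reflect[OF prim k1 s(2,1), symmetric])
  qed
  consider "Re s < 1 / 2" | "Re s = 1 / 2" | "Re s > 1 / 2" by linarith
  hence "zero_weight k psi (1 - s) \<noteq> 0 \<and> (zero_weight k chi s = zero_weight k psi (1 - s) \<longleftrightarrow> Re s = 1 / 2)"
  proof cases
    case 1
    with zero_weight_less[OF prim k s(1) 1 s(3)] show ?thesis unfolding psi_def by auto
  next
    case 2
    have "dirichlet_L chi (3 - cnj s) \<noteq> 0"
    proof -
      note chi = primitive_character_imp_dirichlet[OF prim]
      show ?thesis
        by (rule dirichlet_L_nonzero[OF chi_mult[OF chi] chi_1[OF chi] norm_chi_le[OF chi]]) (use s in auto)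
    qed
    moreover have "Gamma ((3 - cnj s) / 2) \<noteq> 0" using s by (intro Gamma_nonzero nonreal_not_nonpos_Int) auto
    ultimately have "zero_weight k psi (1 - s) \<noteq> 0"
      unfolding half[OF 2] zero_weight_def cc using k s by (auto simp: complex_eq_iff)
    moreover have "zero_weight k psi (1 - s) = zero_weight k chi s"
      unfolding half[OF 2] psi_def by (rule zero_weight_reflect[OF prim k1 s(2,1)])
    ultimately show ?thesis using 2 by simp
  next
    case 3
    have "0 < Re s'" "Re s' < 1 / 2" "Im s' \<ge> 8" using 3 s by (auto simp: s'_def)
    from zero_weight_less[OF prim k this]
    have "0 < zero_weight k psi (1 - s')" "zero_weight k psi (1 - s') < zero_weight k chi s'"
      by (simp_all add: psi_def)
    thus ?thesis using 3 unfolding r by auto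
  qed
  thus "zero_weight k (\<lambda>a. cnj (chi a)) (1 - s) \<noteq> 0"
    and "zero_weight k chi s = zero_weight k (\<lambda>a. cnj (chi a)) (1 - s) \<longleftrightarrow> Re s = 1 / 2"
    unfolding psi_def by auto
qed

theorem theorem1:
  fixes k :: nat and chi :: "int \<Rightarrow> complex"
  assumes "k \<ge> 3"
    and "primitive_character k chi"
    and "even_character chi"
  shows "(\<forall>s. 0 < Re s \<and> Re s < 1 \<and> Im s \<ge> 8 \<longrightarrow>
            (\<lambda>n. cmod (cyclic_xi k chi n s) / cmod (cyclic_xi k (\<lambda>a. cnj (chi a)) n (1 - s)))
              \<longlonglongrightarrow> 1)
         \<longleftrightarrow>
         (\<forall>s. 0 < Re s \<and> Re s < 1 \<and> Im s \<ge> 8 \<and> dirichlet_L chi s = 0 \<longrightarrow> Re s = 1 / 2)"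
proof -
  define psi where "psi = (\<lambda>a. cnj (chi a))"
  have k: "k > 1" using assms(1) by simp
  have primc: "primitive_character k psi" unfolding psi_def by (rule primitive_character_cnj[OF assms(2)])
  have evc: "even_character psi" using assms(3) by (simp add: psi_def even_character_def)
  define q where "q = (\<lambda>s n. cmod (cyclic_xi k chi n s) / cmod (cyclic_xi k psi n (1 - s)))"
  have nonzero: "q s \<longlonglongrightarrow> 1" if s: "0 < Re s" "Re s < 1" "Im s \<ge> 8" and nz: "dirichlet_L chi s \<noteq> 0" for s
  proof -
    have im: "Im s \<noteq> 0" using s by simp
    have eq: "norm (completed_L k chi s) = norm (completed_L k psi (1 - s))"
      unfolding psi_def by (rule completed_L_eq_dual(2)[OF assms(2,3) k im s(1,2)])
    have "completed_L k chi s \<noteq> 0" using completed_L_eq_0_iff[OF k im] nz by simp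
    hence nzc: "completed_L k psi (1 - s) \<noteq> 0" using eq by auto
    have "(\<lambda>n. cyclic_xi k chi n s) \<longlonglongrightarrow> completed_L k chi s"
      unfolding completed_L_def by (rule cyclic_xi_LIMSEQ[OF assms(2,3) k s(1)])
    moreover have "(\<lambda>n. cyclic_xi k psi n (1 - s)) \<longlonglongrightarrow> completed_L k psi (1 - s)"
      unfolding completed_L_def by (rule cyclic_xi_LIMSEQ[OF primc evc k]) (use s in simp)
    ultimately have "q s \<longlonglongrightarrow> norm (completed_L k chi s) / norm (completed_L k psi (1 - s))"
      unfolding q_def using nzc by (intro tendsto_divide tendsto_norm) auto
    moreover have "norm (completed_L k chi s) / norm (completed_L k psi (1 - s)) = 1"
      unfolding eq using nzc by simp
    ultimately show ?thesis by simp
  qed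
  \<comment> \<open>The functional equation makes \<open>dirichlet_L psi (1 - s)\<close> vanish as
    well. Hence numerator and denominator are both of order \<open>n^-2\<close>, and
    \<open>q s\<close> tends to \<open>W / W'\<close>.\<close>
  have zero: "q s \<longlonglongrightarrow> 1 \<longleftrightarrow> Re s = 1 / 2" if s: "0 < Re s" "Re s < 1" "Im s \<ge> 8" and z: "dirichlet_L chi s = 0" for s
  proof -
    have im: "Im s \<noteq> 0" "Im (1 - s) \<noteq> 0" using s by auto
    have "completed_L k chi s = 0" using completed_L_eq_0_iff[OF k im(1)] z by simp
    with completed_L_eq_dual(2)[OF assms(2,3) k im(1) s(1,2), folded psi_def]
    have "completed_L k psi (1 - s) = 0" by simp
    hence z': "dirichlet_L psi (1 - s) = 0" using completed_L_eq_0_iff[OF k im(2)] by simp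
    define W W' where "W = zero_weight k chi s" and "W' = zero_weight k psi (1 - s)"
    have W: "W' \<noteq> 0" "W = W' \<longleftrightarrow> Re s = 1 / 2"
      using zero_weight_quotient[OF assms(2,1) s] unfolding W_def W'_def psi_def by auto
    have "(\<lambda>n. real n ^ 2 * norm (cyclic_xi k chi n s)) \<longlonglongrightarrow> W / 6"
      unfolding W_def by (rule cyclic_xi_at_zero[OF assms(2,3) k im(1) s(1,2) z])
    moreover have "(\<lambda>n. real n ^ 2 * norm (cyclic_xi k psi n (1 - s))) \<longlonglongrightarrow> W' / 6"
      unfolding W'_def by (rule cyclic_xi_at_zero[OF primc evc k im(2) _ _ z']) (use s in auto)
    ultimately have "(\<lambda>n. (real n ^ 2 * norm (cyclic_xi k chi n s)) / (real n ^ 2 * norm (cyclic_xi k psi n (1 - s)))) \<longlonglongrightarrow> (W / 6) / (W' / 6)"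
      using W by (intro tendsto_divide) auto
    moreover have "eventually (\<lambda>n. (real n ^ 2 * norm (cyclic_xi k chi n s)) / (real n ^ 2 * norm (cyclic_xi k psi n (1 - s))) = q s n) sequentially"
      using eventually_gt_at_top[of 0] by eventually_elim (simp add: q_def)
    ultimately have lim: "q s \<longlonglongrightarrow> (W / 6) / (W' / 6)" by (rule Lim_transform_eventually)
    have "q s \<longlonglongrightarrow> 1 \<longleftrightarrow> (W / 6) / (W' / 6) = 1"
    proof
      assume "q s \<longlonglongrightarrow> 1"
      with lim show "(W / 6) / (W' / 6) = 1" by (rule LIMSEQ_unique)
    qed (use lim in simp)
    also have "(W / 6) / (W' / 6) = 1 \<longleftrightarrow> W = W'" using W(1) by auto
    also note W(2)
    finally show ?thesis .
  qed
  have "(\<forall>s. 0 < Re s \<and> Re s < 1 \<and> Im s \<ge> 8 \<longrightarrow> q s \<longlonglongrightarrow> 1) \<longleftrightarrow>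
        (\<forall>s. 0 < Re s \<and> Re s < 1 \<and> Im s \<ge> 8 \<and> dirichlet_L chi s = 0 \<longrightarrow> Re s = 1 / 2)"
    using nonzero zero by blast
  thus ?thesis unfolding q_def psi_def .
qed

end
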